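(* Let $p,q>0$ and $a\in\mathbb{R}$, let $(W_t)_{t\ge 0}$, $(W^{(1)}_t)_{t\ge 0}$, $(W^{(2)}_t)_{t\ge 0}$ be three independent standard one-dimensional Brownian motions (started at $0$), and let $\mathfrak Z_t=(X_t,Y_t,Z_t)$, $t\ge0$, be the Brownian motion with drift on $\mathrm{Sol}(p,q)$ given by $$Z_t = a\,t + W_t,\qquad X_t=\int_0^t e^{pZ_s}\,dW^{(1)}_s,\qquad Y_t=\int_0^t e^{-qZ_s}\,dW^{(2)}_s .$$ Let $\mathcal N=W_1$, $\underline{\mathcal M}=\min\{W_t:0\le t\le 1\}$, $\overline{\mathcal M}=\max\{W_t:0\le t\le 1\}$ and $\mathfrak o=(0,0,0)$. If $a\neq 0$, then $$\frac{d_{\mathrm{Sol}}(\mathfrak Z_t,\mathfrak o)-|a|\,t}{\sqrt t}\to\mathcal N\quad\text{in law, as }t\to\infty.$$ If $a=0$, then $$\frac{d_{\mathrm{Sol}}(\mathfrak Z_t,\mathfrak o)}{\sqrt t}\to 2(\overline{\mathcal M}-\underline{\mathcal M})-|\mathcal N|\quad\text{in law, as }t\to\infty.$$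
   Context: $\mathrm{Sol}(p,q)$ is $\mathbb{R}^3$ with coordinates $(x,y,z)$ and the Riemannian metric $ds^2=e^{-2pz}\,dx^2+e^{2qz}\,dy^2+dz^2$; $d_{\mathrm{Sol}}$ denotes the induced Riemannian distance. The integrals are Itô stochastic integrals; $(\mathfrak Z_t)$ is the diffusion started at $\mathfrak o$ with infinitesimal generator $\frac12\bigl(e^{2pz}\partial_x^2+e^{-2qz}\partial_y^2+\partial_z^2\bigr)+a\,\partial_z$. *)

theory Defs
  imports "HOL-Probability.Probability"
begin

definition sol_metric ::
    "real \<Rightarrow> real \<Rightarrow> real \<times> real \<times> real \<Rightarrow> real \<times> real \<times> real \<Rightarrow> real \<times> real \<times> real \<Rightarrow> real" where
  "sol_metric p q = (\<lambda>(x, y, z) (u1, u2, u3) (v1, v2, v3).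
     exp (- 2 * p * z) * u1 * v1 + exp (2 * q * z) * u2 * v2 + u3 * v3)"

definition sol_speed ::
    "real \<Rightarrow> real \<Rightarrow> (real \<Rightarrow> real \<times> real \<times> real) \<Rightarrow> real \<Rightarrow> real" where
  "sol_speed p q \<gamma> t =
     (let v = vector_derivative \<gamma> (at t within {0..1}) in sqrt (sol_metric p q (\<gamma> t) v v))"

definition sol_length :: "real \<Rightarrow> real \<Rightarrow> (real \<Rightarrow> real \<times> real \<times> real) \<Rightarrow> real" where
  "sol_length p q \<gamma> = integral {0..1} (sol_speed p q \<gamma>)"

text \<open>
  The infimum of the lengths of piecewise continuously differentiable curves. The predicate
  \<^const>\<open>valid_path\<close> does not bound the derivative near the finitely many exceptional parameters,
  so a valid path can have infinite length; the integral would then take the default value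
  \<open>0\<close>. The integrability condition excludes such curves.
\<close>
definition sol_dist ::
    "real \<Rightarrow> real \<Rightarrow> real \<times> real \<times> real \<Rightarrow> real \<times> real \<times> real \<Rightarrow> real" where
  "sol_dist p q u v =
     Inf {sol_length p q \<gamma> | \<gamma>. valid_path \<gamma> \<and> sol_speed p q \<gamma> integrable_on {0..1} \<and>
                               pathstart \<gamma> = u \<and> pathfinish \<gamma> = v}"

text \<open>
  Processes have type \<open>real \<Rightarrow> 'a \<Rightarrow> real\<close>; only their values at times \<open>t \<ge> 0\<close> are meaningful.
\<close>
definition standard_brownian_motion :: "'a measure \<Rightarrow> (real \<Rightarrow> 'a \<Rightarrow> real) \<Rightarrow> bool" where
  "standard_brownian_motion M B \<longleftrightarrow>
     (\<forall>t\<ge>0. B t \<in> borel_measurable M) \<and>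
     (\<forall>\<omega>\<in>space M. B 0 \<omega> = 0) \<and>
     (\<forall>\<omega>\<in>space M. continuous_on {0..} (\<lambda>t. B t \<omega>)) \<and>
     (\<forall>s t. 0 \<le> s \<and> s < t \<longrightarrow>
        distributed M lborel (\<lambda>\<omega>. B t \<omega> - B s \<omega>) (normal_density 0 (sqrt (t - s)))) \<and>
     (\<forall>(n::nat) \<tau>. 0 \<le> \<tau> 0 \<and> (\<forall>i<n. \<tau> i \<le> \<tau> (Suc i)) \<longrightarrow>
        prob_space.indep_vars M (\<lambda>_. borel) (\<lambda>i \<omega>. B (\<tau> (Suc i)) \<omega> - B (\<tau> i) \<omega>) {..<n})"

definition natural_filtration ::
    "'a measure \<Rightarrow> (real \<Rightarrow> 'a \<Rightarrow> 'b::topological_space) \<Rightarrow> real \<Rightarrow> 'a measure" where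
  "natural_filtration M \<xi> t =
     sigma (space M) {\<xi> s -` A \<inter> space M | s A. 0 \<le> s \<and> s \<le> t \<and> A \<in> sets borel}"

text \<open>
  A step process \<open>\<Sum>i<n. h i * indicator {k i<..k (Suc i)}\<close> with knots \<open>0 \<le> k 0 \<le> \<dots> \<le> k n\<close> and
  bounded heights \<open>h i\<close>, each measurable with respect to the information at time \<open>k i\<close>.
\<close>
record 'a step_process =
  steps :: nat
  knot :: "nat \<Rightarrow> real"
  height :: "nat \<Rightarrow> 'a \<Rightarrow> real"

definition adapted_step_process ::
    "'a measure \<Rightarrow> (real \<Rightarrow> 'a measure) \<Rightarrow> 'a step_process \<Rightarrow> bool" where
  "adapted_step_process M F \<phi> \<longleftrightarrow>
     0 \<le> knot \<phi> 0 \<and>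
     (\<forall>i<steps \<phi>. knot \<phi> i \<le> knot \<phi> (Suc i)) \<and>
     (\<forall>i<steps \<phi>. height \<phi> i \<in> borel_measurable (F (knot \<phi> i))) \<and>
     (\<forall>i<steps \<phi>. \<exists>C. \<forall>\<omega>\<in>space M. \<bar>height \<phi> i \<omega>\<bar> \<le> C)"

definition step_value :: "'a step_process \<Rightarrow> real \<Rightarrow> 'a \<Rightarrow> real" where
  "step_value \<phi> s \<omega> =
     (\<Sum>i<steps \<phi>. height \<phi> i \<omega> * indicator {knot \<phi> i<..knot \<phi> (Suc i)} s)"

definition step_integral ::
    "(real \<Rightarrow> 'a \<Rightarrow> real) \<Rightarrow> real \<Rightarrow> 'a step_process \<Rightarrow> 'a \<Rightarrow> real" where
  "step_integral B t \<phi> \<omega> =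
     (\<Sum>i<steps \<phi>. height \<phi> i \<omega> * (B (min t (knot \<phi> (Suc i))) \<omega> - B (min t (knot \<phi> i)) \<omega>))"

text \<open>Progressively measurable and square integrable on \<open>[0,t] \<times> \<Omega>\<close>.\<close>
definition ito_integrand ::
    "'a measure \<Rightarrow> (real \<Rightarrow> 'a measure) \<Rightarrow> real \<Rightarrow> (real \<Rightarrow> 'a \<Rightarrow> real) \<Rightarrow> bool" where
  "ito_integrand M F t H \<longleftrightarrow>
     (\<forall>u\<in>{0..t}. (\<lambda>(s, \<omega>). H s \<omega>) \<in> borel_measurable (restrict_space borel {0..u} \<Otimes>\<^sub>M F u)) \<and>
     (\<integral>\<^sup>+\<omega>. (\<integral>\<^sup>+s\<in>{0..t}. ennreal ((H s \<omega>)\<^sup>2) \<partial>lborel) \<partial>M) < \<infinity>"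

text \<open>
  \<open>J\<close> is (a version of) the integral of \<open>H\<close> against \<open>B\<close> over \<open>[0,t]\<close>: the \<open>L\<^sup>2\<close>-limit of the
  integrals of step processes that approximate \<open>H\<close> in \<open>L\<^sup>2([0,t] \<times> \<Omega>)\<close>. If \<open>B\<close> is a Brownian
  motion relative to \<open>F\<close>, then by the isometry such a \<open>J\<close> exists, is almost surely unique and does
  not depend on the approximating sequence.
\<close>
definition is_ito_integral ::
    "'a measure \<Rightarrow> (real \<Rightarrow> 'a measure) \<Rightarrow> (real \<Rightarrow> 'a \<Rightarrow> real) \<Rightarrow> (real \<Rightarrow> 'a \<Rightarrow> real) \<Rightarrow>
     real \<Rightarrow> ('a \<Rightarrow> real) \<Rightarrow> bool" where
  "is_ito_integral M F B H t J \<longleftrightarrow>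
     ito_integrand M F t H \<and> J \<in> borel_measurable M \<and>
     (\<exists>\<phi> :: nat \<Rightarrow> 'a step_process.
        (\<forall>n. adapted_step_process M F (\<phi> n)) \<and>
        (\<lambda>n. \<integral>\<^sup>+\<omega>. (\<integral>\<^sup>+s\<in>{0..t}. ennreal ((step_value (\<phi> n) s \<omega> - H s \<omega>)\<^sup>2) \<partial>lborel) \<partial>M)
          \<longlonglongrightarrow> 0 \<and>
        (\<lambda>n. \<integral>\<^sup>+\<omega>. ennreal ((step_integral B t (\<phi> n) \<omega> - J \<omega>)\<^sup>2) \<partial>M) \<longlonglongrightarrow> 0)"

definition is_ito_integral_process ::
    "'a measure \<Rightarrow> (real \<Rightarrow> 'a measure) \<Rightarrow> (real \<Rightarrow> 'a \<Rightarrow> real) \<Rightarrow> (real \<Rightarrow> 'a \<Rightarrow> real) \<Rightarrow>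
     (real \<Rightarrow> 'a \<Rightarrow> real) \<Rightarrow> bool" where
  "is_ito_integral_process M F B H X \<longleftrightarrow>
     (\<forall>t\<ge>0. is_ito_integral M F B H t (X t)) \<and>
     (AE \<omega> in M. continuous_on {0..} (\<lambda>t. X t \<omega>))"

text \<open>
  The analogue of \<^const>\<open>weak_conv_m\<close>, which is restricted to sequences, for \<open>t \<rightarrow> \<infinity>\<close> along the
  reals. Measurability is required because \<^const>\<open>distr\<close> is not meaningful for a non-measurable map.
\<close>
definition converges_in_law_at_top ::
    "'a measure \<Rightarrow> (real \<Rightarrow> 'a \<Rightarrow> real) \<Rightarrow> ('a \<Rightarrow> real) \<Rightarrow> bool" where
  "converges_in_law_at_top M \<xi> \<eta> \<longleftrightarrow>
     (\<forall>\<^sub>F t in at_top. \<xi> t \<in> borel_measurable M) \<and> \<eta> \<in> borel_measurable M \<and>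
     (\<forall>x. isCont (cdf (distr M borel \<eta>)) x \<longrightarrow>
        ((\<lambda>t. cdf (distr M borel (\<xi> t)) x) \<longlongrightarrow> cdf (distr M borel \<eta>) x) at_top)"

end

theory Submission
  imports Defs "HOL-Real_Asymp.Real_Asymp"
begin

text \<open>
  Moving in the direction \<open>x\<close> is cheap at great heights \<open>z\<close>, moving in the direction \<open>y\<close> is cheap
  at great depths. A curve from \<open>(x, y, z)\<close> to the origin that is not exponentially long must
  therefore climb to the height \<open>ln \<bar>x\<bar> / p\<close> in order to cancel \<open>x\<close>, and descend to the depth
  \<open>- ln \<bar>y\<bar> / q\<close> in order to cancel \<open>y\<close>. If \<open>T\<close> and \<open>b\<close> are the highest and the lowest level that
  have to be visited, the endpoints included, then the vertical travel alone costs
  \<open>2 (T - b) - \<bar>z\<bar>\<close>, and this is the distance to the origin up to an error that is logarithmic in the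
  distance (\<open>sol_dist_upper\<close>, \<open>sol_dist_lower\<close>).

  Given the path of \<open>W\<close>, the variable \<open>X t\<close> is a centred Gaussian variable whose variance is the
  integral of \<open>exp (2 p Z)\<close> over \<open>[0, t]\<close>. By Laplace's principle this is \<open>exp (2 p max Z)\<close> up to a
  factor \<open>exp (o (sqrt t))\<close>, so that \<open>ln \<bar>X t\<bar> / p\<close> is the maximum of \<open>Z\<close> over \<open>[0, t]\<close> up to
  \<open>o (sqrt t)\<close> in probability; in the same way \<open>- ln \<bar>Y t\<bar> / q\<close> is the minimum
  (\<open>exponential_ito_integral_size\<close>). Hence the distance differs by \<open>o (sqrt t)\<close> from
  \<open>2 (max Z - min Z) - \<bar>Z t\<bar>\<close> (\<open>sol_distance_close_to_range\<close>). If \<open>a = 0\<close>, Brownian scaling says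
  that this variable divided by \<open>sqrt t\<close> has exactly the law of the claimed limit. If
  \<open>a \<noteq> 0\<close>, the drift makes \<open>Z\<close> nearly monotone: at the scale \<open>sqrt t\<close> one of its extrema is attained
  at time \<open>0\<close> and the other one at time \<open>t\<close>, and the variable reduces to \<open>\<bar>Z t\<bar>\<close>, that is, to
  \<open>\<bar>a\<bar> t + sgn a W t\<close>, up to \<open>o (sqrt t)\<close> (\<open>range_of_drifted_path\<close>). Errors that vanish in probability do not change
  limits in law (\<open>converges_in_law_if_close\<close>).

  The conditional law of \<open>X t\<close> is never constructed. The Ito integral is defined as a limit of
  integrals of arbitrary adapted step processes, whose heights may depend on the integrating
  Brownian motion. By the isometry, the step processes that sample the integrand at the points
  of a uniform grid and truncate it lead to the same limit (\<open>ito_integral_grid_limit\<close>). Their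
  heights are functions of \<open>W\<close> alone, so by Fubini's theorem their integrals are exactly
  Gaussian once \<open>W\<close> is fixed (\<open>grid_sum_bounds\<close>). The resulting tail and small-ball
  estimates pass to the limit by Fatou's lemma (\<open>ito_integral_conditional_bounds\<close>).
\<close>

section \<open>Lengths and distances in Sol\<close>

lemma sol_metric_diag:
  "sol_metric p q (x, y, z) (u1, u2, u3) (u1, u2, u3) =
     (exp (- p * z) * u1)\<^sup>2 + (exp (q * z) * u2)\<^sup>2 + u3\<^sup>2"
proof -
  have "exp (- 2 * p * z) = exp (- p * z) ^ 2" "exp (2 * q * z) = exp (q * z) ^ 2"
    by (simp_all flip: exp_of_nat_mult add: field_simps)
  then show ?thesis by (simp add: sol_metric_def power2_eq_square)
qed

lemma sol_metric_nonneg: "sol_metric p q P v v \<ge> 0"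
  by (cases P; cases v) (simp add: sol_metric_diag)

lemma sol_metric_scale: "sol_metric p q P (r *\<^sub>R v) (r *\<^sub>R v) = r\<^sup>2 * sol_metric p q P v v"
  by (cases P; cases v) (simp add: sol_metric_def algebra_simps power2_eq_square)

lemma sol_speed_nonneg: "sol_speed p q \<gamma> t \<ge> 0"
  by (simp add: sol_speed_def Let_def sol_metric_nonneg)

lemma sol_norm_bounds:
  fixes p q x y z u1 u2 u3 :: real
  defines "S \<equiv> sqrt (sol_metric p q (x, y, z) (u1, u2, u3) (u1, u2, u3))"
  shows "exp (- p * z) * \<bar>u1\<bar> \<le> S" "exp (q * z) * \<bar>u2\<bar> \<le> S" "\<bar>u3\<bar> \<le> S"
    "S \<le> exp (- p * z) * \<bar>u1\<bar> + exp (q * z) * \<bar>u2\<bar> + \<bar>u3\<bar>"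
proof -
  define a b c where "a = exp (- p * z) * u1" and "b = exp (q * z) * u2" and "c = u3"
  have S: "S = sqrt (a\<^sup>2 + b\<^sup>2 + c\<^sup>2)"
    by (simp add: S_def sol_metric_diag a_def b_def c_def)
  have abs: "\<bar>a\<bar> = exp (- p * z) * \<bar>u1\<bar>" "\<bar>b\<bar> = exp (q * z) * \<bar>u2\<bar>" "\<bar>c\<bar> = \<bar>u3\<bar>"
    by (simp_all add: a_def b_def c_def abs_mult)
  have "\<bar>a\<bar> \<le> S" "\<bar>b\<bar> \<le> S" "\<bar>c\<bar> \<le> S"
    unfolding S by (auto intro!: real_le_rsqrt)
  moreover have "S \<le> \<bar>a\<bar> + \<bar>b\<bar> + \<bar>c\<bar>"
  proof -
    have "S \<le> sqrt (a\<^sup>2 + b\<^sup>2) + sqrt (c\<^sup>2)"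
      unfolding S by (rule sqrt_add_le_add_sqrt) auto
    also have "sqrt (a\<^sup>2 + b\<^sup>2) \<le> sqrt (a\<^sup>2) + sqrt (b\<^sup>2)"
      by (rule sqrt_add_le_add_sqrt) auto
    finally have "S \<le> sqrt (a\<^sup>2) + sqrt (b\<^sup>2) + sqrt (c\<^sup>2)" by simp
    then show ?thesis by simp
  qed
  ultimately show "exp (- p * z) * \<bar>u1\<bar> \<le> S" "exp (q * z) * \<bar>u2\<bar> \<le> S" "\<bar>u3\<bar> \<le> S"
    "S \<le> exp (- p * z) * \<bar>u1\<bar> + exp (q * z) * \<bar>u2\<bar> + \<bar>u3\<bar>"
    unfolding abs by auto
qed

lemma valid_path_has_vector_derivative:
  assumes "valid_path \<gamma>"
  obtains S where "finite S" "continuous_on {0..1} \<gamma>"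
    "\<And>t. t \<in> {0..1} - S \<Longrightarrow>
       (\<gamma> has_vector_derivative vector_derivative \<gamma> (at t within {0..1})) (at t)"
proof -
  obtain S D where S: "finite S" "continuous_on {0..1} \<gamma>"
    and D: "\<And>t. t \<in> {0..1} - S \<Longrightarrow> (\<gamma> has_vector_derivative D t) (at t)"
    using assms
    unfolding valid_path_def piecewise_C1_differentiable_on_def C1_differentiable_on_def
    by metis
  show thesis
  proof (rule that[OF S])
    fix t assume t: "t \<in> {0..1} - S"
    have "vector_derivative \<gamma> (at t within {0..1}) = D t"
      using t by (intro vector_derivative_at_within_ivl[OF D]) auto
    with D[OF t] show "(\<gamma> has_vector_derivative vector_derivative \<gamma> (at t within {0..1})) (at t)"
      by simp
  qed
qed

text \<open>The curves over which the infimum in \<^const>\<open>sol_dist\<close> is taken.\<close>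

definition sol_curve :: "real \<Rightarrow> real \<Rightarrow> (real \<Rightarrow> real \<times> real \<times> real) \<Rightarrow> bool" where
  "sol_curve p q \<gamma> \<longleftrightarrow> valid_path \<gamma> \<and> sol_speed p q \<gamma> integrable_on {0..1}"

lemma sol_dist_alt:
  "sol_dist p q u v =
     Inf {sol_length p q \<gamma> | \<gamma>. sol_curve p q \<gamma> \<and> pathstart \<gamma> = u \<and> pathfinish \<gamma> = v}"
  by (simp add: sol_dist_def sol_curve_def conj_assoc)

text \<open>By the fundamental theorem of calculus, since the derivative of \<open>f\<close> along the curve is
  dominated by the speed. For the height this is applied with \<open>k = 1\<close>; for \<open>x\<close> and \<open>y\<close> the constant
  is the square root of the metric coefficient at an extreme height of the curve.\<close>

lemma increment_le_length:
  fixes f :: "real \<times> real \<times> real \<Rightarrow> real"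
  assumes "bounded_linear f" and \<gamma>: "sol_curve p q \<gamma>"
    and ab: "0 \<le> a" "a \<le> b" "b \<le> 1" and k: "k \<ge> 0"
    and le: "\<And>t v. t \<in> {a..b} \<Longrightarrow> k * \<bar>f v\<bar> \<le> sqrt (sol_metric p q (\<gamma> t) v v)"
  shows "k * \<bar>f (\<gamma> b) - f (\<gamma> a)\<bar> \<le> integral {a..b} (sol_speed p q \<gamma>)"
proof -
  interpret f: bounded_linear f by fact
  define D where "D t = vector_derivative \<gamma> (at t within {0..1})" for t
  obtain S where S: "finite S" "continuous_on {0..1} \<gamma>"
    and D: "\<And>t. t \<in> {0..1} - S \<Longrightarrow> (\<gamma> has_vector_derivative D t) (at t)"
    using valid_path_has_vector_derivative \<gamma> unfolding D_def sol_curve_def by metis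
  have 1: "((\<lambda>t. f (D t)) has_integral (f (\<gamma> b) - f (\<gamma> a))) {a..b}"
  proof (rule fundamental_theorem_of_calculus_interior_strong[OF S(1) ab(2)])
    show "continuous_on {a..b} (\<lambda>t. f (\<gamma> t))"
      by (intro f.continuous_on continuous_on_subset[OF S(2)]) (use ab in auto)
    fix t assume "t \<in> {a<..<b} - S"
    then show "((\<lambda>t. f (\<gamma> t)) has_vector_derivative f (D t)) (at t)"
      using ab by (intro f.has_vector_derivative D) auto
  qed
  have 2: "sol_speed p q \<gamma> integrable_on {a..b}"
    using \<gamma> ab unfolding sol_curve_def by (auto intro: integrable_subinterval_real)
  have "norm (integral {a..b} (\<lambda>t. k * f (D t))) \<le> integral {a..b} (sol_speed p q \<gamma>)"
  proof (rule integral_norm_bound_integral)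
    show "(\<lambda>t. k * f (D t)) integrable_on {a..b}"
      using has_integral_mult_right[OF 1, of k] by (auto simp: integrable_on_def)
    fix t assume "t \<in> {a..b}"
    from le[OF this, of "D t"] show "norm (k * f (D t)) \<le> sol_speed p q \<gamma> t"
      using k by (simp add: sol_speed_def D_def abs_mult Let_def)
  qed fact
  also have "integral {a..b} (\<lambda>t. k * f (D t)) = k * (f (\<gamma> b) - f (\<gamma> a))"
    using has_integral_mult_right[OF 1, of k] by (rule integral_unique)
  finally show ?thesis using k by (simp add: abs_mult)
qed

lemma sol_length_nonneg: "sol_length p q \<gamma> \<ge> 0"
  unfolding sol_length_def
  by (cases "sol_speed p q \<gamma> integrable_on {0..1}")
     (auto intro!: integral_nonneg simp: sol_speed_nonneg not_integrable_integral)

lemma sol_lengths_bdd_below: "bdd_below {sol_length p q \<gamma> | \<gamma>. P \<gamma>}"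
  by (rule bdd_belowI[of _ 0]) (auto simp: sol_length_nonneg)

lemma sol_dist_le_length:
  assumes "sol_curve p q \<gamma>" "pathstart \<gamma> = u" "pathfinish \<gamma> = v"
  shows "sol_dist p q u v \<le> sol_length p q \<gamma>"
  unfolding sol_dist_alt using assms by (intro cInf_lower sol_lengths_bdd_below) blast

text \<open>A linear parametrisation has constant speed if the metric does not vary along the segment.\<close>

lemma sol_segment:
  assumes const: "\<And>t. t \<in> {0..1} \<Longrightarrow> sol_metric p q (linepath u v t) = sol_metric p q u"
  shows "sol_curve p q (linepath u v)"
    "sol_length p q (linepath u v) = sqrt (sol_metric p q u (v - u) (v - u))"
proof -
  have *: "sol_speed p q (linepath u v) t = sqrt (sol_metric p q u (v - u) (v - u))"
    if "t \<in> {0..1}" for t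
  proof -
    have "vector_derivative (linepath u v) (at t within {0..1}) = v - u"
      using that by (intro vector_derivative_at_within_ivl[OF has_vector_derivative_linepath_within]) auto
    then show ?thesis using const[OF that] by (simp add: sol_speed_def Let_def)
  qed
  have "((\<lambda>t. sqrt (sol_metric p q u (v - u) (v - u))) has_integral
          sqrt (sol_metric p q u (v - u) (v - u))) {0..1::real}"
    using has_integral_const_real[of "sqrt (sol_metric p q u (v - u) (v - u))" 0 1] by simp
  then have **: "(sol_speed p q (linepath u v) has_integral
      sqrt (sol_metric p q u (v - u) (v - u))) {0..1}"
    by (rule has_integral_eq[rotated]) (simp add: *)
  show "sol_curve p q (linepath u v)" using ** by (auto simp: sol_curve_def integrable_on_def)
  show "sol_length p q (linepath u v) = sqrt (sol_metric p q u (v - u) (v - u))"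
    using ** by (auto simp: sol_length_def integral_unique)
qed

text \<open>Each half of the concatenation runs at double speed over half of the parameter interval. The
  one-sided derivatives at the junction may differ, which affects a single parameter only.\<close>

lemma sol_join:
  assumes g1: "sol_curve p q g1" and g2: "sol_curve p q g2"
    and eq: "pathfinish g1 = pathstart g2"
  shows "sol_curve p q (g1 +++ g2)"
    "sol_length p q (g1 +++ g2) = sol_length p q g1 + sol_length p q g2"
proof -
  define D where "D g t = vector_derivative g (at t within {0..1})" for g :: "real \<Rightarrow> real \<times> real \<times> real" and t
  have sp: "sol_speed p q g t = sqrt (sol_metric p q (g t) (D g t) (D g t))" for g t
    by (simp add: sol_speed_def D_def Let_def)
  obtain S1 where S1: "finite S1"
    "\<And>t. t \<in> {0..1} - S1 \<Longrightarrow> (g1 has_vector_derivative D g1 t) (at t)"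
    using valid_path_has_vector_derivative g1 unfolding D_def sol_curve_def by metis
  obtain S2 where S2: "finite S2"
    "\<And>t. t \<in> {0..1} - S2 \<Longrightarrow> (g2 has_vector_derivative D g2 t) (at t)"
    using valid_path_has_vector_derivative g2 unfolding D_def sol_curve_def by metis
  have scale: "sqrt (sol_metric p q P (2 *\<^sub>R v) (2 *\<^sub>R v)) = 2 * sqrt (sol_metric p q P v v)" for P v
    by (subst sol_metric_scale) (simp add: real_sqrt_mult)
  have I1: "(sol_speed p q g1 has_integral sol_length p q g1) {0..1}"
    and I2: "(sol_speed p q g2 has_integral sol_length p q g2) {0..1}"
    using g1 g2 by (auto simp: sol_curve_def sol_length_def integrable_integral)
  have i1: "((\<lambda>t. 2 * sol_speed p q g1 (2*t)) has_integral sol_length p q g1) {0..1/2}"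
   and i2: "((\<lambda>t. 2 * sol_speed p q g2 (2*t - 1)) has_integral sol_length p q g2) {1/2..1}"
    using has_integral_affinity01 [OF I1, where m= 2 and c=0, THEN has_integral_cmul [where c=2]]
          has_integral_affinity01 [OF I2, where m= 2 and c="-1", THEN has_integral_cmul [where c=2]]
    by (simp_all only: image_affinity_atLeastAtMost_div_diff, simp_all add: mult_ac)
  have d1: "D (g1 +++ g2) z = 2 *\<^sub>R D g1 (2 * z)" if "0 \<le> z" "z < 1/2" "2 * z \<notin> S1" for z
  proof -
    have "((*) 2 has_vector_derivative 2) (at z)"
      by (simp add: has_vector_derivative_def has_derivative_def bounded_linear_mult_left)
    moreover have "(g1 has_vector_derivative D g1 (2 * z)) (at (2 * z))"
      using that by (intro S1(2)) auto
    ultimately have "((\<lambda>x. g1 (2 * x)) has_vector_derivative 2 *\<^sub>R D g1 (2 * z)) (at z)"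
      using vector_diff_chain_at[of "(*) 2" 2 z g1 "D g1 (2 * z)"] by (simp add: o_def)
    then have "((g1 +++ g2) has_vector_derivative 2 *\<^sub>R D g1 (2 * z)) (at z)"
      by (rule has_vector_derivative_transform_within[where d = "\<bar>z - 1/2\<bar>"])
         (use that in \<open>auto simp: joinpaths_def dist_real_def abs_if split: if_split_asm\<close>)
    then show ?thesis
      unfolding D_def[of "g1 +++ g2"] using that by (intro vector_derivative_at_within_ivl) auto
  qed
  have d2: "D (g1 +++ g2) z = 2 *\<^sub>R D g2 (2 * z - 1)" if "1/2 < z" "z \<le> 1" "2 * z - 1 \<notin> S2" for z
  proof -
    have "((\<lambda>x. 2 * x - 1) has_vector_derivative 2) (at z)"
      by (auto intro!: derivative_eq_intros simp: has_real_derivative_iff_has_vector_derivative[symmetric])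
    moreover have "(g2 has_vector_derivative D g2 (2 * z - 1)) (at (2 * z - 1))"
      using that by (intro S2(2)) auto
    ultimately have "((\<lambda>x. g2 (2 * x - 1)) has_vector_derivative 2 *\<^sub>R D g2 (2 * z - 1)) (at z)"
      using vector_diff_chain_at[of "\<lambda>x. 2 * x - 1" 2 z g2 "D g2 (2 * z - 1)"] by (simp add: o_def)
    then have "((g1 +++ g2) has_vector_derivative 2 *\<^sub>R D g2 (2 * z - 1)) (at z)"
      by (rule has_vector_derivative_transform_within[where d = "\<bar>z - 1/2\<bar>"])
         (use that in \<open>auto simp: joinpaths_def dist_real_def abs_if split: if_split_asm\<close>)
    then show ?thesis
      unfolding D_def[of "g1 +++ g2"] using that by (intro vector_derivative_at_within_ivl) auto
  qed
  have j1: "(sol_speed p q (g1 +++ g2) has_integral sol_length p q g1) {0..1/2}"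
  proof (rule has_integral_spike_finite[OF _ _ i1])
    show "finite (insert (1/2) ((*) 2 -` S1))"
      using S1(1) by (intro finite.insertI finite_vimageI) (auto simp: inj_on_def)
    fix t :: real assume "t \<in> {0..1/2} - insert (1/2) ((*) 2 -` S1)"
    then have t: "0 \<le> t" "t < 1/2" "2 * t \<notin> S1" by auto
    have "(g1 +++ g2) t = g1 (2 * t)" using t(2) by (simp add: joinpaths_def)
    with d1[OF t]
    show "sol_speed p q (g1 +++ g2) t = 2 * sol_speed p q g1 (2 * t)"
      by (simp only: sp scale)
  qed
  have j2: "(sol_speed p q (g1 +++ g2) has_integral sol_length p q g2) {1/2..1}"
  proof (rule has_integral_spike_finite[OF _ _ i2])
    show "finite (insert (1/2) ((\<lambda>t. 2 * t - 1) -` S2))"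
      using S2(1) by (intro finite.insertI finite_vimageI) (auto simp: inj_on_def)
    fix t :: real assume "t \<in> {1/2..1} - insert (1/2) ((\<lambda>t. 2 * t - 1) -` S2)"
    then have t: "1/2 < t" "t \<le> 1" "2 * t - 1 \<notin> S2" by auto
    have "(g1 +++ g2) t = g2 (2 * t - 1)" using t(1) by (simp add: joinpaths_def)
    with d2[OF t]
    show "sol_speed p q (g1 +++ g2) t = 2 * sol_speed p q g2 (2 * t - 1)"
      by (simp only: sp scale)
  qed
  have j: "(sol_speed p q (g1 +++ g2) has_integral sol_length p q g1 + sol_length p q g2) {0..1}"
    by (rule has_integral_combine[OF _ _ j1 j2]) auto
  show "sol_curve p q (g1 +++ g2)"
    using j g1 g2 eq by (auto simp: sol_curve_def integrable_on_def valid_path_join)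
  show "sol_length p q (g1 +++ g2) = sol_length p q g1 + sol_length p q g2"
    using j by (simp add: sol_length_def[of p q "g1 +++ g2"] integral_unique)
qed

lemma sol_curve_vertical:
  "sol_curve p q (linepath (x, y, z') (x, y, z))" 
  "sol_length p q (linepath (x, y, z') (x, y, z)) = \<bar>z - z'\<bar>"
proof -
  define \<gamma> where "\<gamma> = linepath (x, y, z') (x, y, z)"
  have *: "sol_speed p q \<gamma> t = \<bar>z - z'\<bar>" if "t \<in> {0..1}" for t
  proof -
    have "vector_derivative \<gamma> (at t within {0..1}) = (0, 0, z - z')"
      unfolding \<gamma>_def using that
      by (subst vector_derivative_at_within_ivl[OF has_vector_derivative_linepath_within]) auto
    then show ?thesis
      by (cases "\<gamma> t") (simp add: sol_speed_def sol_metric_diag)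
  qed
  have "((\<lambda>t. \<bar>z - z'\<bar>) has_integral \<bar>z - z'\<bar>) {0..1::real}"
    using has_integral_const_real[of "\<bar>z - z'\<bar>" 0 1] by simp
  then have **: "(sol_speed p q \<gamma> has_integral \<bar>z - z'\<bar>) {0..1}"
    by (rule has_integral_eq[rotated]) (simp add: *)
  then show "sol_curve p q (linepath (x, y, z') (x, y, z))" 
    "sol_length p q (linepath (x, y, z') (x, y, z)) = \<bar>z - z'\<bar>"
    by (auto simp: sol_curve_def sol_length_def integrable_on_def integral_unique \<gamma>_def)
qed

lemma sol_curve_horizontal:
  "sol_curve p q (linepath (x', y', z) (x, y, z))" 
  "sol_length p q (linepath (x', y', z) (x, y, z)) \<le> exp (- p * z) * \<bar>x - x'\<bar> + exp (q * z) * \<bar>y - y'\<bar>"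
proof -
  have const: "sol_metric p q (linepath (x', y', z) (x, y, z) t) = sol_metric p q (x', y', z)" for t
    by (simp add: linepath_def sol_metric_def algebra_simps fun_eq_iff)
  note seg = sol_segment[of p q "(x', y', z)" "(x, y, z)", OF const]
  show "sol_curve p q (linepath (x', y', z) (x, y, z))" by (rule seg)
  show "sol_length p q (linepath (x', y', z) (x, y, z)) \<le> exp (- p * z) * \<bar>x - x'\<bar> + exp (q * z) * \<bar>y - y'\<bar>"
    unfolding seg(2) using sol_norm_bounds(4)[of p q x' y' z "x - x'" "y - y'" 0] by simp
qed

lemma sol_curve_exists:
  obtains \<gamma> where "sol_curve p q \<gamma>" "pathstart \<gamma> = u" "pathfinish \<gamma> = v"
proof (cases u; cases v)
  fix x' y' z' x y z assume [simp]: "u = (x', y', z')" "v = (x, y, z)"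
  let ?\<gamma> = "linepath (x', y', z') (x', y', z) +++ linepath (x', y', z) (x, y, z)"
  show thesis
    by (rule that[of ?\<gamma>]) (auto intro!: sol_join(1) sol_curve_vertical sol_curve_horizontal)
qed

lemma sol_dist_approx:
  assumes "e > 0"
  obtains \<gamma> where "sol_curve p q \<gamma>" "pathstart \<gamma> = u" "pathfinish \<gamma> = v"
    "sol_length p q \<gamma> < sol_dist p q u v + e"
proof -
  have "{sol_length p q \<gamma> | \<gamma>. sol_curve p q \<gamma> \<and> pathstart \<gamma> = u \<and> pathfinish \<gamma> = v} \<noteq> {}"
    by (rule sol_curve_exists[of p q u v]) auto
  from cInf_lessD[OF this, of "sol_dist p q u v + e"] assms
  have "\<exists>\<gamma>. sol_curve p q \<gamma> \<and> pathstart \<gamma> = u \<and> pathfinish \<gamma> = v \<and>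
      sol_length p q \<gamma> < sol_dist p q u v + e"
    unfolding sol_dist_alt[symmetric] by auto
  then show ?thesis using that by blast
qed

lemma sol_dist_triangle: "sol_dist p q u w \<le> sol_dist p q u v + sol_dist p q v w"
proof (rule field_le_epsilon)
  fix e :: real assume "e > 0"
  obtain g1 where g1: "sol_curve p q g1" "pathstart g1 = u" "pathfinish g1 = v"
    "sol_length p q g1 < sol_dist p q u v + e / 2"
    using sol_dist_approx[of "e/2" p q u v] \<open>e > 0\<close> by auto
  obtain g2 where g2: "sol_curve p q g2" "pathstart g2 = v" "pathfinish g2 = w"
    "sol_length p q g2 < sol_dist p q v w + e / 2"
    using sol_dist_approx[of "e/2" p q v w] \<open>e > 0\<close> by auto
  have "sol_dist p q u w \<le> sol_length p q (g1 +++ g2)"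
    using g1 g2 by (intro sol_dist_le_length sol_join) auto
  also have "\<dots> = sol_length p q g1 + sol_length p q g2"
    using g1 g2 by (intro sol_join) auto
  finally show "sol_dist p q u w \<le> sol_dist p q u v + sol_dist p q v w + e"
    using g1(4) g2(4) by simp
qed

text \<open>First move vertically to the height of the target and then horizontally, so that the metric
  coefficients are those of the target height.\<close>

lemma sol_dist_le_axis:
  "sol_dist p q (x', y', z') (x, y, z) \<le>
     \<bar>z - z'\<bar> + exp (- p * z) * \<bar>x - x'\<bar> + exp (q * z) * \<bar>y - y'\<bar>"
proof -
  have "sol_dist p q (x', y', z') (x', y', z) \<le> \<bar>z - z'\<bar>"
    using sol_dist_le_length[OF sol_curve_vertical(1) refl refl, of p q x' y' z' z]
    by (simp add: sol_curve_vertical)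
  moreover have "sol_dist p q (x', y', z) (x, y, z) \<le> exp (- p * z) * \<bar>x - x'\<bar> + exp (q * z) * \<bar>y - y'\<bar>"
    using sol_dist_le_length[OF sol_curve_horizontal(1) refl refl, of p q x' y' z x y]
      sol_curve_horizontal(2)[of p q x' y' z x y] by simp
  ultimately show ?thesis
    using sol_dist_triangle[of p q "(x', y', z')" "(x, y, z)" "(x', y', z)"] by linarith
qed

text \<open>Upper semicontinuity suffices, and it follows from the triangle inequality, because the bound
  of \<open>sol_dist_le_axis\<close> tends to \<open>0\<close> as the starting points approach each other.\<close>

lemma sol_dist_measurable: "(\<lambda>u. sol_dist p q u v) \<in> borel_measurable borel"
proof (rule borel_measurableI_less)
  fix c
  have "open {u. sol_dist p q u v < c}"
    unfolding open_contains_ball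
  proof safe
    fix x y z :: real assume less: "sol_dist p q (x, y, z) v < c"
    define g where "g u = \<bar>z - snd (snd u)\<bar> + exp (- p * z) * \<bar>x - fst u\<bar> + exp (q * z) * \<bar>y - fst (snd u)\<bar>"
      for u :: "real \<times> real \<times> real"
    have "open {u. g u < c - sol_dist p q (x, y, z) v}"
      unfolding g_def by (intro open_Collect_less continuous_intros)
    moreover have "(x, y, z) \<in> {u. g u < c - sol_dist p q (x, y, z) v}"
      using less by (simp add: g_def)
    ultimately obtain e where e: "e > 0" "ball (x, y, z) e \<subseteq> {u. g u < c - sol_dist p q (x, y, z) v}"
      by (meson open_contains_ball)
    have "sol_dist p q u v \<le> g u + sol_dist p q (x, y, z) v" for u
      using sol_dist_le_axis[of p q "fst u" "fst (snd u)" "snd (snd u)" x y z]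
        sol_dist_triangle[of p q u v "(x, y, z)"] by (simp add: g_def)
    then have "{u. g u < c - sol_dist p q (x, y, z) v} \<subseteq> {u. sol_dist p q u v < c}"
      by (intro Collect_mono impI) (smt (verit))
    with e(2) have "ball (x, y, z) e \<subseteq> {u. sol_dist p q u v < c}" by (rule order_trans)
    then show "\<exists>e>0. ball (x, y, z) e \<subseteq> {u. sol_dist p q u v < c}" using e(1) by blast
  qed
  then show "{u \<in> space borel. sol_dist p q u v < c} \<in> sets borel" by simp
qed

section \<open>The distance to the origin up to a logarithm\<close>

text \<open>The highest level that a nearly shortest curve between \<open>(x, y, z)\<close> and the origin visits: one
  at which the displacement \<open>x\<close> costs at most \<open>1\<close>, but not below the endpoints.\<close>

definition sol_top :: "real \<Rightarrow> real \<Rightarrow> real \<Rightarrow> real" where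
  "sol_top p x z = max (ln \<bar>x\<bar> / p) (max 0 z)"

definition sol_bottom :: "real \<Rightarrow> real \<Rightarrow> real \<Rightarrow> real" where
  "sol_bottom q y z = min (- ln \<bar>y\<bar> / q) (min 0 z)"

text \<open>The curve visits the two extreme levels and makes its horizontal moves there, each at a cost
  of at most \<open>1\<close>. The level on the side of the starting height is visited last if the curve is run
  from the origin, so that the height \<open>\<bar>z\<bar>\<close> is saved.\<close>

lemma sol_dist_upper:
  assumes "p > 0" "q > 0" "x \<noteq> 0" "y \<noteq> 0"
  shows "sol_dist p q (x, y, z) (0, 0, 0) \<le> 2 * (sol_top p x z - sol_bottom q y z) - \<bar>z\<bar> + 2"
proof -
  define A B where "A = sol_top p x z" and "B = sol_bottom q y z"
  have A: "A \<ge> 0" "A \<ge> z" "ln \<bar>x\<bar> / p \<le> A" and B: "B \<le> 0" "B \<le> z" "B \<le> - ln \<bar>y\<bar> / q"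
    by (auto simp: A_def B_def sol_top_def sol_bottom_def)
  have "exp (- p * A) * \<bar>x\<bar> = exp (ln \<bar>x\<bar> - p * A)"
    using assms by (simp add: exp_diff exp_minus field_simps)
  also have "\<dots> \<le> 1" using A(3) assms by (simp add: field_simps)
  finally have x: "exp (- p * A) * \<bar>x\<bar> \<le> 1" .
  have "exp (q * B) * \<bar>y\<bar> = exp (ln \<bar>y\<bar> + q * B)"
    using assms by (simp add: exp_add field_simps)
  also have "\<dots> \<le> 1" using B(3) assms by (simp add: field_simps)
  finally have y: "exp (q * B) * \<bar>y\<bar> \<le> 1" .
  show ?thesis
  proof (cases "z \<ge> 0")
    case True
    have "sol_dist p q (x, y, z) (0, y, A) \<le> (A - z) + 1"
      "sol_dist p q (0, y, A) (0, 0, B) \<le> (A - B) + 1"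
      "sol_dist p q (0, 0, B) (0, 0, 0) \<le> - B"
      using A B x y sol_dist_le_axis[of p q x y z 0 y A] sol_dist_le_axis[of p q 0 y A 0 0 B]
        sol_dist_le_axis[of p q 0 0 B 0 0 0] by simp_all
    moreover note sol_dist_triangle[of p q "(x, y, z)" "(0, 0, 0)" "(0, y, A)"]
      sol_dist_triangle[of p q "(0, y, A)" "(0, 0, 0)" "(0, 0, B)"]
    moreover have "\<bar>z\<bar> = z" using True by simp
    ultimately
    have "sol_dist p q (x, y, z) (0, 0, 0) \<le> 2 * (A - B) - \<bar>z\<bar> + 2" by (smt (verit))
    then show ?thesis by (simp only: A_def B_def)
  next
    case False
    have "sol_dist p q (x, y, z) (x, 0, B) \<le> (z - B) + 1"
      "sol_dist p q (x, 0, B) (0, 0, A) \<le> (A - B) + 1"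
      "sol_dist p q (0, 0, A) (0, 0, 0) \<le> A"
      using A B x y sol_dist_le_axis[of p q x y z x 0 B] sol_dist_le_axis[of p q x 0 B 0 0 A]
        sol_dist_le_axis[of p q 0 0 A 0 0 0] by simp_all
    moreover note sol_dist_triangle[of p q "(x, y, z)" "(0, 0, 0)" "(x, 0, B)"]
      sol_dist_triangle[of p q "(x, 0, B)" "(0, 0, 0)" "(0, 0, A)"]
    moreover have "\<bar>z\<bar> = - z" using False by simp
    ultimately
    have "sol_dist p q (x, y, z) (0, 0, 0) \<le> 2 * (A - B) - \<bar>z\<bar> + 2" by (smt (verit))
    then show ?thesis by (simp only: A_def B_def)
  qed
qed

text \<open>A curve of length \<open>L\<close> changes \<open>x\<close> by at most \<open>L exp (p h)\<close>, where \<open>h\<close> is its maximal height.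
  It therefore rises to \<open>ln \<bar>x\<bar> / p - ln L / p\<close> at least, and likewise descends to
  \<open>- ln \<bar>y\<bar> / q + ln L / q\<close>. Visiting its own maximum and minimum in either order costs the vertical
  travel on the left-hand side.\<close>

lemma sol_length_lower:
  fixes p q x y z :: real
  assumes pq: "p > 0" "q > 0" and xy: "x \<noteq> 0" "y \<noteq> 0"
    and \<gamma>: "sol_curve p q \<gamma>" "pathstart \<gamma> = (x, y, z)" "pathfinish \<gamma> = (0, 0, 0)"
  defines "L \<equiv> sol_length p q \<gamma>"
  shows "2 * (sol_top p x z - sol_bottom q y z) - \<bar>z\<bar> \<le> L + 2 * (1 / p + 1 / q) * ln (max 1 L)"
proof -
  define h where "h t = snd (snd (\<gamma> t))" for t
  have cont: "continuous_on {0..1} h"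
    using \<gamma>(1) valid_path_imp_path[of \<gamma>] unfolding h_def sol_curve_def path_def
    by (auto intro!: continuous_intros)
  have ends: "h 0 = z" "h 1 = 0" "\<gamma> 0 = (x, y, z)" "\<gamma> 1 = (0, 0, 0)"
    using \<gamma>(2,3) by (auto simp: h_def pathstart_def pathfinish_def)
  obtain s where s: "s \<in> {0..1}" "\<And>t. t \<in> {0..1} \<Longrightarrow> h t \<le> h s"
    using continuous_attains_sup[OF _ _ cont] by fastforce
  obtain r where r: "r \<in> {0..1}" "\<And>t. t \<in> {0..1} \<Longrightarrow> h r \<le> h t"
    using continuous_attains_inf[OF _ _ cont] by fastforce
  have int: "sol_speed p q \<gamma> integrable_on {0..1}" using \<gamma>(1) by (simp add: sol_curve_def)
  have vert: "\<bar>h b - h a\<bar> \<le> integral {a..b} (sol_speed p q \<gamma>)" if "0 \<le> a" "a \<le> b" "b \<le> 1" for a b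
  proof -
    have "1 * \<bar>snd (snd (\<gamma> b)) - snd (snd (\<gamma> a))\<bar> \<le> integral {a..b} (sol_speed p q \<gamma>)"
    proof (rule increment_le_length[OF _ \<gamma>(1) that])
      show "bounded_linear (\<lambda>v::real \<times> real \<times> real. snd (snd v))"
        by (intro bounded_linear_snd_comp bounded_linear_snd)
      fix t :: real and v :: "real \<times> real \<times> real"
      show "1 * \<bar>snd (snd v)\<bar> \<le> sqrt (sol_metric p q (\<gamma> t) v v)"
        using sol_norm_bounds(3)[of "snd (snd v)" p q "fst (\<gamma> t)" "fst (snd (\<gamma> t))" "snd (snd (\<gamma> t))" "fst v" "fst (snd v)"]
        by simp
    qed auto
    then show ?thesis by (simp add: h_def)
  qed
  have tri: "\<bar>h a - h 0\<bar> + \<bar>h b - h a\<bar> + \<bar>h 1 - h b\<bar> \<le> L" if "0 \<le> a" "a \<le> b" "b \<le> 1" for a b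
  proof -
    have "L = integral {0..b} (sol_speed p q \<gamma>) + integral {b..1} (sol_speed p q \<gamma>)"
      unfolding L_def sol_length_def using that int by (intro Henstock_Kurzweil_Integration.integral_combine[symmetric]) auto
    moreover have "integral {0..b} (sol_speed p q \<gamma>) =
        integral {0..a} (sol_speed p q \<gamma>) + integral {a..b} (sol_speed p q \<gamma>)"
      using that by (intro Henstock_Kurzweil_Integration.integral_combine[symmetric] integrable_subinterval_real[OF int]) auto
    ultimately show ?thesis using vert[of 0 a] vert[of a b] vert[of b 1] that by linarith
  qed
  have V: "2 * (h s - h r) - \<bar>z\<bar> \<le> L"
  proof (cases "r \<le> s")
    case True
    with tri[of r s] r s ends show ?thesis by auto
  next
    case False
    with tri[of s r] r s ends show ?thesis by auto
  qed
  have "exp (- p * h s) * \<bar>0 - x\<bar> \<le> L"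
  proof -
    have "exp (- p * h s) * \<bar>fst (\<gamma> 1) - fst (\<gamma> 0)\<bar> \<le> integral {0..1} (sol_speed p q \<gamma>)"
    proof (rule increment_le_length[OF bounded_linear_fst \<gamma>(1)])
      fix t :: real and v :: "real \<times> real \<times> real" assume t: "t \<in> {0..1}"
      have "exp (- p * h s) * \<bar>fst v\<bar> \<le> exp (- p * h t) * \<bar>fst v\<bar>"
        using s(2)[OF t] pq by (intro mult_right_mono) auto
      also have "\<dots> \<le> sqrt (sol_metric p q (\<gamma> t) v v)"
        using sol_norm_bounds(1)[of p "h t" "fst v" q "fst (\<gamma> t)" "fst (snd (\<gamma> t))" "fst (snd v)" "snd (snd v)"]
        by (simp add: h_def)
      finally show "exp (- p * h s) * \<bar>fst v\<bar> \<le> sqrt (sol_metric p q (\<gamma> t) v v)" .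
    qed auto
    then show ?thesis by (simp add: ends L_def sol_length_def)
  qed
  moreover have "exp (- p * h s) * \<bar>0 - x\<bar> = exp (ln \<bar>x\<bar> - p * h s)"
    using xy by (simp add: exp_diff exp_minus field_simps)
  ultimately have x: "exp (ln \<bar>x\<bar> - p * h s) \<le> max 1 L" by simp
  then have "ln \<bar>x\<bar> - p * h s \<le> ln (max 1 L)" by (subst ln_ge_iff) auto
  then have X: "ln \<bar>x\<bar> / p \<le> h s + ln (max 1 L) / p" using pq by (simp add: field_simps)
  have "exp (q * h r) * \<bar>0 - y\<bar> \<le> L"
  proof -
    have "exp (q * h r) * \<bar>fst (snd (\<gamma> 1)) - fst (snd (\<gamma> 0))\<bar> \<le> integral {0..1} (sol_speed p q \<gamma>)"
    proof (rule increment_le_length[OF _ \<gamma>(1)])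
      show "bounded_linear (\<lambda>v::real \<times> real \<times> real. fst (snd v))"
        by (intro bounded_linear_fst_comp bounded_linear_snd)
      fix t :: real and v :: "real \<times> real \<times> real" assume t: "t \<in> {0..1}"
      have "exp (q * h r) * \<bar>fst (snd v)\<bar> \<le> exp (q * h t) * \<bar>fst (snd v)\<bar>"
        using r(2)[OF t] pq by (intro mult_right_mono) auto
      also have "\<dots> \<le> sqrt (sol_metric p q (\<gamma> t) v v)"
        using sol_norm_bounds(2)[of q "h t" "fst (snd v)" p "fst (\<gamma> t)" "fst (snd (\<gamma> t))" "fst v" "snd (snd v)"]
        by (simp add: h_def)
      finally show "exp (q * h r) * \<bar>fst (snd v)\<bar> \<le> sqrt (sol_metric p q (\<gamma> t) v v)" .
    qed auto
    then show ?thesis by (simp add: ends L_def sol_length_def)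
  qed
  moreover have "exp (q * h r) * \<bar>0 - y\<bar> = exp (ln \<bar>y\<bar> + q * h r)"
    using xy by (simp add: exp_add field_simps)
  ultimately have y: "exp (ln \<bar>y\<bar> + q * h r) \<le> max 1 L" by simp
  then have "ln \<bar>y\<bar> + q * h r \<le> ln (max 1 L)" by (subst ln_ge_iff) auto
  then have Y: "- ln \<bar>y\<bar> / q \<ge> h r - ln (max 1 L) / q" using divide_right_mono[of "ln \<bar>y\<bar> + q * h r" "ln (max 1 L)" q] pq
    by (simp add: add_divide_distrib)
  have pos: "ln (max 1 L) / p \<ge> 0" "ln (max 1 L) / q \<ge> 0" using pq by auto
  have "sol_top p x z \<le> h s + ln (max 1 L) / p"
    using X pos s(2)[of 0] s(2)[of 1] ends by (auto simp: sol_top_def)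
  moreover have "sol_bottom q y z \<ge> h r - ln (max 1 L) / q"
    using Y pos r(2)[of 0] r(2)[of 1] ends by (auto simp: sol_bottom_def)
  ultimately show ?thesis using V by (simp add: algebra_simps)
qed

text \<open>The bound for curves is continuous in the length, so it survives the infimum.\<close>

lemma sol_dist_lower:
  fixes p q x y z :: real
  assumes pq: "p > 0" "q > 0" and xy: "x \<noteq> 0" "y \<noteq> 0"
  defines "d \<equiv> sol_dist p q (x, y, z) (0, 0, 0)"
  shows "2 * (sol_top p x z - sol_bottom q y z) - \<bar>z\<bar> \<le> d + 2 * (1 / p + 1 / q) * ln (max 1 d)"
proof (rule tendsto_lowerbound)
  let ?f = "\<lambda>e. d + e + 2 * (1 / p + 1 / q) * ln (max 1 (d + e))"
  have "(?f \<longlongrightarrow> d + 0 + 2 * (1 / p + 1 / q) * ln (max 1 (d + 0))) (at_right 0)"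
    by (intro tendsto_intros) (simp_all add: max_def)
  then show "(?f \<longlongrightarrow> d + 2 * (1 / p + 1 / q) * ln (max 1 d)) (at_right 0)" by simp
  show "\<forall>\<^sub>F e in at_right 0. 2 * (sol_top p x z - sol_bottom q y z) - \<bar>z\<bar> \<le> ?f e"
    unfolding eventually_at_right_field
  proof (intro exI[of _ 1] conjI allI impI)
    fix e :: real assume "0 < e" "e < 1"
    then obtain \<gamma> where \<gamma>: "sol_curve p q \<gamma>" "pathstart \<gamma> = (x, y, z)" "pathfinish \<gamma> = (0, 0, 0)"
      and L: "sol_length p q \<gamma> < d + e"
      using sol_dist_approx[of e] unfolding d_def by metis
    have "ln (max 1 (sol_length p q \<gamma>)) \<le> ln (max 1 (d + e))"
      using L by (subst ln_le_cancel_iff) auto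
    then have "2 * (1 / p + 1 / q) * ln (max 1 (sol_length p q \<gamma>)) \<le>
        2 * (1 / p + 1 / q) * ln (max 1 (d + e))"
      using pq by (intro mult_left_mono) auto
    then have "sol_length p q \<gamma> + 2 * (1 / p + 1 / q) * ln (max 1 (sol_length p q \<gamma>)) \<le> ?f e"
      using L by (intro add_mono) auto
    with sol_length_lower[OF pq xy \<gamma>]
    show "2 * (sol_top p x z - sol_bottom q y z) - \<bar>z\<bar> \<le> ?f e" by (rule order_trans)
  qed simp
qed (rule trivial_limit_at_right_real)

section \<open>Brownian sample paths\<close>

text \<open>Independence of random elements whose values may have different types; for equal types this is
  \<open>indep_var\<close> (lemma \<open>indep_rv_indep_var\<close>). Taking \<open>X\<close> to be the identity map into a measure with
  fewer measurable sets expresses independence from a sub-\<open>\<sigma>\<close>-algebra.\<close>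

definition indep_rv :: "'a measure \<Rightarrow> 'b measure \<Rightarrow> ('a \<Rightarrow> 'b) \<Rightarrow> 'c measure \<Rightarrow> ('a \<Rightarrow> 'c) \<Rightarrow> bool" where
  "indep_rv M S X T Y \<longleftrightarrow> X \<in> measurable M S \<and> Y \<in> measurable M T \<and>
     (\<forall>A\<in>sets S. \<forall>B\<in>sets T. measure M {\<omega> \<in> space M. X \<omega> \<in> A \<and> Y \<omega> \<in> B} =
       measure M {\<omega> \<in> space M. X \<omega> \<in> A} * measure M {\<omega> \<in> space M. Y \<omega> \<in> B})"

lemma indep_rvD:
  assumes "indep_rv M S X T Y"
  shows "X \<in> measurable M S" "Y \<in> measurable M T"
    "\<And>A B. A \<in> sets S \<Longrightarrow> B \<in> sets T \<Longrightarrow>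
      measure M {\<omega> \<in> space M. X \<omega> \<in> A \<and> Y \<omega> \<in> B} =
      measure M {\<omega> \<in> space M. X \<omega> \<in> A} * measure M {\<omega> \<in> space M. Y \<omega> \<in> B}"
  using assms unfolding indep_rv_def by auto

lemma (in prob_space) indep_rv_distr:
  assumes ind: "indep_rv M S X T Y"
  shows "distr M (S \<Otimes>\<^sub>M T) (\<lambda>\<omega>. (X \<omega>, Y \<omega>)) = distr M S X \<Otimes>\<^sub>M distr M T Y"
proof -
  note [measurable] = indep_rvD(1,2)[OF ind]
  note eq = indep_rvD(3)[OF ind]
  interpret X: prob_space "distr M S X" by (rule prob_space_distr) measurable
  interpret Y: prob_space "distr M T Y" by (rule prob_space_distr) measurable
  have "distr M S X \<Otimes>\<^sub>M distr M T Y = distr M (S \<Otimes>\<^sub>M T) (\<lambda>x. (X x, Y x))"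
  proof (rule pair_measure_eqI)
    show "sigma_finite_measure (distr M S X)" "sigma_finite_measure (distr M T Y)"
      by unfold_locales
    fix A B assume "A \<in> sets (distr M S X)" "B \<in> sets (distr M T Y)"
    then have [measurable]: "A \<in> sets S" "B \<in> sets T" by auto
    have "emeasure (distr M (S \<Otimes>\<^sub>M T) (\<lambda>x. (X x, Y x))) (A \<times> B) =
        emeasure M {\<omega> \<in> space M. X \<omega> \<in> A \<and> Y \<omega> \<in> B}"
      by (subst emeasure_distr) (auto intro!: arg_cong[where f = "emeasure M"])
    moreover have "emeasure (distr M S X) A = emeasure M {\<omega> \<in> space M. X \<omega> \<in> A}"
      by (subst emeasure_distr) (auto intro!: arg_cong[where f = "emeasure M"])
    moreover have "emeasure (distr M T Y) B = emeasure M {\<omega> \<in> space M. Y \<omega> \<in> B}"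
      by (subst emeasure_distr) (auto intro!: arg_cong[where f = "emeasure M"])
    ultimately show "emeasure (distr M S X) A * emeasure (distr M T Y) B =
        emeasure (distr M (S \<Otimes>\<^sub>M T) (\<lambda>x. (X x, Y x))) (A \<times> B)"
      by (simp add: emeasure_eq_measure eq ennreal_mult)
  qed simp
  then show ?thesis by simp
qed

lemma (in prob_space) indep_rv_of_distr:
  assumes X[measurable]: "X \<in> measurable M S" and Y[measurable]: "Y \<in> measurable M T"
    and eq: "distr M (S \<Otimes>\<^sub>M T) (\<lambda>\<omega>. (X \<omega>, Y \<omega>)) = distr M S X \<Otimes>\<^sub>M distr M T Y"
  shows "indep_rv M S X T Y"
  unfolding indep_rv_def
proof (intro conjI ballI X Y)
  interpret Y: prob_space "distr M T Y" by (rule prob_space_distr) measurable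
  fix A B assume [measurable]: "A \<in> sets S" "B \<in> sets T"
  have "emeasure M {\<omega> \<in> space M. X \<omega> \<in> A \<and> Y \<omega> \<in> B} =
      emeasure (distr M (S \<Otimes>\<^sub>M T) (\<lambda>x. (X x, Y x))) (A \<times> B)"
    by (subst emeasure_distr) (auto intro!: arg_cong[where f = "emeasure M"])
  also have "\<dots> = emeasure (distr M S X) A * emeasure (distr M T Y) B"
    unfolding eq by (intro Y.emeasure_pair_measure_Times) auto
  also have "emeasure (distr M S X) A = emeasure M {\<omega> \<in> space M. X \<omega> \<in> A}"
    by (subst emeasure_distr) (auto intro!: arg_cong[where f = "emeasure M"])
  also have "emeasure (distr M T Y) B = emeasure M {\<omega> \<in> space M. Y \<omega> \<in> B}"
    by (subst emeasure_distr) (auto intro!: arg_cong[where f = "emeasure M"])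
  finally show "prob {\<omega> \<in> space M. X \<omega> \<in> A \<and> Y \<omega> \<in> B} =
      prob {\<omega> \<in> space M. X \<omega> \<in> A} * prob {\<omega> \<in> space M. Y \<omega> \<in> B}"
    by (simp add: emeasure_eq_measure flip: ennreal_mult)
qed

lemma (in prob_space) indep_rv_indep_var:
  "indep_var S X T Y \<longleftrightarrow> indep_rv M S X T Y"
proof
  assume "indep_var S X T Y"
  then show "indep_rv M S X T Y"
    unfolding indep_var_distribution_eq by (intro indep_rv_of_distr) auto
next
  assume ind: "indep_rv M S X T Y"
  show "indep_var S X T Y"
    unfolding indep_var_distribution_eq
    using indep_rvD(1,2)[OF ind] indep_rv_distr[OF ind] by simp
qed

lemma (in prob_space) indep_rv_compose:
  assumes ind: "indep_rv M S X T Y" and f: "f \<in> measurable S S'" and g: "g \<in> measurable T T'"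
  shows "indep_rv M S' (\<lambda>\<omega>. f (X \<omega>)) T' (\<lambda>\<omega>. g (Y \<omega>))"
proof -
  note [measurable] = indep_rvD(1,2)[OF ind] f g
  have X: "X \<omega> \<in> space S" "Y \<omega> \<in> space T" if "\<omega> \<in> space M" for \<omega>
    using that measurable_space indep_rvD(1,2)[OF ind] by metis+
  show ?thesis
    unfolding indep_rv_def
  proof (intro conjI ballI)
    fix A B assume A: "A \<in> sets S'" and B: "B \<in> sets T'"
    show "prob {\<omega> \<in> space M. f (X \<omega>) \<in> A \<and> g (Y \<omega>) \<in> B} =
        prob {\<omega> \<in> space M. f (X \<omega>) \<in> A} * prob {\<omega> \<in> space M. g (Y \<omega>) \<in> B}"
      using indep_rvD(3)[OF ind measurable_sets[OF f A] measurable_sets[OF g B]] X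
      by (simp cong: conj_cong)
  qed measurable
qed

lemma sbm_measurable: "standard_brownian_motion M B \<Longrightarrow> t \<ge> 0 \<Longrightarrow> B t \<in> borel_measurable M"
  by (simp add: standard_brownian_motion_def)

lemma sbm_zero: "standard_brownian_motion M B \<Longrightarrow> \<omega> \<in> space M \<Longrightarrow> B 0 \<omega> = 0"
  by (simp add: standard_brownian_motion_def)

lemma sbm_continuous: "standard_brownian_motion M B \<Longrightarrow> \<omega> \<in> space M \<Longrightarrow> continuous_on {0..} (\<lambda>t. B t \<omega>)"
  by (simp add: standard_brownian_motion_def)

lemma sbm_normal:
  "standard_brownian_motion M B \<Longrightarrow> 0 \<le> s \<Longrightarrow> s < t \<Longrightarrow>
    distributed M lborel (\<lambda>\<omega>. B t \<omega> - B s \<omega>) (normal_density 0 (sqrt (t - s)))"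
  by (simp add: standard_brownian_motion_def)

lemma sbm_indep:
  assumes "standard_brownian_motion M B" "0 \<le> \<tau> 0" "\<And>i. i < n \<Longrightarrow> \<tau> i \<le> \<tau> (Suc i)"
  shows "prob_space.indep_vars M (\<lambda>_. borel) (\<lambda>i \<omega>. B (\<tau> (Suc i)) \<omega> - B (\<tau> i) \<omega>) {..<n}"
  using assms unfolding standard_brownian_motion_def by blast

text \<open>Scaling and, with \<open>t = 1\<close> and \<open>k = - 1\<close>, reflection in one statement.\<close>

lemma sbm_scale:
  assumes "prob_space M" and B: "standard_brownian_motion M B" and t: "t > 0" and k: "k\<^sup>2 * t = 1"
  shows "standard_brownian_motion M (\<lambda>s \<omega>. k * B (t * s) \<omega>)"
proof -
  interpret prob_space M by fact
  have k0: "k \<noteq> 0" using k by auto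
  have abs_k: "\<bar>k\<bar> * sqrt (t * u) = sqrt u" if "u \<ge> 0" for u
  proof -
    have "\<bar>k\<bar> * sqrt (t * u) = sqrt (k\<^sup>2 * t * u)" by (simp add: real_sqrt_mult mult.assoc)
    then show ?thesis by (simp add: k)
  qed
  show ?thesis
    unfolding standard_brownian_motion_def
  proof (intro conjI allI impI ballI; (elim conjE)?)
    fix s :: real assume "0 \<le> s"
    then show "(\<lambda>\<omega>. k * B (t * s) \<omega>) \<in> borel_measurable M"
      using sbm_measurable[OF B, of "t * s"] t by simp
  next
    fix \<omega> assume "\<omega> \<in> space M"
    then show "k * B (t * 0) \<omega> = 0" by (simp add: sbm_zero[OF B])
  next
    fix \<omega> assume \<omega>: "\<omega> \<in> space M"
    show "continuous_on {0..} (\<lambda>s. k * B (t * s) \<omega>)"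
      by (intro continuous_intros continuous_on_compose2[OF sbm_continuous[OF B \<omega>]]) (use t in auto)
  next
    fix s u :: real assume su: "0 \<le> s" "s < u"
    have "distributed M lborel (\<lambda>\<omega>. 0 + k * (B (t * u) \<omega> - B (t * s) \<omega>))
        (normal_density (0 + k * 0) (\<bar>k\<bar> * sqrt (t * u - t * s)))"
      by (intro normal_density_affine sbm_normal[OF B]) (use su t k0 in auto)
    moreover have "\<bar>k\<bar> * sqrt (t * u - t * s) = sqrt (u - s)"
      using abs_k[of "u - s"] su by (simp add: right_diff_distrib)
    ultimately show "distributed M lborel (\<lambda>\<omega>. k * B (t * u) \<omega> - k * B (t * s) \<omega>)
        (normal_density 0 (sqrt (u - s)))"
      by (simp add: right_diff_distrib)
  next
    fix n :: nat and \<tau> :: "nat \<Rightarrow> real" assume \<tau>: "0 \<le> \<tau> 0" "\<forall>i<n. \<tau> i \<le> \<tau> (Suc i)"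
    have "indep_vars (\<lambda>_. borel) (\<lambda>i \<omega>. B (t * \<tau> (Suc i)) \<omega> - B (t * \<tau> i) \<omega>) {..<n}"
      using sbm_indep[OF B, of "\<lambda>i. t * \<tau> i" n] \<tau> t by auto
    then have "indep_vars (\<lambda>_. borel) (\<lambda>i \<omega>. k * (B (t * \<tau> (Suc i)) \<omega> - B (t * \<tau> i) \<omega>)) {..<n}"
      by (rule indep_vars_compose2) auto
    then show "indep_vars (\<lambda>_. borel) (\<lambda>i \<omega>. k * B (t * \<tau> (Suc i)) \<omega> - k * B (t * \<tau> i) \<omega>) {..<n}"
      by (simp add: right_diff_distrib)
  qed
qed

text \<open>Finitely many times are listed in increasing order after a leading \<open>0\<close>, so that the values of
  a Brownian motion at these times become partial sums of independent increments.\<close>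

lemma ordered_enumeration:
  fixes J :: "real set"
  assumes "finite J" "J \<subseteq> {0..s}"
  obtains \<tau> :: "nat \<Rightarrow> real" and idx where "\<tau> 0 = 0" "\<And>i. i < card J \<Longrightarrow> \<tau> i \<le> \<tau> (Suc i)"
    "\<And>j. j \<in> J \<Longrightarrow> idx j \<le> card J \<and> \<tau> (idx j) = j" "\<And>i. i \<le> card J \<Longrightarrow> \<tau> i \<in> insert 0 J"
proof -
  define l where "l = 0 # sorted_list_of_set J"
  have len: "length l = Suc (card J)" using assms by (simp add: l_def)
  have sorted: "sorted l" using assms by (auto simp: l_def)
  have set: "set l = insert 0 J" using assms by (simp add: l_def)
  define \<tau> where "\<tau> = nth l"
  have ex: "\<exists>i. i \<le> card J \<and> \<tau> i = j" if "j \<in> J" for j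
  proof -
    have "j \<in> List.set l" using that set by simp
    then show ?thesis unfolding in_set_conv_nth len \<tau>_def by (auto simp: less_Suc_eq_le)
  qed
  define idx where "idx j = (SOME i. i \<le> card J \<and> \<tau> i = j)" for j
  show thesis
  proof (rule that[of \<tau> idx])
    show "\<tau> 0 = 0" by (simp add: \<tau>_def l_def)
    show "\<tau> i \<le> \<tau> (Suc i)" if "i < card J" for i
      using sorted len that by (auto simp: \<tau>_def intro: sorted_nth_mono)
    show "idx j \<le> card J \<and> \<tau> (idx j) = j" if "j \<in> J" for j
      unfolding idx_def by (rule someI_ex[OF ex[OF that]])
    show "\<tau> i \<in> insert 0 J" if "i \<le> card J" for i
      using that len set nth_mem[of i l] by (auto simp: \<tau>_def)
  qed
qed

lemma sbm_eq_sum_increments: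
  assumes B: "standard_brownian_motion M B" and \<omega>: "\<omega> \<in> space M" and "\<tau> 0 = 0"
  shows "B (\<tau> m) \<omega> = (\<Sum>i<m. B (\<tau> (Suc i)) \<omega> - B (\<tau> i) \<omega>)"
  using sum_lessThan_telescope[of "\<lambda>i. B (\<tau> i) \<omega>" m] sbm_zero[OF B \<omega>] assms(3) by simp

abbreviation path_space :: "(real \<Rightarrow> real) measure" where
  "path_space \<equiv> Pi\<^sub>M {0..} (\<lambda>_. borel)"

definition sample_path :: "(real \<Rightarrow> 'a \<Rightarrow> real) \<Rightarrow> 'a \<Rightarrow> real \<Rightarrow> real" where
  "sample_path B \<omega> = (\<lambda>t\<in>{0..}. B t \<omega>)"

lemma path_measurable:
  assumes "\<And>t. t \<ge> 0 \<Longrightarrow> B t \<in> borel_measurable M"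
  shows "sample_path B \<in> measurable M path_space"
  unfolding sample_path_def by (rule measurable_restrict) (use assms in auto)

lemma sbm_path_measurable: "standard_brownian_motion M B \<Longrightarrow> sample_path B \<in> measurable M path_space"
  by (rule path_measurable) (rule sbm_measurable)

lemma vimage_box:
  assumes J: "finite J" "J \<subseteq> I" and B: "\<And>i. i \<in> I \<Longrightarrow> B i \<in> borel_measurable M"
  shows "(\<lambda>\<omega>. \<lambda>t\<in>I. B t \<omega>) -` prod_emb I (\<lambda>_. borel) J (Pi\<^sub>E J A) \<inter> space M =
    {\<omega> \<in> space M. \<forall>j\<in>J. B j \<omega> \<in> A j}"
proof -
  have "I \<inter> J = J" using J by blast
  then show ?thesis
    by (auto simp: prod_emb_def space_PiM restrict_PiE_iff restrict_restrict)
qed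

lemma partial_sums_event:
  fixes A :: "'j \<Rightarrow> real set" and idx :: "'j \<Rightarrow> nat"
  assumes J: "finite J" and idx: "\<And>j. j \<in> J \<Longrightarrow> idx j \<le> n" and A: "\<And>j. j \<in> J \<Longrightarrow> A j \<in> sets borel"
  shows "{x \<in> space (Pi\<^sub>M {..<n} (\<lambda>_. borel :: real measure)). \<forall>j\<in>J. (\<Sum>i<idx j. x i) \<in> A j} \<in>
    sets (Pi\<^sub>M {..<n} (\<lambda>_. borel))"
proof (intro sets.sets_Collect_finite_All J(1))
  fix j assume j: "j \<in> J"
  have "(\<lambda>x::nat \<Rightarrow> real. \<Sum>i<idx j. x i) \<in> borel_measurable (Pi\<^sub>M {..<n} (\<lambda>_. borel))"
    using idx[OF j] by (intro borel_measurable_sum measurable_component_singleton) auto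
  then show "{x \<in> space (Pi\<^sub>M {..<n} (\<lambda>_. borel)). (\<Sum>i<idx j. x i) \<in> A j} \<in> sets (Pi\<^sub>M {..<n} (\<lambda>_. borel))"
    using A[OF j] by measurable
qed

text \<open>The increments over consecutive times of a finite set are independent with prescribed normal
  laws. They determine the finite-dimensional distributions, and these determine the law on the path
  space.\<close>

lemma (in prob_space) sbm_path_law:
  assumes B: "standard_brownian_motion M B" and C: "standard_brownian_motion M C"
  shows "distr M path_space (sample_path B) = distr M path_space (sample_path C)"
proof (rule measure_eqI_PiM_infinite)
  show "finite_measure (distr M path_space (sample_path B))"
    by (intro prob_space.finite_measure prob_space_distr sbm_path_measurable[OF B])
  fix A :: "real \<Rightarrow> real set" and J :: "real set"
  assume J: "finite J" "J \<subseteq> {0..}" and A: "\<And>i. i \<in> J \<Longrightarrow> A i \<in> sets borel"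
  obtain s where s: "J \<subseteq> {0..s}"
  proof (rule that[of "Max (insert 0 J)"])
    show "J \<subseteq> {0..Max (insert 0 J)}" using J by (auto intro!: Max_ge)
  qed
  obtain \<tau> idx where \<tau>: "\<tau> 0 = 0" "\<And>i. i < card J \<Longrightarrow> \<tau> i \<le> \<tau> (Suc i)"
    "\<And>j. j \<in> J \<Longrightarrow> idx j \<le> card J \<and> \<tau> (idx j) = j" "\<And>i. i \<le> card J \<Longrightarrow> \<tau> i \<in> insert (0::real) J"
    using ordered_enumeration[OF J(1) s] by blast
  define n where "n = card J"
  have nonneg: "0 \<le> \<tau> i" if "i \<le> n" for i
    using \<tau>(4)[of i] J that by (auto simp: n_def)
  define D where "D X = (\<lambda>\<omega>. \<lambda>i\<in>{..<n}. X (\<tau> (Suc i)) \<omega> - X (\<tau> i) \<omega>)" for X :: "real \<Rightarrow> 'a \<Rightarrow> real"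
  define E where "E = {x \<in> space (Pi\<^sub>M {..<n} (\<lambda>_. borel :: real measure)). \<forall>j\<in>J. (\<Sum>i<idx j. x i) \<in> A j}"
  have E: "E \<in> sets (Pi\<^sub>M {..<n} (\<lambda>_. borel))"
    unfolding E_def by (rule partial_sums_event) (use J A \<tau>(3) in \<open>auto simp: n_def\<close>)
  have box: "emeasure (distr M path_space (sample_path X)) (prod_emb {0..} (\<lambda>_. borel) J (Pi\<^sub>E J A)) =
      emeasure (distr M (Pi\<^sub>M {..<n} (\<lambda>_. borel)) (D X)) E"
    and D: "D X \<in> measurable M (Pi\<^sub>M {..<n} (\<lambda>_. borel))"
    and prod: "n > 0 \<Longrightarrow> distr M (Pi\<^sub>M {..<n} (\<lambda>_. borel)) (D X) =
      (\<Pi>\<^sub>M i\<in>{..<n}. distr M borel (\<lambda>\<omega>. X (\<tau> (Suc i)) \<omega> - X (\<tau> i) \<omega>))"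
    if X: "standard_brownian_motion M X" for X
  proof -
    have rv: "random_variable borel (\<lambda>\<omega>. X (\<tau> (Suc i)) \<omega> - X (\<tau> i) \<omega>)" if "i \<in> {..<n}" for i
      using that by (intro borel_measurable_diff sbm_measurable[OF X] nonneg) auto
    then show D: "D X \<in> measurable M (Pi\<^sub>M {..<n} (\<lambda>_. borel))"
      unfolding D_def by (rule measurable_restrict)
    have "sample_path X -` prod_emb {0..} (\<lambda>_. borel) J (Pi\<^sub>E J A) \<inter> space M = D X -` E \<inter> space M"
    proof -
      have "(X j \<omega> \<in> A j) = ((\<Sum>i<idx j. D X \<omega> i) \<in> A j)" if "j \<in> J" "\<omega> \<in> space M" for j \<omega>
      proof -
        have "X j \<omega> = (\<Sum>i<idx j. X (\<tau> (Suc i)) \<omega> - X (\<tau> i) \<omega>)"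
          using sbm_eq_sum_increments[OF X that(2), of \<tau> "idx j"] \<tau>(1,3) that(1) by simp
        also have "\<dots> = (\<Sum>i<idx j. D X \<omega> i)"
          using \<tau>(3)[OF that(1)] by (intro sum.cong) (auto simp: D_def n_def)
        finally show ?thesis by simp
      qed
      moreover have "sample_path X -` prod_emb {0..} (\<lambda>_. borel) J (Pi\<^sub>E J A) \<inter> space M =
          {\<omega> \<in> space M. \<forall>j\<in>J. X j \<omega> \<in> A j}"
        unfolding sample_path_def by (rule vimage_box[OF J sbm_measurable[OF X]]) auto
      ultimately show ?thesis
        using measurable_space[OF D] by (auto simp: E_def)
    qed
    moreover have "prod_emb {0..} (\<lambda>_. borel) J (Pi\<^sub>E J A) \<in> sets path_space"
      using J A by (intro sets_PiM_I) auto
    ultimately show "emeasure (distr M path_space (sample_path X)) (prod_emb {0..} (\<lambda>_. borel) J (Pi\<^sub>E J A)) =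
      emeasure (distr M (Pi\<^sub>M {..<n} (\<lambda>_. borel)) (D X)) E"
      using E D sbm_path_measurable[OF X] by (simp add: emeasure_distr)
    show "distr M (Pi\<^sub>M {..<n} (\<lambda>_. borel)) (D X) =
      (\<Pi>\<^sub>M i\<in>{..<n}. distr M borel (\<lambda>\<omega>. X (\<tau> (Suc i)) \<omega> - X (\<tau> i) \<omega>))" if "n > 0"
      unfolding D_def
      by (rule indep_vars_iff_distr_eq_PiM'[THEN iffD1])
         (use rv that sbm_indep[OF X, of \<tau> n] \<tau>(1,2) in \<open>auto simp: n_def\<close>)
  qed
  have marginal: "distr M borel (\<lambda>\<omega>. B (\<tau> (Suc i)) \<omega> - B (\<tau> i) \<omega>) =
      distr M borel (\<lambda>\<omega>. C (\<tau> (Suc i)) \<omega> - C (\<tau> i) \<omega>)" if i: "i < n" for i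
  proof (cases "\<tau> i = \<tau> (Suc i)")
    case False
    then have "\<tau> i < \<tau> (Suc i)" using \<tau>(2)[of i] i by (auto simp: n_def)
    note less = nonneg[OF less_imp_le[OF i]] this
    have "distr M borel (\<lambda>\<omega>. X (\<tau> (Suc i)) \<omega> - X (\<tau> i) \<omega>) =
        density lborel (normal_density 0 (sqrt (\<tau> (Suc i) - \<tau> i)))"
      if X: "standard_brownian_motion M X" for X
      using distributed_distr_eq_density[OF sbm_normal[OF X less]]
      by (simp cong: distr_cong)
    from this[OF B] this[OF C] show ?thesis by simp
  qed simp
  have "distr M (Pi\<^sub>M {..<n} (\<lambda>_. borel)) (D B) = distr M (Pi\<^sub>M {..<n} (\<lambda>_. borel)) (D C)"
  proof (cases "n = 0")
    case True
    then have "D B = D C" by (auto simp: D_def fun_eq_iff)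
    then show ?thesis by simp
  next
    case False
    then show ?thesis
      unfolding prod[OF B, simplified neq0_conv[symmetric], OF False] prod[OF C, simplified neq0_conv[symmetric], OF False]
      by (intro PiM_cong marginal) auto
  qed
  then show "emeasure (distr M path_space (sample_path B)) (prod_emb {0..} (\<lambda>_. borel) J (Pi\<^sub>E J A)) =
      emeasure (distr M path_space (sample_path C)) (prod_emb {0..} (\<lambda>_. borel) J (Pi\<^sub>E J A))"
    by (simp add: box[OF B] box[OF C])
qed simp_all

lemma rational_grid_dense: "closure (\<rat> \<inter> {0..1}) = {0..1::real}"
proof
  show "closure (\<rat> \<inter> {0..1}) \<subseteq> {0..1::real}" by (intro closure_minimal) auto
  have "{0<..<1} \<inter> closure \<rat> \<subseteq> closure ({0<..<1} \<inter> (\<rat>::real set))"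
    by (rule open_Int_closure_subset) auto
  then have "{0<..<1} \<subseteq> closure ({0<..<1} \<inter> (\<rat>::real set))" by (simp add: Rats_closure_real)
  then have "closure {0<..<1} \<subseteq> closure ({0<..<1} \<inter> (\<rat>::real set))"
    by (rule closure_minimal) simp
  also have "\<dots> \<subseteq> closure (\<rat> \<inter> {0..1})" by (intro closure_mono) auto
  finally show "{0..1} \<subseteq> closure (\<rat> \<inter> {0..1::real})" by simp
qed

text \<open>Path events that quantify over all pairs of times need not be measurable in the product
  \<open>\<sigma>\<close>-algebra. For continuous paths they agree with events over rational times, which are
  measurable. The open set \<open>U\<close> restricts the pairs of times that are considered.\<close>

lemma le_on_square_if_le_on_rationals:
  fixes f :: "real \<times> real \<Rightarrow> real"
  assumes cont: "continuous_on ({0..1} \<times> {0..1}) f" and "open U"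
    and le: "\<And>r s. r \<in> \<rat> \<inter> {0..1} \<Longrightarrow> s \<in> \<rat> \<inter> {0..1} \<Longrightarrow> (r, s) \<in> U \<Longrightarrow> f (r, s) \<le> x"
    and rs: "r \<in> {0..1}" "s \<in> {0..1}" "(r, s) \<in> U"
  shows "f (r, s) \<le> x"
proof -
  let ?Q = "(\<rat> \<inter> {0..1::real}) \<times> (\<rat> \<inter> {0..1::real})"
  have cl: "closure ?Q = {0..1} \<times> {0..1}" by (simp only: closure_Times rational_grid_dense)
  have "U \<inter> closure ?Q \<subseteq> closure (U \<inter> ?Q)"
    by (rule open_Int_closure_subset[OF \<open>open U\<close>])
  with rs cl have "(r, s) \<in> closure (U \<inter> ?Q)" by auto
  moreover have "closure (U \<inter> ?Q) \<subseteq> {0..1} \<times> {0..1}"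
    unfolding cl[symmetric] by (intro closure_mono) auto
  then have "continuous_on (closure (U \<inter> ?Q)) f" by (rule continuous_on_subset[OF cont])
  moreover have "f v \<le> x" if "v \<in> U \<inter> ?Q" for v
    using that le[of "fst v" "snd v"] by (cases v) simp
  ultimately show ?thesis using continuous_le_on_closure by blast
qed

lemma rational_pair_event:
  assumes f: "\<And>r s. r \<in> \<rat> \<inter> {0..1} \<Longrightarrow> s \<in> \<rat> \<inter> {0..1} \<Longrightarrow>
     (\<lambda>w. f w r s) \<in> borel_measurable path_space"
  shows "{w \<in> space path_space. \<forall>r\<in>\<rat> \<inter> {0..1::real}. \<forall>s\<in>\<rat> \<inter> {0..1::real}.
     (r, s) \<in> U \<longrightarrow> f w r s \<le> (x::real)} \<in> sets path_space"
proof -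
  have Q: "countable (\<rat> \<inter> {0..1::real})" using countable_rat by (rule countable_subset[rotated]) auto
  have "{w \<in> space path_space. (r, s) \<in> U \<longrightarrow> f w r s \<le> x} \<in> sets path_space"
    if "r \<in> \<rat> \<inter> {0..1}" "s \<in> \<rat> \<inter> {0..1}" for r s
    using f[OF that] by measurable
  then show ?thesis
    by (intro sets.sets_Collect_countable_All' Q) auto
qed

lemma path_coordinate_measurable [measurable]: "t \<ge> 0 \<Longrightarrow> (\<lambda>w. w t) \<in> borel_measurable path_space"
  by (rule measurable_component_singleton) auto

definition osc_event :: "real \<Rightarrow> real \<Rightarrow> (real \<Rightarrow> real) set" where
  "osc_event \<delta> e = {w \<in> space path_space. \<forall>r\<in>\<rat> \<inter> {0..1}. \<forall>s\<in>\<rat> \<inter> {0..1}.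
     (r, s) \<in> {(r, s). \<bar>r - s\<bar> < \<delta>} \<longrightarrow> \<bar>w r - w s\<bar> \<le> e}"

lemma osc_event_measurable: "osc_event \<delta> e \<in> sets path_space"
  unfolding osc_event_def by (rule rational_pair_event) auto

text \<open>Continuity extends the bound from rational to real times, because the pairs in question form
  an open set.\<close>

lemma osc_event_iff:
  assumes "continuous_on {0..} w"
  shows "(\<lambda>t\<in>{0..}. w t) \<in> osc_event \<delta> e \<longleftrightarrow>
    (\<forall>r\<in>{0..1}. \<forall>s\<in>{0..1}. \<bar>r - s\<bar> < \<delta> \<longrightarrow> \<bar>w r - w s\<bar> \<le> e)"
proof safe
  fix r s :: real assume w: "(\<lambda>t\<in>{0..}. w t) \<in> osc_event \<delta> e" and rs: "r \<in> {0..1}" "s \<in> {0..1}" "\<bar>r - s\<bar> < \<delta>"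
  let ?f = "\<lambda>(r, s). \<bar>w r - w s\<bar>"
  have "?f (r, s) \<le> e"
  proof (rule le_on_square_if_le_on_rationals[OF _ _ _ rs(1,2)])
    show "continuous_on ({0..1} \<times> {0..1}) ?f"
      unfolding case_prod_beta
      by (intro continuous_intros continuous_on_compose2[OF assms]) auto
    show "open {(r, s). \<bar>r - s\<bar> < \<delta>}"
      unfolding case_prod_beta by (intro open_Collect_less continuous_intros)
    show "(r, s) \<in> {(r, s). \<bar>r - s\<bar> < \<delta>}" using rs by simp
  qed (use w in \<open>auto simp: osc_event_def\<close>)
  then show "\<bar>w r - w s\<bar> \<le> e" by simp
qed (auto simp: osc_event_def space_PiM)

definition range_event :: "real \<Rightarrow> (real \<Rightarrow> real) set" where
  "range_event x = {w \<in> space path_space. \<forall>r\<in>\<rat> \<inter> {0..1}. \<forall>s\<in>\<rat> \<inter> {0..1}.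
     (r, s) \<in> UNIV \<longrightarrow> 2 * (w r - w s) - \<bar>w 1\<bar> \<le> x}"

lemma range_event_measurable: "range_event x \<in> sets path_space"
  unfolding range_event_def by (rule rational_pair_event) auto

lemma range_event_iff:
  assumes cont: "continuous_on {0..} w"
  shows "(\<lambda>t\<in>{0..}. w t) \<in> range_event x \<longleftrightarrow>
    2 * ((SUP s\<in>{0..1}. w s) - (INF s\<in>{0..1}. w s)) - \<bar>w 1\<bar> \<le> x"
proof
  have cont': "continuous_on {0..1} w" by (rule continuous_on_subset[OF cont]) auto
  obtain s where s: "s \<in> {0..1}" "\<And>t. t \<in> {0..1} \<Longrightarrow> w t \<le> w s"
    using continuous_attains_sup[OF _ _ cont'] by fastforce
  obtain r where r: "r \<in> {0..1}" "\<And>t. t \<in> {0..1} \<Longrightarrow> w r \<le> w t"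
    using continuous_attains_inf[OF _ _ cont'] by fastforce
  have sup: "(SUP s\<in>{0..1}. w s) = w s" using s by (intro cSup_eq_maximum) auto
  have inf: "(INF s\<in>{0..1}. w s) = w r" using r by (intro cInf_eq_minimum) auto
  {
    assume w: "(\<lambda>t\<in>{0..}. w t) \<in> range_event x"
    let ?f = "\<lambda>(r, s). 2 * (w r - w s) - \<bar>w 1\<bar>"
    have "?f (s, r) \<le> x"
    proof (rule le_on_square_if_le_on_rationals[OF _ open_UNIV _ s(1) r(1)])
      show "continuous_on ({0..1} \<times> {0..1}) ?f"
        unfolding case_prod_beta
        by (intro continuous_intros continuous_on_compose2[OF cont]) auto
    qed (use w in \<open>auto simp: range_event_def\<close>)
    then show "2 * ((SUP s\<in>{0..1}. w s) - (INF s\<in>{0..1}. w s)) - \<bar>w 1\<bar> \<le> x"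
      by (simp add: sup inf)
  }
  assume "2 * ((SUP s\<in>{0..1}. w s) - (INF s\<in>{0..1}. w s)) - \<bar>w 1\<bar> \<le> x"
  then have "2 * (w t - w u) - \<bar>w 1\<bar> \<le> x" if "t \<in> {0..1}" "u \<in> {0..1}" for t u
    using s(2)[OF that(1)] r(2)[OF that(2)] unfolding sup inf by argo
  then show "(\<lambda>t\<in>{0..}. w t) \<in> range_event x"
    by (auto simp: range_event_def space_PiM)
qed

lemma (in prob_space) sbm_event_prob_eq:
  assumes "standard_brownian_motion M B" "standard_brownian_motion M C" "E \<in> sets path_space"
  shows "prob {\<omega> \<in> space M. sample_path B \<omega> \<in> E} = prob {\<omega> \<in> space M. sample_path C \<omega> \<in> E}"
proof -
  have "prob {\<omega> \<in> space M. sample_path X \<omega> \<in> E} = measure (distr M path_space (sample_path X)) E"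
    if "standard_brownian_motion M X" for X
    using sbm_path_measurable[OF that] assms(3)
    by (subst measure_distr) (auto intro!: arg_cong[where f = prob])
  with assms sbm_path_law[OF assms(1,2)] show ?thesis by simp
qed

text \<open>Both sides of the product formula are finite measures of the event in the past, so it suffices
  to compare them on cylinder sets. There the past is a function of finitely many increments, and
  all of these are independent of the later one.\<close>

lemma (in prob_space) sbm_past_indep_increment:
  assumes B: "standard_brownian_motion M B" and scd: "0 \<le> s" "s \<le> c" "c \<le> d"
  shows "indep_rv M (Pi\<^sub>M {0..s} (\<lambda>_. borel)) (\<lambda>\<omega>. \<lambda>u\<in>{0..s}. B u \<omega>) borel (\<lambda>\<omega>. B d \<omega> - B c \<omega>)"
  unfolding indep_rv_def
proof (intro conjI ballI)
  let ?R = "\<lambda>\<omega>. \<lambda>u\<in>{0..s}. B u \<omega>" and ?Y = "\<lambda>\<omega>. B d \<omega> - B c \<omega>"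
  let ?P = "Pi\<^sub>M {0..s} (\<lambda>_. borel :: real measure)"
  show R[measurable]: "random_variable ?P ?R"
    by (intro measurable_restrict sbm_measurable[OF B]) auto
  show Y[measurable]: "random_variable borel ?Y"
    by (intro borel_measurable_diff sbm_measurable[OF B]) (use scd in auto)
  fix E and F :: "real set" assume E: "E \<in> sets ?P" and F[measurable]: "F \<in> sets borel"
  \<comment> \<open>Two measures of the past: restricted to the event \<open>Y \<in> F\<close>, and multiplied by its probability.\<close>
  define b where "b = prob {\<omega> \<in> space M. ?Y \<omega> \<in> F}"
  let ?D = "{\<omega> \<in> space M. ?Y \<omega> \<in> F}"
  have D: "?D \<in> sets M" by measurable
  define Q1 where "Q1 = distr (density M (indicator ?D)) ?P ?R"
  define Q2 where "Q2 = scale_measure (ennreal b) (distr M ?P ?R)"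
  have Q1: "emeasure Q1 G = emeasure M {\<omega> \<in> space M. ?R \<omega> \<in> G \<and> ?Y \<omega> \<in> F}" if G: "G \<in> sets ?P" for G
  proof -
    have "emeasure Q1 G = emeasure (density M (indicator ?D)) (?R -` G \<inter> space M)"
      unfolding Q1_def using G by (subst emeasure_distr) auto
    also have "\<dots> = (\<integral>\<^sup>+ \<omega>. indicator ?D \<omega> * indicator (?R -` G \<inter> space M) \<omega> \<partial>M)"
      using D measurable_sets[OF R G] by (intro emeasure_density) auto
    also have "\<dots> = (\<integral>\<^sup>+ \<omega>. indicator (?D \<inter> (?R -` G \<inter> space M)) \<omega> \<partial>M)"
      by (simp only: indicator_inter_arith)
    also have "\<dots> = emeasure M (?D \<inter> (?R -` G \<inter> space M))"
      using D measurable_sets[OF R G] by (intro nn_integral_indicator) auto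
    also have "?D \<inter> (?R -` G \<inter> space M) = {\<omega> \<in> space M. ?R \<omega> \<in> G \<and> ?Y \<omega> \<in> F}" by auto
    finally show ?thesis .
  qed
  have Q2: "emeasure Q2 G = ennreal b * emeasure M {\<omega> \<in> space M. ?R \<omega> \<in> G}" if G: "G \<in> sets ?P" for G
    unfolding Q2_def emeasure_scale_measure using G R
    by (subst emeasure_distr) (auto intro!: arg_cong[where f = "\<lambda>x. _ * emeasure M x"])
  have "Q1 = Q2"
  proof (rule measure_eqI_PiM_infinite)
    show "sets Q1 = sets ?P" "sets Q2 = sets ?P" by (simp_all add: Q1_def Q2_def)
    show "finite_measure Q1"
    proof
      have "emeasure Q1 (space Q1) \<le> emeasure M (space M)"
        using Q1[of "space ?P"] by (auto simp: Q1_def intro!: emeasure_mono)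
      then show "emeasure Q1 (space Q1) \<noteq> \<infinity>" by (auto simp: emeasure_space_1 top_unique) 
    qed
    fix A :: "real \<Rightarrow> real set" and J :: "real set"
    assume J: "finite J" "J \<subseteq> {0..s}" and A: "\<And>i. i \<in> J \<Longrightarrow> A i \<in> sets borel"
    let ?box = "prod_emb {0..s} (\<lambda>_. borel) J (Pi\<^sub>E J A)"
    have box: "?box \<in> sets ?P" using J A by (intro sets_PiM_I) auto
    have "?R -` ?box \<inter> space M = {\<omega> \<in> space M. \<forall>j\<in>J. B j \<omega> \<in> A j}"
      by (rule vimage_box[OF J sbm_measurable[OF B]]) auto
    then have eq: "{\<omega> \<in> space M. ?R \<omega> \<in> ?box \<and> ?Y \<omega> \<in> F} =
        {\<omega> \<in> space M. (\<forall>j\<in>J. B j \<omega> \<in> A j) \<and> ?Y \<omega> \<in> F}"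
      "{\<omega> \<in> space M. ?R \<omega> \<in> ?box} = {\<omega> \<in> space M. (\<forall>j\<in>J. B j \<omega> \<in> A j)}"
      by blast+
    obtain \<tau>0 idx where \<tau>0: "\<tau>0 0 = 0" "\<And>i. i < card J \<Longrightarrow> \<tau>0 i \<le> \<tau>0 (Suc i)"
      "\<And>j. j \<in> J \<Longrightarrow> idx j \<le> card J \<and> \<tau>0 (idx j) = j" "\<And>i. i \<le> card J \<Longrightarrow> \<tau>0 i \<in> insert (0::real) J"
      using ordered_enumeration[OF J] by blast
    define n where "n = card J"
    define \<tau> where "\<tau> i = (if i \<le> n then \<tau>0 i else if i = Suc n then c else d)" for i
    have \<tau>: "\<tau> 0 = 0" "\<And>i. i < Suc (Suc n) \<Longrightarrow> \<tau> i \<le> \<tau> (Suc i)"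
      "\<And>j. j \<in> J \<Longrightarrow> idx j \<le> n \<and> \<tau> (idx j) = j" "\<tau> (Suc n) = c" "\<tau> (Suc (Suc n)) = d"
    proof -
      show "\<tau> 0 = 0" "\<tau> (Suc n) = c" "\<tau> (Suc (Suc n)) = d"
        using \<tau>0(1) by (simp_all add: \<tau>_def)
      show "idx j \<le> n \<and> \<tau> (idx j) = j" if "j \<in> J" for j
        using \<tau>0(3)[OF that] by (simp add: \<tau>_def n_def)
      show "\<tau> i \<le> \<tau> (Suc i)" if "i < Suc (Suc n)" for i
      proof -
        consider "i < n" | "i = n" | "i = Suc n" using \<open>i < Suc (Suc n)\<close> by linarith
        then show ?thesis
        proof cases
          case 1
          then show ?thesis using \<tau>0(2)[of i] by (simp add: \<tau>_def n_def)
        next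
          case 2
          have "\<tau>0 n \<in> insert 0 J" using \<tau>0(4)[of n] by (simp add: n_def)
          then have "\<tau>0 n \<le> c" using J(2) scd by auto
          then show ?thesis using 2 by (simp add: \<tau>_def)
        next
          case 3
          then show ?thesis using scd by (simp add: \<tau>_def)
        qed
      qed
    qed
    define \<Delta> where "\<Delta> i \<omega> = B (\<tau> (Suc i)) \<omega> - B (\<tau> i) \<omega>" for i \<omega>
    have ind: "indep_vars (\<lambda>_. borel) \<Delta> {..<Suc (Suc n)}"
      unfolding \<Delta>_def by (rule sbm_indep[OF B]) (use \<tau> in auto)
    have "indep_var (Pi\<^sub>M {..<n} (\<lambda>_. borel)) (\<lambda>\<omega>. restrict (\<lambda>i. \<Delta> i \<omega>) {..<n})
        (Pi\<^sub>M {Suc n} (\<lambda>_. borel)) (\<lambda>\<omega>. restrict (\<lambda>i. \<Delta> i \<omega>) {Suc n})"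
      by (rule indep_var_restrict[OF ind]) auto
    moreover define G where "G = {x \<in> space (Pi\<^sub>M {..<n} (\<lambda>_. borel :: real measure)). \<forall>j\<in>J. (\<Sum>i<idx j. x i) \<in> A j}"
    have "G \<in> sets (Pi\<^sub>M {..<n} (\<lambda>_. borel))"
      unfolding G_def by (rule partial_sums_event) (use J A \<tau>(3) in auto)
    moreover have "{x \<in> space (Pi\<^sub>M {Suc n} (\<lambda>_. borel :: real measure)). x (Suc n) \<in> F} \<in> sets (Pi\<^sub>M {Suc n} (\<lambda>_. borel))"
      (is "?F \<in> _")
      by measurable
    ultimately have "prob {\<omega> \<in> space M. restrict (\<lambda>i. \<Delta> i \<omega>) {..<n} \<in> G \<and> restrict (\<lambda>i. \<Delta> i \<omega>) {Suc n} \<in> ?F} =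
      prob {\<omega> \<in> space M. restrict (\<lambda>i. \<Delta> i \<omega>) {..<n} \<in> G} * prob {\<omega> \<in> space M. restrict (\<lambda>i. \<Delta> i \<omega>) {Suc n} \<in> ?F}"
      by (rule indep_rvD(3)[OF iffD1[OF indep_rv_indep_var]])
    moreover have "restrict (\<lambda>i. \<Delta> i \<omega>) {..<n} \<in> G \<longleftrightarrow> (\<forall>j\<in>J. B j \<omega> \<in> A j)" if "\<omega> \<in> space M" for \<omega>
    proof -
      have "B j \<omega> = (\<Sum>i<idx j. restrict (\<lambda>i. \<Delta> i \<omega>) {..<n} i)" if j: "j \<in> J" for j
      proof -
        have "B j \<omega> = (\<Sum>i<idx j. \<Delta> i \<omega>)"
          using sbm_eq_sum_increments[OF B \<open>\<omega> \<in> space M\<close>, of \<tau> "idx j"] \<tau>(1,3) j by (simp add: \<Delta>_def)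
        also have "\<dots> = (\<Sum>i<idx j. restrict (\<lambda>i. \<Delta> i \<omega>) {..<n} i)"
          using \<tau>(3)[OF j] by (intro sum.cong) auto
        finally show ?thesis .
      qed
      then show ?thesis by (auto simp: G_def space_PiM)
    qed
    moreover have "restrict (\<lambda>i. \<Delta> i \<omega>) {Suc n} \<in> ?F \<longleftrightarrow> ?Y \<omega> \<in> F" for \<omega>
      by (simp add: space_PiM \<Delta>_def \<tau>(4,5))
    ultimately have "prob {\<omega> \<in> space M. (\<forall>j\<in>J. B j \<omega> \<in> A j) \<and> ?Y \<omega> \<in> F} =
       prob {\<omega> \<in> space M. \<forall>j\<in>J. B j \<omega> \<in> A j} * b"
      unfolding b_def by (simp cong: conj_cong)
    then show "emeasure Q1 ?box = emeasure Q2 ?box"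
      unfolding Q1[OF box] Q2[OF box] eq
      by (simp add: emeasure_eq_measure ennreal_mult' b_def mult.commute)
  qed
  then have "emeasure Q1 E = emeasure Q2 E" by simp
  then show "prob {\<omega> \<in> space M. ?R \<omega> \<in> E \<and> ?Y \<omega> \<in> F} =
      prob {\<omega> \<in> space M. ?R \<omega> \<in> E} * prob {\<omega> \<in> space M. ?Y \<omega> \<in> F}"
    unfolding Q1[OF E] Q2[OF E] b_def
    by (simp add: emeasure_eq_measure flip: ennreal_mult)
qed


text \<open>The paths are uniformly continuous on the unit interval, so the modulus of continuity is small
  with high probability for one Brownian motion. The event is determined by the path law, whence the
  same \<open>\<delta>\<close> works for every Brownian motion, in particular for all the rescaled ones at once.\<close>

lemma (in prob_space) sbm_osc_tight:
  assumes B: "standard_brownian_motion M B" and e: "e > 0" and \<eta>: "\<eta> > 0"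
  obtains \<delta> where "\<delta> > 0"
    "\<And>C. standard_brownian_motion M C \<Longrightarrow> prob {\<omega> \<in> space M. sample_path C \<omega> \<notin> osc_event \<delta> e} < \<eta>"
proof -
  note [measurable] = sbm_path_measurable[OF B] osc_event_measurable
  define A where "A k = {\<omega> \<in> space M. sample_path B \<omega> \<notin> osc_event (1 / Suc k) e}" for k
  have A[measurable]: "A k \<in> events" for k unfolding A_def by measurable
  have "decseq A"
  proof (rule decseq_SucI, rule subsetI)
    fix k \<omega> assume \<omega>: "\<omega> \<in> A (Suc k)"
    then have sp: "\<omega> \<in> space M" by (simp add: A_def)
    have "1 / Suc (Suc k) \<le> 1 / real (Suc k)" by (simp add: field_simps)
    with \<omega> show "\<omega> \<in> A k"
      unfolding A_def sample_path_def mem_Collect_eq osc_event_iff[OF sbm_continuous[OF B sp]] by fastforce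
  qed
  then have "(\<lambda>k. prob (A k)) \<longlonglongrightarrow> prob (\<Inter>k. A k)"
    by (intro finite_Lim_measure_decseq) auto
  moreover have "(\<Inter>k. A k) = {}"
  proof -
    have False if \<omega>: "\<And>k. \<omega> \<in> A k" for \<omega>
    proof -
      have sp: "\<omega> \<in> space M" using \<omega>[of 0] by (simp add: A_def)
      have "uniformly_continuous_on {0..1} (\<lambda>t. B t \<omega>)"
        by (intro compact_uniformly_continuous continuous_on_subset[OF sbm_continuous[OF B sp]]) auto
      then obtain d where d: "d > 0"
        "\<And>r s. r \<in> {0..1} \<Longrightarrow> s \<in> {0..1} \<Longrightarrow> dist s r < d \<Longrightarrow> dist (B s \<omega>) (B r \<omega>) < e"
        unfolding uniformly_continuous_on_def using e by metis
      obtain k where "1 / Suc k < d" using nat_approx_posE[OF d(1)] by auto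
      then have "sample_path B \<omega> \<in> osc_event (1 / Suc k) e"
        unfolding sample_path_def osc_event_iff[OF sbm_continuous[OF B sp]]
        using d(2) by (force simp: dist_real_def)
      with \<omega>[of k] show False by (simp add: A_def)
    qed
    then show ?thesis by auto
  qed
  ultimately have "(\<lambda>k. prob (A k)) \<longlonglongrightarrow> 0" by simp
  then obtain k where k: "prob (A k) < \<eta>"
    using order_tendstoD(2)[OF _ \<eta>] eventually_happens'[OF sequentially_bot] by blast
  show thesis
  proof (rule that[of "1 / Suc k"])
    fix C assume C: "standard_brownian_motion M C"
    have "prob {\<omega> \<in> space M. sample_path C \<omega> \<in> space path_space - osc_event (1 / Suc k) e} =
      prob {\<omega> \<in> space M. sample_path B \<omega> \<in> space path_space - osc_event (1 / Suc k) e}"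
      by (rule sbm_event_prob_eq[OF C B]) (auto intro: osc_event_measurable)
    moreover have "{\<omega> \<in> space M. sample_path X \<omega> \<in> space path_space - osc_event (1 / Suc k) e} =
      {\<omega> \<in> space M. sample_path X \<omega> \<notin> osc_event (1 / Suc k) e}" for X
      by (auto simp: sample_path_def space_PiM)
    ultimately show "prob {\<omega> \<in> space M. sample_path C \<omega> \<notin> osc_event (1 / Suc k) e} < \<eta>"
      using k by (simp add: A_def)
  qed simp
qed

text \<open>The interval \<open>[0, s]\<close> is covered by \<open>n\<close> steps that are shorter than \<open>\<delta>\<close>.\<close>

lemma osc_event_bounded:
  fixes w :: "real \<Rightarrow> real"
  assumes osc: "\<And>r s. r \<in> {0..1} \<Longrightarrow> s \<in> {0..1} \<Longrightarrow> \<bar>r - s\<bar> < \<delta> \<Longrightarrow> \<bar>w r - w s\<bar> \<le> e"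
    and n: "1 / \<delta> < real n" "\<delta> > 0" and w0: "w 0 = 0" and s: "s \<in> {0..1}"
  shows "\<bar>w s\<bar> \<le> real n * e"
proof -
  have n0: "n > 0" using n by (cases n) (auto simp: field_simps dest: less_asym)
  have "\<bar>w (real k * s / n)\<bar> \<le> real k * e" if "k \<le> n" for k
    using that
  proof (induction k)
    case 0
    then show ?case by (simp add: w0)
  next
    case (Suc k)
    have mem: "real j * s / n \<in> {0..1}" if "j \<le> n" for j
      using that s n0 mult_mono[of "real j" "real n" s 1] by (auto simp: field_simps)
    have "\<bar>real (Suc k) * s / n - real k * s / n\<bar> = s / n"
      using s by (simp add: algebra_simps add_divide_distrib)
    also have "\<dots> \<le> 1 / n" using s n0 by (simp add: divide_right_mono)
    also have "\<dots> < \<delta>" using n n0 by (simp add: field_simps)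
    finally have "\<bar>w (real (Suc k) * s / n) - w (real k * s / n)\<bar> \<le> e"
      using Suc.prems by (intro osc mem) auto
    with Suc show ?case by (auto simp: algebra_simps)
  qed
  from this[of n] n0 show ?thesis by simp
qed

section \<open>The Ito isometry for step processes\<close>

text \<open>Brownian motion relative to a filtration that may carry more information than its own past.\<close>

definition brownian_wrt :: "'a measure \<Rightarrow> (real \<Rightarrow> 'a measure) \<Rightarrow> (real \<Rightarrow> 'a \<Rightarrow> real) \<Rightarrow> bool" where
  "brownian_wrt M F B \<longleftrightarrow> standard_brownian_motion M B \<and>
     (\<forall>s\<ge>0. space (F s) = space M \<and> sets (F s) \<subseteq> sets M \<and> B s \<in> borel_measurable (F s)) \<and>
     (\<forall>s\<ge>0. \<forall>t\<ge>s. sets (F s) \<subseteq> sets (F t)) \<and>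
     (\<forall>s\<ge>0. \<forall>t\<ge>s. indep_rv M (F s) (\<lambda>\<omega>. \<omega>) borel (\<lambda>\<omega>. B t \<omega> - B s \<omega>))"

lemma measurable_larger_sets:
  assumes "f \<in> borel_measurable N" "space N = space M" "sets N \<subseteq> sets M"
  shows "f \<in> borel_measurable M"
  using assms unfolding measurable_def by auto

lemma measurable_ident_coarser:
  assumes "space N = space M" "sets N \<subseteq> sets M"
  shows "(\<lambda>\<omega>. \<omega>) \<in> measurable M N"
  unfolding measurable_def
proof (intro CollectI conjI ballI)
  fix A assume "A \<in> sets N"
  then have "A \<in> sets M" using assms(2) by blast
  then show "(\<lambda>\<omega>. \<omega>) -` A \<inter> space M \<in> sets M" by (simp add: sets.Int)
qed (simp add: assms(1))

lemma brownian_wrt_measurable_mono: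
  assumes "brownian_wrt M F B" "f \<in> borel_measurable (F s)" "0 \<le> s" "s \<le> t"
  shows "f \<in> borel_measurable (F t)"
  by (rule measurable_larger_sets[OF assms(2)])
     (use assms order_trans[OF assms(3,4)] in \<open>auto simp: brownian_wrt_def\<close>)

lemma brownian_wrt_measurable_ambient:
  assumes "brownian_wrt M F B" "f \<in> borel_measurable (F s)" "0 \<le> s"
  shows "f \<in> borel_measurable M"
  by (rule measurable_larger_sets[OF assms(2)]) (use assms in \<open>auto simp: brownian_wrt_def\<close>)

lemma (in prob_space) sbm_increment_moments:
  assumes B: "standard_brownian_motion M B" and st: "0 \<le> s" "s \<le> t"
  shows "integrable M (\<lambda>\<omega>. B t \<omega> - B s \<omega>)" "expectation (\<lambda>\<omega>. B t \<omega> - B s \<omega>) = 0"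
    "integrable M (\<lambda>\<omega>. (B t \<omega> - B s \<omega>)\<^sup>2)" "expectation (\<lambda>\<omega>. (B t \<omega> - B s \<omega>)\<^sup>2) = t - s"
proof -
  have "integrable M (\<lambda>\<omega>. B t \<omega> - B s \<omega>) \<and> expectation (\<lambda>\<omega>. B t \<omega> - B s \<omega>) = 0 \<and>
    integrable M (\<lambda>\<omega>. (B t \<omega> - B s \<omega>)\<^sup>2) \<and> expectation (\<lambda>\<omega>. (B t \<omega> - B s \<omega>)\<^sup>2) = t - s"
  proof (cases "s = t")
    case True
    then show ?thesis by simp
  next
    case False
    then have less: "s < t" and pos: "sqrt (t - s) > 0" using st by auto
    note D = sbm_normal[OF B st(1) less]
    have 1: "integrable M (\<lambda>\<omega>. B t \<omega> - B s \<omega>)"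
      using distributed_integrable[OF D, of "\<lambda>x. x"] integrable_normal_moment_nz_1[OF pos, of 0] by simp
    have 2: "integrable M (\<lambda>\<omega>. (B t \<omega> - B s \<omega>)\<^sup>2)"
      using distributed_integrable[OF D, of "\<lambda>x. x\<^sup>2"] integrable_normal_moment[OF pos, of 0 2] by simp
    have 3: "expectation (\<lambda>\<omega>. B t \<omega> - B s \<omega>) = 0"
      by (rule normal_distributed_expectation[OF pos D])
    have 4: "expectation (\<lambda>\<omega>. (B t \<omega> - B s \<omega>)\<^sup>2) = t - s"
      using normal_distributed_variance[OF pos D] less by (simp only: 3) simp
    from 1 2 3 4 show ?thesis by simp
  qed
  then show "integrable M (\<lambda>\<omega>. B t \<omega> - B s \<omega>)" "expectation (\<lambda>\<omega>. B t \<omega> - B s \<omega>) = 0"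
    "integrable M (\<lambda>\<omega>. (B t \<omega> - B s \<omega>)\<^sup>2)" "expectation (\<lambda>\<omega>. (B t \<omega> - B s \<omega>)\<^sup>2) = t - s"
    by auto
qed

text \<open>By independence, the increment is averaged separately from the factor \<open>K\<close>, which belongs to
  the past.\<close>

lemma (in prob_space) brownian_wrt_conditioning:
  assumes B: "brownian_wrt M F B" and cd: "0 \<le> c" "c \<le> d"
    and K: "K \<in> borel_measurable (F c)" "integrable M K"
  shows "integrable M (\<lambda>\<omega>. K \<omega> * (B d \<omega> - B c \<omega>))"
    "expectation (\<lambda>\<omega>. K \<omega> * (B d \<omega> - B c \<omega>)) = 0"
    "integrable M (\<lambda>\<omega>. K \<omega> * (B d \<omega> - B c \<omega>)\<^sup>2)"
    "expectation (\<lambda>\<omega>. K \<omega> * (B d \<omega> - B c \<omega>)\<^sup>2) = expectation K * (d - c)"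
proof -
  have sbm: "standard_brownian_motion M B" using B by (simp add: brownian_wrt_def)
  note mom = sbm_increment_moments[OF sbm cd]
  have ind: "indep_rv M (F c) (\<lambda>\<omega>. \<omega>) borel (\<lambda>\<omega>. B d \<omega> - B c \<omega>)"
    using B cd by (simp add: brownian_wrt_def)
  have 1: "indep_var borel K borel (\<lambda>\<omega>. B d \<omega> - B c \<omega>)"
    unfolding indep_rv_indep_var using indep_rv_compose[OF ind K(1), of "\<lambda>x. x"] by simp
  have 2: "indep_var borel K borel (\<lambda>\<omega>. (B d \<omega> - B c \<omega>)\<^sup>2)"
    unfolding indep_rv_indep_var using indep_rv_compose[OF ind K(1), of "\<lambda>x. x\<^sup>2"] by simp
  show "integrable M (\<lambda>\<omega>. K \<omega> * (B d \<omega> - B c \<omega>))"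
    by (rule indep_var_integrable[OF 1 K(2) mom(1)])
  show "expectation (\<lambda>\<omega>. K \<omega> * (B d \<omega> - B c \<omega>)) = 0"
    using indep_var_lebesgue_integral[OF 1 K(2) mom(1)] mom(2) by simp
  show "integrable M (\<lambda>\<omega>. K \<omega> * (B d \<omega> - B c \<omega>)\<^sup>2)"
    by (rule indep_var_integrable[OF 2 K(2) mom(3)])
  show "expectation (\<lambda>\<omega>. K \<omega> * (B d \<omega> - B c \<omega>)\<^sup>2) = expectation K * (d - c)"
    using indep_var_lebesgue_integral[OF 2 K(2) mom(3)] mom(4) by simp
qed

text \<open>The length of the intersection of \<open>(a, b]\<close> and \<open>(c, d]\<close>.\<close>

definition overlap :: "real \<Rightarrow> real \<Rightarrow> real \<Rightarrow> real \<Rightarrow> real" where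
  "overlap a b c d = max 0 (min b d - max a c)"

text \<open>The product is split at the later left endpoint and at the earlier right endpoint. In every
  term except the square of the common increment, one factor is an increment that is independent of
  the rest and centred.\<close>

lemma (in prob_space) increment_product_ordered:
  assumes B: "brownian_wrt M F B" and ab: "0 \<le> a" "a \<le> b" and cd: "a \<le> c" "c \<le> d"
    and h: "h \<in> borel_measurable (F a)" "\<And>\<omega>. \<omega> \<in> space M \<Longrightarrow> \<bar>h \<omega>\<bar> \<le> C"
    and g: "g \<in> borel_measurable (F c)" "\<And>\<omega>. \<omega> \<in> space M \<Longrightarrow> \<bar>g \<omega>\<bar> \<le> C'"
  shows "integrable M (\<lambda>\<omega>. (h \<omega> * (B b \<omega> - B a \<omega>)) * (g \<omega> * (B d \<omega> - B c \<omega>))) \<and>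
    expectation (\<lambda>\<omega>. (h \<omega> * (B b \<omega> - B a \<omega>)) * (g \<omega> * (B d \<omega> - B c \<omega>))) =
      expectation (\<lambda>\<omega>. h \<omega> * g \<omega>) * overlap a b c d"
proof -
  have sbm: "standard_brownian_motion M B" using B by (simp add: brownian_wrt_def)
  have BF: "B s \<in> borel_measurable (F u)" if "0 \<le> s" "s \<le> u" for s u
  proof -
    have "B s \<in> borel_measurable (F s)" using B that by (auto simp: brownian_wrt_def)
    then show ?thesis by (rule brownian_wrt_measurable_mono[OF B _ that])
  qed
  have hF: "h \<in> borel_measurable (F u)" if "a \<le> u" for u
    using brownian_wrt_measurable_mono[OF B h(1) ab(1) that] .
  have gF: "g \<in> borel_measurable (F u)" if "c \<le> u" for u
    using brownian_wrt_measurable_mono[OF B g(1) _ that] ab cd by simp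
  have [measurable]: "h \<in> borel_measurable M" "g \<in> borel_measurable M"
    using brownian_wrt_measurable_ambient[OF B h(1) ab(1)]
      brownian_wrt_measurable_ambient[OF B g(1) order_trans[OF ab(1) cd(1)]] by auto
  have hg_bound: "\<bar>h \<omega> * g \<omega>\<bar> \<le> C * C'" if "\<omega> \<in> space M" for \<omega>
    unfolding abs_mult using h(2)[OF that] g(2)[OF that]
    by (intro mult_mono) (auto intro: order_trans[OF abs_ge_zero])
  have int_hg: "integrable M (\<lambda>\<omega>. h \<omega> * g \<omega>)"
    by (rule integrable_const_bound[of _ "C * C'"]) (use hg_bound in auto)
  have int_hgB: "integrable M (\<lambda>\<omega>. h \<omega> * g \<omega> * (B v \<omega> - B u \<omega>))" if "0 \<le> u" "u \<le> v" for u v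
  proof (rule Bochner_Integration.integrable_bound)
    show "integrable M (\<lambda>\<omega>. C * C' * (B v \<omega> - B u \<omega>))"
      using sbm_increment_moments(1)[OF sbm that] by simp
    show "(\<lambda>\<omega>. h \<omega> * g \<omega> * (B v \<omega> - B u \<omega>)) \<in> borel_measurable M"
      using that by (intro borel_measurable_times borel_measurable_diff sbm_measurable[OF sbm]) auto
    show "AE \<omega> in M. norm (h \<omega> * g \<omega> * (B v \<omega> - B u \<omega>)) \<le> norm (C * C' * (B v \<omega> - B u \<omega>))"
    proof (rule AE_I2)
      fix \<omega> assume "\<omega> \<in> space M"
      from hg_bound[OF this] have "\<bar>h \<omega> * g \<omega>\<bar> \<le> \<bar>C * C'\<bar>" by linarith
      then show "norm (h \<omega> * g \<omega> * (B v \<omega> - B u \<omega>)) \<le> norm (C * C' * (B v \<omega> - B u \<omega>))"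
        unfolding real_norm_def abs_mult[of _ "B v \<omega> - B u \<omega>"] by (intro mult_right_mono) auto
    qed
  qed
  show ?thesis
  proof (cases "b \<le> c")
    case True
    have "(\<lambda>\<omega>. h \<omega> * g \<omega> * (B b \<omega> - B a \<omega>)) \<in> borel_measurable (F c)"
      using True ab cd by (intro borel_measurable_times borel_measurable_diff hF gF BF) auto
    from brownian_wrt_conditioning(1,2)[OF B _ cd(2) this int_hgB] ab cd True
    show ?thesis by (simp add: overlap_def mult_ac)
  next
    case False
    \<comment> \<open>From here on the intervals overlap in \<open>(c, m]\<close>.\<close>
    define m where "m = min b d"
    have m: "c \<le> m" "m \<le> b" "m \<le> d" "0 \<le> m" "0 \<le> c" using False ab cd by (auto simp: m_def)
    have K1: "(\<lambda>\<omega>. h \<omega> * g \<omega> * (B c \<omega> - B a \<omega>)) \<in> borel_measurable (F c)"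
      using ab cd by (intro borel_measurable_times borel_measurable_diff hF gF BF) auto
    note t1 = brownian_wrt_conditioning(1,2)[OF B m(5) cd(2) K1 int_hgB[OF ab(1) cd(1)]]
    have K2: "(\<lambda>\<omega>. h \<omega> * g \<omega>) \<in> borel_measurable (F c)"
      using ab cd by (intro borel_measurable_times hF gF) auto
    note t2 = brownian_wrt_conditioning(3,4)[OF B m(5) m(1) K2 int_hg]
    have K3: "(\<lambda>\<omega>. h \<omega> * g \<omega> * (B m \<omega> - B c \<omega>)) \<in> borel_measurable (F m)"
      using ab cd m by (intro borel_measurable_times borel_measurable_diff hF gF BF) auto
    note t3 = brownian_wrt_conditioning(1,2)[OF B m(4) m(3) K3 int_hgB[OF m(5) m(1)]]
    have t4: "integrable M (\<lambda>\<omega>. h \<omega> * g \<omega> * (B d \<omega> - B c \<omega>) * (B b \<omega> - B m \<omega>))"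
      "expectation (\<lambda>\<omega>. h \<omega> * g \<omega> * (B d \<omega> - B c \<omega>) * (B b \<omega> - B m \<omega>)) = 0"
    proof -
      have "integrable M (\<lambda>\<omega>. h \<omega> * g \<omega> * (B d \<omega> - B c \<omega>) * (B b \<omega> - B m \<omega>)) \<and>
        expectation (\<lambda>\<omega>. h \<omega> * g \<omega> * (B d \<omega> - B c \<omega>) * (B b \<omega> - B m \<omega>)) = 0"
      proof (cases "b \<le> d")
        case True
        then show ?thesis by (simp add: m_def)
      next
        case False
        then have "m = d" by (simp add: m_def)
        have K4: "(\<lambda>\<omega>. h \<omega> * g \<omega> * (B d \<omega> - B c \<omega>)) \<in> borel_measurable (F m)"
          using ab cd m \<open>m = d\<close> by (intro borel_measurable_times borel_measurable_diff hF gF BF) auto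
        show ?thesis
          using brownian_wrt_conditioning(1,2)[OF B m(4) m(2) K4 int_hgB[OF m(5) cd(2)]] by simp
      qed
      then show "integrable M (\<lambda>\<omega>. h \<omega> * g \<omega> * (B d \<omega> - B c \<omega>) * (B b \<omega> - B m \<omega>))"
        "expectation (\<lambda>\<omega>. h \<omega> * g \<omega> * (B d \<omega> - B c \<omega>) * (B b \<omega> - B m \<omega>)) = 0" by auto
    qed
    have eq: "(\<lambda>\<omega>. (h \<omega> * (B b \<omega> - B a \<omega>)) * (g \<omega> * (B d \<omega> - B c \<omega>))) =
      (\<lambda>\<omega>. h \<omega> * g \<omega> * (B c \<omega> - B a \<omega>) * (B d \<omega> - B c \<omega>) + h \<omega> * g \<omega> * (B m \<omega> - B c \<omega>)\<^sup>2 +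
         h \<omega> * g \<omega> * (B m \<omega> - B c \<omega>) * (B d \<omega> - B m \<omega>) + h \<omega> * g \<omega> * (B d \<omega> - B c \<omega>) * (B b \<omega> - B m \<omega>))"
      by (simp add: fun_eq_iff power2_eq_square algebra_simps)
    have "overlap a b c d = m - c" using m cd by (simp add: overlap_def m_def)
    then show ?thesis
      unfolding eq using t1 t2 t3 t4 by simp
  qed
qed

text \<open>Cutting a step process off at a time produces empty intervals whose heights carry later
  information. They contribute nothing.\<close>

lemma (in prob_space) increment_product:
  assumes B: "brownian_wrt M F B" and ab: "0 \<le> a" "a \<le> b" and cd: "0 \<le> c" "c \<le> d"
    and h: "a < b \<Longrightarrow> h \<in> borel_measurable (F a)" "\<And>\<omega>. \<omega> \<in> space M \<Longrightarrow> \<bar>h \<omega>\<bar> \<le> C"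
    and g: "c < d \<Longrightarrow> g \<in> borel_measurable (F c)" "\<And>\<omega>. \<omega> \<in> space M \<Longrightarrow> \<bar>g \<omega>\<bar> \<le> C'"
  shows "integrable M (\<lambda>\<omega>. (h \<omega> * (B b \<omega> - B a \<omega>)) * (g \<omega> * (B d \<omega> - B c \<omega>)))"
    "expectation (\<lambda>\<omega>. (h \<omega> * (B b \<omega> - B a \<omega>)) * (g \<omega> * (B d \<omega> - B c \<omega>))) =
      expectation (\<lambda>\<omega>. h \<omega> * g \<omega>) * overlap a b c d"
proof -
  have "integrable M (\<lambda>\<omega>. (h \<omega> * (B b \<omega> - B a \<omega>)) * (g \<omega> * (B d \<omega> - B c \<omega>))) \<and>
    expectation (\<lambda>\<omega>. (h \<omega> * (B b \<omega> - B a \<omega>)) * (g \<omega> * (B d \<omega> - B c \<omega>))) =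
      expectation (\<lambda>\<omega>. h \<omega> * g \<omega>) * overlap a b c d"
  proof (cases "a = b \<or> c = d")
    case True
    then have "overlap a b c d = 0" by (auto simp: overlap_def)
    with True show ?thesis by auto
  next
    case False
    then have lt: "a < b" "c < d" using ab cd by auto
    show ?thesis
    proof (cases "a \<le> c")
      case True
      show ?thesis
        by (rule increment_product_ordered[OF B ab True cd(2) h(1)[OF lt(1)] h(2) g(1)[OF lt(2)] g(2)])
    next
      case False
      then have "c \<le> a" by simp
      from increment_product_ordered[OF B cd this ab(2) g(1)[OF lt(2)] g(2) h(1)[OF lt(1)] h(2)]
      show ?thesis by (simp add: overlap_def mult.commute min.commute max.commute)
    qed
  qed
  then show "integrable M (\<lambda>\<omega>. (h \<omega> * (B b \<omega> - B a \<omega>)) * (g \<omega> * (B d \<omega> - B c \<omega>)))"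
    "expectation (\<lambda>\<omega>. (h \<omega> * (B b \<omega> - B a \<omega>)) * (g \<omega> * (B d \<omega> - B c \<omega>))) =
      expectation (\<lambda>\<omega>. h \<omega> * g \<omega>) * overlap a b c d" by auto
qed

lemma step_function_square_integral:
  fixes h a b :: "'i \<Rightarrow> real"
  assumes I: "finite I"
  shows "has_bochner_integral lborel (\<lambda>s. (\<Sum>i\<in>I. h i * indicator {a i<..b i} s)\<^sup>2)
      (\<Sum>i\<in>I. \<Sum>j\<in>I. h i * h j * overlap (a i) (b i) (a j) (b j))"
proof -
  have ind: "h i * indicator {a i<..b i} s * (h j * indicator {a j<..b j} s) =
      h i * h j * indicator {max (a i) (a j)<..min (b i) (b j)} s"
    for i j s by (auto simp: indicator_def)
  have ov: "has_bochner_integral lborel (indicator {l<..u::real}) (max 0 (u - l))" for l u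
    using has_bochner_integral_real_indicator[of "{l<..u}" lborel]
    by (cases "l \<le> u") (auto simp: max_def)
  have eq: "(\<Sum>i\<in>I. h i * indicator {a i<..b i} s)\<^sup>2 =
      (\<Sum>i\<in>I. \<Sum>j\<in>I. h i * h j * indicator {max (a i) (a j)<..min (b i) (b j)} s)" for s
    unfolding power2_eq_square sum_product ind ..
  show ?thesis
    unfolding eq overlap_def by (intro has_bochner_integral_sum has_bochner_integral_mult_right ov)
qed

text \<open>The difference of two step processes with different knots is a finite linear combination of
  indicators of overlapping intervals. The isometry is therefore proved for arbitrary finite
  families of intervals.\<close>

lemma (in prob_space) ito_isometry:
  fixes h :: "'i \<Rightarrow> 'a \<Rightarrow> real"
  assumes B: "brownian_wrt M F B" and I: "finite I"
    and ab: "\<And>i. i \<in> I \<Longrightarrow> 0 \<le> a i \<and> a i \<le> b i"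
    and h: "\<And>i. i \<in> I \<Longrightarrow> a i < b i \<Longrightarrow> h i \<in> borel_measurable (F (a i))"
    and hM: "\<And>i. i \<in> I \<Longrightarrow> h i \<in> borel_measurable M"
    and C: "\<And>i \<omega>. i \<in> I \<Longrightarrow> \<omega> \<in> space M \<Longrightarrow> \<bar>h i \<omega>\<bar> \<le> C i"
  shows "(\<integral>\<^sup>+\<omega>. ennreal ((\<Sum>i\<in>I. h i \<omega> * (B (b i) \<omega> - B (a i) \<omega>))\<^sup>2) \<partial>M) =
    (\<integral>\<^sup>+\<omega>. (\<integral>\<^sup>+s. ennreal ((\<Sum>i\<in>I. h i \<omega> * indicator {a i<..b i} s)\<^sup>2) \<partial>lborel) \<partial>M)"
proof -
  let ?o = "\<lambda>i j. overlap (a i) (b i) (a j) (b j)"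
  have eq: "(\<Sum>i\<in>I. h i \<omega> * (B (b i) \<omega> - B (a i) \<omega>))\<^sup>2 =
      (\<Sum>i\<in>I. \<Sum>j\<in>I. (h i \<omega> * (B (b i) \<omega> - B (a i) \<omega>)) * (h j \<omega> * (B (b j) \<omega> - B (a j) \<omega>)))" for \<omega>
    unfolding power2_eq_square sum_product ..
  have P: "integrable M (\<lambda>\<omega>. (h i \<omega> * (B (b i) \<omega> - B (a i) \<omega>)) * (h j \<omega> * (B (b j) \<omega> - B (a j) \<omega>)))"
    "expectation (\<lambda>\<omega>. (h i \<omega> * (B (b i) \<omega> - B (a i) \<omega>)) * (h j \<omega> * (B (b j) \<omega> - B (a j) \<omega>))) =
      expectation (\<lambda>\<omega>. h i \<omega> * h j \<omega>) * ?o i j" if "i \<in> I" "j \<in> I" for i j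
    using increment_product[OF B, of "a i" "b i" "a j" "b j" "h i" "C i" "h j" "C j"] ab h C that by auto
  have int_hh: "integrable M (\<lambda>\<omega>. h i \<omega> * h j \<omega>)" if "i \<in> I" "j \<in> I" for i j
  proof (rule integrable_const_bound[of _ "C i * C j"])
    show "AE \<omega> in M. norm (h i \<omega> * h j \<omega>) \<le> C i * C j"
    proof (rule AE_I2)
      fix \<omega> assume "\<omega> \<in> space M"
      from C[OF that(1) this] C[OF that(2) this] show "norm (h i \<omega> * h j \<omega>) \<le> C i * C j"
        unfolding real_norm_def abs_mult by (intro mult_mono) (auto intro: order_trans[OF abs_ge_zero])
    qed
  qed (use hM that in auto)
  note sq = step_function_square_integral[OF I]
  have "(\<integral>\<^sup>+\<omega>. ennreal ((\<Sum>i\<in>I. h i \<omega> * (B (b i) \<omega> - B (a i) \<omega>))\<^sup>2) \<partial>M) =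
      ennreal (expectation (\<lambda>\<omega>. (\<Sum>i\<in>I. h i \<omega> * (B (b i) \<omega> - B (a i) \<omega>))\<^sup>2))"
  proof (rule nn_integral_eq_integral)
    show "integrable M (\<lambda>\<omega>. (\<Sum>i\<in>I. h i \<omega> * (B (b i) \<omega> - B (a i) \<omega>))\<^sup>2)"
      unfolding eq by (intro Bochner_Integration.integrable_sum P)
  qed simp
  also have "expectation (\<lambda>\<omega>. (\<Sum>i\<in>I. h i \<omega> * (B (b i) \<omega> - B (a i) \<omega>))\<^sup>2) =
      (\<Sum>i\<in>I. \<Sum>j\<in>I. expectation (\<lambda>\<omega>. h i \<omega> * h j \<omega>) * ?o i j)"
    unfolding eq using P by (simp add: Bochner_Integration.integral_sum)
  also have "\<dots> = expectation (\<lambda>\<omega>. \<Sum>i\<in>I. \<Sum>j\<in>I. h i \<omega> * h j \<omega> * ?o i j)"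
    using int_hh by (simp add: Bochner_Integration.integral_sum)
  also have "ennreal \<dots> = (\<integral>\<^sup>+\<omega>. ennreal (\<Sum>i\<in>I. \<Sum>j\<in>I. h i \<omega> * h j \<omega> * ?o i j) \<partial>M)"
  proof (rule nn_integral_eq_integral[symmetric])
    show "integrable M (\<lambda>\<omega>. \<Sum>i\<in>I. \<Sum>j\<in>I. h i \<omega> * h j \<omega> * ?o i j)"
      using int_hh by (auto intro!: Bochner_Integration.integrable_sum)
    show "AE \<omega> in M. 0 \<le> (\<Sum>i\<in>I. \<Sum>j\<in>I. h i \<omega> * h j \<omega> * ?o i j)"
    proof (rule AE_I2)
      fix \<omega>
      show "0 \<le> (\<Sum>i\<in>I. \<Sum>j\<in>I. h i \<omega> * h j \<omega> * ?o i j)"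
        unfolding has_bochner_integral_integral_eq[OF sq[of "\<lambda>i. h i \<omega>" a b], symmetric]
        by (rule Bochner_Integration.integral_nonneg) simp
    qed
  qed
  also have "\<dots> = (\<integral>\<^sup>+\<omega>. (\<integral>\<^sup>+s. ennreal ((\<Sum>i\<in>I. h i \<omega> * indicator {a i<..b i} s)\<^sup>2) \<partial>lborel) \<partial>M)"
  proof (rule nn_integral_cong)
    fix \<omega>
    have "(\<integral>\<^sup>+s. ennreal ((\<Sum>i\<in>I. h i \<omega> * indicator {a i<..b i} s)\<^sup>2) \<partial>lborel) =
        ennreal (\<integral>s. (\<Sum>i\<in>I. h i \<omega> * indicator {a i<..b i} s)\<^sup>2 \<partial>lborel)"
      using sq[of "\<lambda>i. h i \<omega>" a b] by (intro nn_integral_eq_integral) (auto simp: has_bochner_integral_iff)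
    then show "ennreal (\<Sum>i\<in>I. \<Sum>j\<in>I. h i \<omega> * h j \<omega> * ?o i j) =
        (\<integral>\<^sup>+s. ennreal ((\<Sum>i\<in>I. h i \<omega> * indicator {a i<..b i} s)\<^sup>2) \<partial>lborel)"
      unfolding has_bochner_integral_integral_eq[OF sq[of "\<lambda>i. h i \<omega>" a b]] by simp
  qed
  finally show ?thesis .
qed

lemma adapted_step_processD:
  assumes "adapted_step_process M F \<phi>"
  shows "i \<le> steps \<phi> \<Longrightarrow> 0 \<le> knot \<phi> i" "i < steps \<phi> \<Longrightarrow> knot \<phi> i \<le> knot \<phi> (Suc i)"
    "i < steps \<phi> \<Longrightarrow> height \<phi> i \<in> borel_measurable (F (knot \<phi> i))"
    "i < steps \<phi> \<Longrightarrow> \<exists>C. \<forall>\<omega>\<in>space M. \<bar>height \<phi> i \<omega>\<bar> \<le> C"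
proof -
  show "i \<le> steps \<phi> \<Longrightarrow> 0 \<le> knot \<phi> i"
  proof (induction i)
    case (Suc i)
    then have "0 \<le> knot \<phi> i" "knot \<phi> i \<le> knot \<phi> (Suc i)"
      using assms by (auto simp: adapted_step_process_def)
    then show ?case by linarith
  qed (use assms in \<open>simp add: adapted_step_process_def\<close>)
qed (use assms in \<open>auto simp: adapted_step_process_def\<close>)

text \<open>The two families of intervals, cut off at time \<open>t\<close>, are combined into one family over a
  disjoint union, with the heights of the second one negated.\<close>

lemma (in prob_space) step_integral_isometry:
  assumes B: "brownian_wrt M F B" and \<phi>: "adapted_step_process M F \<phi>" and \<psi>: "adapted_step_process M F \<psi>"
    and t: "0 \<le> t"
  shows "(\<integral>\<^sup>+\<omega>. ennreal ((step_integral B t \<phi> \<omega> - step_integral B t \<psi> \<omega>)\<^sup>2) \<partial>M) =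
    (\<integral>\<^sup>+\<omega>. (\<integral>\<^sup>+s\<in>{0..t}. ennreal ((step_value \<phi> s \<omega> - step_value \<psi> s \<omega>)\<^sup>2) \<partial>lborel) \<partial>M)"
proof -
  define I where "I = {..<steps \<phi>} <+> {..<steps \<psi>}"
  define a where "a = case_sum (\<lambda>i. min t (knot \<phi> i)) (\<lambda>i. min t (knot \<psi> i))"
  define b where "b = case_sum (\<lambda>i. min t (knot \<phi> (Suc i))) (\<lambda>i. min t (knot \<psi> (Suc i)))"
  define h where "h = case_sum (height \<phi>) (\<lambda>i \<omega>. - height \<psi> i \<omega>)"
  note D = adapted_step_processD[OF \<phi>] adapted_step_processD[OF \<psi>]
  have fin: "finite I" by (simp add: I_def)
  have ab: "0 \<le> a i \<and> a i \<le> b i" if "i \<in> I" for i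
    using that D(1,2,5,6) t by (force simp: I_def a_def b_def)
  have hM: "h i \<in> borel_measurable M" if "i \<in> I" for i
    using that brownian_wrt_measurable_ambient[OF B D(3) D(1)] brownian_wrt_measurable_ambient[OF B D(7) D(5)]
    by (auto simp: I_def h_def)
  have hF: "h i \<in> borel_measurable (F (a i))" if "i \<in> I" "a i < b i" for i
    using that D(3,7) by (auto simp: I_def h_def a_def b_def min_def split: if_splits)
  have "\<exists>C. \<forall>\<omega>\<in>space M. \<bar>h i \<omega>\<bar> \<le> C" if "i \<in> I" for i
    using that D(4,8) by (auto simp: I_def h_def)
  then obtain C where C: "\<And>i \<omega>. i \<in> I \<Longrightarrow> \<omega> \<in> space M \<Longrightarrow> \<bar>h i \<omega>\<bar> \<le> C i" by metis
  have 1: "step_integral B t \<phi> \<omega> - step_integral B t \<psi> \<omega> = (\<Sum>i\<in>I. h i \<omega> * (B (b i) \<omega> - B (a i) \<omega>))" for \<omega>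
    by (simp add: step_integral_def I_def sum.Plus h_def a_def b_def sum_negf)
  have 2: "ennreal ((step_value \<phi> s \<omega> - step_value \<psi> s \<omega>)\<^sup>2) * indicator {0..t} s =
      ennreal ((\<Sum>i\<in>I. h i \<omega> * indicator {a i<..b i} s)\<^sup>2)" for s \<omega>
  proof (cases "s \<in> {0..t}")
    case True
    then have "step_value \<phi> s \<omega> = (\<Sum>i<steps \<phi>. height \<phi> i \<omega> * indicator {min t (knot \<phi> i)<..min t (knot \<phi> (Suc i))} s)"
      "step_value \<psi> s \<omega> = (\<Sum>i<steps \<psi>. height \<psi> i \<omega> * indicator {min t (knot \<psi> i)<..min t (knot \<psi> (Suc i))} s)"
      by (auto simp: step_value_def indicator_def intro!: sum.cong)
    then have "step_value \<phi> s \<omega> - step_value \<psi> s \<omega> = (\<Sum>i\<in>I. h i \<omega> * indicator {a i<..b i} s)"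
      by (simp add: I_def sum.Plus h_def a_def b_def sum_negf del: sum_mult_indicator)
    then show ?thesis using True by simp
  next
    case False
    have "indicator {a i<..b i} s = (0::real)" if "i \<in> I" for i
      using False that ab[OF that] by (auto simp: indicator_def I_def a_def b_def)
    then show ?thesis using False by simp
  qed
  show ?thesis unfolding 1 2 by (rule ito_isometry[OF B fin ab hF hM C])
qed

section \<open>Ito integrals as limits along uniform grids\<close>

definition grid_value :: "real \<Rightarrow> nat \<Rightarrow> (real \<Rightarrow> real) \<Rightarrow> real \<Rightarrow> real" where
  "grid_value t n g s = (\<Sum>i<n. g (t * real i / real n) * indicator {t * real i / real n<..t * real (Suc i) / real n} s)"

text \<open>A point of the grid interval is evaluated at its left endpoint, whatever the function \<open>g\<close> is.\<close>

lemma grid_value_eq: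
  assumes t: "t > 0" and n: "n > 0" and s: "s \<in> {0<..t}"
  obtains u where "u \<in> {0..t}" "s - t / n \<le> u" "u \<le> s" "\<forall>g. grid_value t n g s = g u"
proof -
  define x where "x = s * n / t"
  have x: "x > 0" "x \<le> n" using assms by (auto simp: x_def field_simps)
  have "\<lceil>x\<rceil> \<ge> 1" using x(1) by (simp add: one_le_ceiling)
  then obtain k where ceil: "\<lceil>x\<rceil> = int k + 1"
    using zero_le_imp_eq_int[of "\<lceil>x\<rceil> - 1"] by (auto simp: algebra_simps)
  have k: "real k < x" "x \<le> real k + 1" using ceil by linarith+
  have kn: "k < n" using k x by linarith
  have ind: "indicator {t * real i / real n<..t * real (Suc i) / real n} s = (if i = k then 1 else 0 :: real)" for i :: nat
  proof -
    have "s \<in> {t * real i / real n<..t * real (Suc i) / real n} \<longleftrightarrow> real i < x \<and> x \<le> real i + 1"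
      using t n by (simp add: x_def field_simps)
    also have "\<dots> \<longleftrightarrow> i = k" using k by linarith
    finally show ?thesis by (simp add: indicator_def)
  qed
  show thesis
  proof (rule that[of "t * real k / n"])
    show "t * real k / n \<in> {0..t}" using t n kn by (auto simp: field_simps)
    have sx: "s = t * x / n" using t n by (simp add: x_def)
    have "t * x / n \<le> t * (real k + 1) / n" "t * real k / n \<le> t * x / n"
      using k t by (intro divide_right_mono mult_left_mono; simp)+
    then show "s - t / n \<le> t * real k / n" "t * real k / n \<le> s"
      unfolding sx by (simp_all add: distrib_left add_divide_distrib)
    show "\<forall>g. grid_value t n g s = g (t * real k / n)"
      unfolding grid_value_def ind using kn by (simp add: if_distrib cong: if_cong)
  qed
qed

lemma grid_value_tendsto:
  assumes t: "t > 0" and s: "s \<in> {0<..t}" and g: "continuous_on {0..t} g"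
  shows "(\<lambda>n. grid_value t n g s) \<longlonglongrightarrow> g s"
proof (rule LIMSEQ_imp_Suc)
  have "\<exists>u. u \<in> {0..t} \<and> s - t / Suc n \<le> u \<and> u \<le> s \<and> grid_value t (Suc n) g s = g u" for n
  proof -
    obtain u where "u \<in> {0..t}" "s - t / Suc n \<le> u" "u \<le> s" "\<forall>g. grid_value t (Suc n) g s = g u"
      by (rule grid_value_eq[OF t zero_less_Suc s])
    then show ?thesis by blast
  qed
  then obtain u where u: "\<And>n. u n \<in> {0..t}" "\<And>n. s - t / Suc n \<le> u n" "\<And>n. u n \<le> s"
    "\<And>n. grid_value t (Suc n) g s = g (u n)" by metis
  have "(\<lambda>n. s - t / Suc n) \<longlonglongrightarrow> s - 0"
    by (intro tendsto_diff tendsto_const) (rule LIMSEQ_Suc[OF lim_const_over_n])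
  then have "u \<longlonglongrightarrow> s"
    by (intro tendsto_sandwich[OF always_eventually always_eventually _ tendsto_const, of _ u]) (use u in auto)
  then have "(\<lambda>n. g (u n)) \<longlonglongrightarrow> g s"
    using u s by (intro continuous_on_tendsto_compose[OF g]) auto
  then show "(\<lambda>n. grid_value t (Suc n) g s) \<longlonglongrightarrow> g s" by (simp add: u(4))
qed

text \<open>The heights sample \<open>H\<close> at the left endpoints of a uniform grid. They are cut off at \<open>K\<close>
  because step processes have bounded heights.\<close>

definition grid_step :: "real \<Rightarrow> nat \<Rightarrow> real \<Rightarrow> (real \<Rightarrow> 'a \<Rightarrow> real) \<Rightarrow> 'a step_process" where
  "grid_step t n K H = \<lparr>steps = n, knot = (\<lambda>i. t * real i / real n),
     height = (\<lambda>i \<omega>. min (H (t * real i / real n) \<omega>) K)\<rparr>"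

lemma grid_step_value:
  "step_value (grid_step t n K H) s \<omega> = grid_value t n (\<lambda>u. min (H u \<omega>) K) s"
  by (simp add: step_value_def grid_step_def grid_value_def)

lemma grid_step_adapted:
  assumes t: "t > 0" and K: "K \<ge> 0" and H: "\<And>s. s \<ge> 0 \<Longrightarrow> H s \<in> borel_measurable (F s)"
    and pos: "\<And>s \<omega>. s \<ge> 0 \<Longrightarrow> \<omega> \<in> space M \<Longrightarrow> H s \<omega> \<ge> 0"
  shows "adapted_step_process M F (grid_step t n K H)"
proof -
  have "(\<lambda>\<omega>. min (H (t * real i / real n) \<omega>) K) \<in> borel_measurable (F (t * real i / real n))" for i
    using H[of "t * real i / real n"] t by (intro borel_measurable_min) auto
  moreover have "\<forall>\<omega>\<in>space M. \<bar>min (H (t * real i / real n) \<omega>) K\<bar> \<le> K" for i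
    using pos[of "t * real i / real n"] t K by (auto simp: min_def)
  moreover have "t * real i / real n \<le> t * real (Suc i) / real n" for i
    using t by (intro divide_right_mono mult_left_mono) auto
  ultimately show ?thesis
    by (auto simp: adapted_step_process_def grid_step_def)
qed

lemma grid_step_integral:
  assumes "t > 0"
  shows "step_integral B t (grid_step t n K H) \<omega> =
    (\<Sum>i<n. min (H (t * real i / real n) \<omega>) K * (B (t * real (Suc i) / real n) \<omega> - B (t * real i / real n) \<omega>))"
proof -
  have *: "min t (t * real i / real n) = t * real i / real n" if "i \<le> n" for i
    using that assms by (cases "n = 0") (auto simp: min_def field_simps)
  show ?thesis
    unfolding step_integral_def grid_step_def step_process.simps
    by (intro sum.cong refl) (simp only: * lessThan_iff Suc_leI less_imp_le)
qed

lemma square_add_le: "((a::real) + b)\<^sup>2 \<le> 2 * a\<^sup>2 + 2 * b\<^sup>2"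
  using sum_squares_bound[of a b] by (simp add: power2_sum)

lemma ennreal_square_diff_le:
  "ennreal (((a::real) - c)\<^sup>2) \<le> 2 * ennreal ((a - b)\<^sup>2) + 2 * ennreal ((b - c)\<^sup>2)"
proof -
  have "ennreal ((a - c)\<^sup>2) \<le> ennreal (2 * (a - b)\<^sup>2 + 2 * (b - c)\<^sup>2)"
    using square_add_le[of "a - b" "b - c"] by (intro ennreal_leI) simp
  then show ?thesis by (simp add: ennreal_mult)
qed

text \<open>The time \<open>0\<close>, a null set, is left out because all grid processes vanish there.\<close>

abbreviation horizon :: "real \<Rightarrow> real measure" where
  "horizon t \<equiv> restrict_space lborel {0<..t}"

lemma finite_measure_horizon: "finite_measure (horizon t)"
  by (rule finite_measureI, cases "0 \<le> t") (auto simp: emeasure_restrict_space space_restrict_space)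

lemma continuous_measurable_horizon:
  fixes g :: "real \<Rightarrow> real"
  assumes "continuous_on {0..t} g"
  shows "g \<in> borel_measurable (horizon t)"
proof -
  have "g \<in> borel_measurable (restrict_space borel {0..t})"
    by (rule borel_measurable_continuous_on_restrict[OF assms])
  moreover have "(\<lambda>s. s) \<in> measurable (horizon t) (restrict_space borel {0..t})"
    by (intro measurable_restrict_space2 measurable_restrict_space1) (auto simp: space_restrict_space)
  ultimately show ?thesis using measurable_compose by fastforce
qed

text \<open>The squared norm in \<open>L\<^sup>2 (\<Omega> \<times> [0, t])\<close>, written as one integral over the product space in
  order to have dominated convergence available in a single step.\<close>

definition (in prob_space) L2_norm_sq :: "real \<Rightarrow> (real \<Rightarrow> 'a \<Rightarrow> real) \<Rightarrow> ennreal" where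
  "L2_norm_sq t G = (\<integral>\<^sup>+z. ennreal ((G (snd z) (fst z))\<^sup>2) \<partial>(M \<Otimes>\<^sub>M horizon t))"

lemma (in prob_space) L2_norm_sq_iterated:
  assumes G: "(\<lambda>z. G (snd z) (fst z)) \<in> borel_measurable (M \<Otimes>\<^sub>M horizon t)"
  shows "(\<integral>\<^sup>+\<omega>. (\<integral>\<^sup>+s\<in>{0..t}. ennreal ((G s \<omega>)\<^sup>2) \<partial>lborel) \<partial>M) = L2_norm_sq t G"
proof -
  interpret L: finite_measure "horizon t" by (rule finite_measure_horizon)
  have "(\<integral>\<^sup>+s\<in>{0..t}. ennreal ((G s \<omega>)\<^sup>2) \<partial>lborel) = (\<integral>\<^sup>+s. ennreal ((G s \<omega>)\<^sup>2) \<partial>horizon t)" for \<omega>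
  proof -
    have "(\<integral>\<^sup>+s\<in>{0..t}. ennreal ((G s \<omega>)\<^sup>2) \<partial>lborel) = (\<integral>\<^sup>+s\<in>{0<..t}. ennreal ((G s \<omega>)\<^sup>2) \<partial>lborel)"
      using AE_lborel_singleton[of "0::real"]
      by (intro nn_integral_cong_AE) (auto simp: indicator_def elim!: eventually_mono)
    then show ?thesis by (subst nn_integral_restrict_space) auto
  qed
  moreover have "L2_norm_sq t G = (\<integral>\<^sup>+\<omega>. (\<integral>\<^sup>+s. ennreal ((G s \<omega>)\<^sup>2) \<partial>horizon t) \<partial>M)"
    unfolding L2_norm_sq_def using G by (subst L.nn_integral_fst[symmetric]) auto
  ultimately show ?thesis by simp
qed

lemma (in prob_space) L2_norm_sq_triangle:
  assumes "(\<lambda>z. G (snd z) (fst z)) \<in> borel_measurable (M \<Otimes>\<^sub>M horizon t)"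
    "(\<lambda>z. G' (snd z) (fst z)) \<in> borel_measurable (M \<Otimes>\<^sub>M horizon t)"
    "(\<lambda>z. G'' (snd z) (fst z)) \<in> borel_measurable (M \<Otimes>\<^sub>M horizon t)"
  shows "L2_norm_sq t (\<lambda>s \<omega>. G s \<omega> - G'' s \<omega>) \<le>
    2 * L2_norm_sq t (\<lambda>s \<omega>. G s \<omega> - G' s \<omega>) + 2 * L2_norm_sq t (\<lambda>s \<omega>. G' s \<omega> - G'' s \<omega>)"
proof -
  note [measurable] = assms
  have "L2_norm_sq t (\<lambda>s \<omega>. G s \<omega> - G'' s \<omega>) \<le>
      (\<integral>\<^sup>+z. 2 * ennreal ((G (snd z) (fst z) - G' (snd z) (fst z))\<^sup>2) +
        2 * ennreal ((G' (snd z) (fst z) - G'' (snd z) (fst z))\<^sup>2) \<partial>(M \<Otimes>\<^sub>M horizon t))"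
    unfolding L2_norm_sq_def by (intro nn_integral_mono ennreal_square_diff_le)
  also have "\<dots> = 2 * L2_norm_sq t (\<lambda>s \<omega>. G s \<omega> - G' s \<omega>) + 2 * L2_norm_sq t (\<lambda>s \<omega>. G' s \<omega> - G'' s \<omega>)"
    unfolding L2_norm_sq_def by (simp add: nn_integral_add nn_integral_cmult)
  finally show ?thesis .
qed

lemma step_value_joint_measurable:
  assumes "\<And>i. i < steps \<phi> \<Longrightarrow> height \<phi> i \<in> borel_measurable M"
  shows "(\<lambda>z. step_value \<phi> (snd z) (fst z)) \<in> borel_measurable (M \<Otimes>\<^sub>M horizon t)"
  unfolding step_value_def
proof (intro borel_measurable_sum borel_measurable_times)
  fix i assume i: "i \<in> {..<steps \<phi>}"
  show "(\<lambda>z. height \<phi> i (fst z)) \<in> borel_measurable (M \<Otimes>\<^sub>M horizon t)"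
    by (rule measurable_compose[OF measurable_fst assms]) (use i in simp)
  have "(\<lambda>s. s) \<in> borel_measurable (horizon t)" by (intro measurable_restrict_space1) simp
  then have "(\<lambda>z. snd z) \<in> borel_measurable (M \<Otimes>\<^sub>M horizon t)"
    by (rule measurable_compose[OF measurable_snd])
  then show "(\<lambda>z. indicator {knot \<phi> i<..knot \<phi> (Suc i)} (snd z) :: real) \<in> borel_measurable (M \<Otimes>\<^sub>M horizon t)"
    by measurable
qed

text \<open>First the truncation level \<open>K\<close> is fixed such that the truncated integrand is close to \<open>H\<close>, by
  dominated convergence with the dominating function \<open>H\<^sup>2\<close>. For this \<open>K\<close> the grid processes converge
  to the truncated integrand, dominated by the constant \<open>K\<^sup>2\<close>. The order matters: without truncation
  the grid processes need not have an integrable bound.\<close>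

lemma (in prob_space) grid_L2_approx:
  assumes t: "t > 0" and H: "\<And>s. s \<ge> 0 \<Longrightarrow> H s \<in> borel_measurable M"
    and joint: "(\<lambda>z. H (snd z) (fst z)) \<in> borel_measurable (M \<Otimes>\<^sub>M horizon t)"
    and pos: "\<And>s \<omega>. s \<ge> 0 \<Longrightarrow> \<omega> \<in> space M \<Longrightarrow> H s \<omega> \<ge> 0"
    and cont: "\<And>\<omega>. \<omega> \<in> space M \<Longrightarrow> continuous_on {0..} (\<lambda>s. H s \<omega>)"
    and fin: "(\<integral>\<^sup>+\<omega>. (\<integral>\<^sup>+s\<in>{0..t}. ennreal ((H s \<omega>)\<^sup>2) \<partial>lborel) \<partial>M) < \<infinity>"
    and e: "e > (0::real)"
  shows "\<exists>n K. n \<ge> m \<and> K \<ge> m \<and>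
    (\<integral>\<^sup>+\<omega>. (\<integral>\<^sup>+s\<in>{0..t}. ennreal ((step_value (grid_step t n (real K) H) s \<omega> - H s \<omega>)\<^sup>2) \<partial>lborel) \<partial>M) < e"
proof -
  define L where "L = horizon t"
  have [measurable]: "(\<lambda>z. H (snd z) (fst z)) \<in> borel_measurable (M \<Otimes>\<^sub>M L)"
    using joint by (simp add: L_def)
  have spL: "space L = {0<..t}" by (simp add: L_def space_restrict_space)
  interpret L: finite_measure L unfolding L_def by (rule finite_measure_horizon)
  have finP: "finite_measure (M \<Otimes>\<^sub>M L)"
    by (intro finite_measure_pair_measure finite_measure_axioms L.finite_measure_axioms)
  define N where "N = L2_norm_sq t"
  have N_def': "N G = (\<integral>\<^sup>+z. ennreal ((G (snd z) (fst z))\<^sup>2) \<partial>(M \<Otimes>\<^sub>M L))" for G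
    by (simp add: N_def L2_norm_sq_def L_def)
  have inP: "fst z \<in> space M" "snd z \<in> {0<..t}" if "z \<in> space (M \<Otimes>\<^sub>M L)" for z
    using that spL by (auto simp: space_pair_measure)
  have "N H < \<infinity>" using fin L2_norm_sq_iterated[of H t] joint by (simp add: N_def)
  have 1: "(\<lambda>K. N (\<lambda>s \<omega>. min (H s \<omega>) (real K) - H s \<omega>)) \<longlonglongrightarrow> (\<integral>\<^sup>+z. 0 \<partial>(M \<Otimes>\<^sub>M L))"
    unfolding N_def'
  proof (rule nn_integral_dominated_convergence[where w = "\<lambda>z. ennreal ((H (snd z) (fst z))\<^sup>2)"])
    show "(\<integral>\<^sup>+z. ennreal ((H (snd z) (fst z))\<^sup>2) \<partial>(M \<Otimes>\<^sub>M L)) < \<infinity>"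
      using \<open>N H < \<infinity>\<close> by (simp add: N_def')
    show "AE z in M \<Otimes>\<^sub>M L. ennreal ((min (H (snd z) (fst z)) (real K) - H (snd z) (fst z))\<^sup>2) \<le> ennreal ((H (snd z) (fst z))\<^sup>2)" for K
    proof (rule AE_I2)
      fix z assume z: "z \<in> space (M \<Otimes>\<^sub>M L)"
      then have "H (snd z) (fst z) \<ge> 0" using inP[OF z] by (intro pos) auto
      then show "ennreal ((min (H (snd z) (fst z)) (real K) - H (snd z) (fst z))\<^sup>2) \<le> ennreal ((H (snd z) (fst z))\<^sup>2)"
        by (intro ennreal_leI) (auto simp flip: abs_le_square_iff)
    qed
    show "AE z in M \<Otimes>\<^sub>M L. (\<lambda>K. ennreal ((min (H (snd z) (fst z)) (real K) - H (snd z) (fst z))\<^sup>2)) \<longlonglongrightarrow> 0"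
    proof (rule AE_I2)
      fix z
      obtain K0 :: nat where "H (snd z) (fst z) \<le> real K0" using real_arch_simple by blast
      then have "\<forall>\<^sub>F K in sequentially. ennreal ((min (H (snd z) (fst z)) (real K) - H (snd z) (fst z))\<^sup>2) = 0"
        unfolding eventually_sequentially by (intro exI[of _ K0]) (auto simp: min_def)
      then show "(\<lambda>K. ennreal ((min (H (snd z) (fst z)) (real K) - H (snd z) (fst z))\<^sup>2)) \<longlonglongrightarrow> 0"
        by (rule tendsto_eventually)
    qed
  qed simp_all
  then have "\<forall>\<^sub>F K in sequentially. N (\<lambda>s \<omega>. min (H s \<omega>) (real K) - H s \<omega>) < ennreal (e / 8)"
    using e by (intro order_tendstoD(2)[OF 1]) auto
  then have "\<forall>\<^sub>F K in sequentially. N (\<lambda>s \<omega>. min (H s \<omega>) (real K) - H s \<omega>) < ennreal (e / 8) \<and> K \<ge> m"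
    using eventually_ge_at_top[of m] by eventually_elim auto
  then obtain K where K: "N (\<lambda>s \<omega>. min (H s \<omega>) (real K) - H s \<omega>) < ennreal (e / 8)" "K \<ge> m"
    using eventually_happens'[OF sequentially_bot] by blast
  define S where "S n s \<omega> = grid_value t n (\<lambda>u. min (H u \<omega>) (real K)) s" for n s \<omega>
  have Sm[measurable]: "(\<lambda>z. S n (snd z) (fst z)) \<in> borel_measurable (M \<Otimes>\<^sub>M L)" for n
  proof -
    have "(\<lambda>\<omega>. min (H (t * real i / real n) \<omega>) (real K)) \<in> borel_measurable M" for i
      using H[of "t * real i / real n"] t by (intro borel_measurable_min) auto
    then show ?thesis
      using step_value_joint_measurable[of "grid_step t n (real K) H" M t]
      unfolding grid_step_value S_def L_def by (simp add: grid_step_def)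
  qed
  have 2: "(\<lambda>n. N (\<lambda>s \<omega>. S n s \<omega> - min (H s \<omega>) (real K))) \<longlonglongrightarrow> (\<integral>\<^sup>+z. 0 \<partial>(M \<Otimes>\<^sub>M L))"
    unfolding N_def'
  proof (rule nn_integral_dominated_convergence[where w = "\<lambda>z. ennreal ((real K)\<^sup>2)"])
    show "(\<integral>\<^sup>+z. ennreal ((real K)\<^sup>2) \<partial>(M \<Otimes>\<^sub>M L)) < \<infinity>"
      using finite_measure.emeasure_finite[OF finP] by (simp add: ennreal_mult_less_top less_top)
    show "AE z in M \<Otimes>\<^sub>M L. ennreal ((S n (snd z) (fst z) - min (H (snd z) (fst z)) (real K))\<^sup>2) \<le> ennreal ((real K)\<^sup>2)" for n
    proof (rule AE_I2)
      fix z assume z: "z \<in> space (M \<Otimes>\<^sub>M L)"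
      have H0: "H s (fst z) \<ge> 0" if "s \<ge> 0" for s using inP[OF z] that by (intro pos) auto
      have "0 \<le> S n (snd z) (fst z) \<and> S n (snd z) (fst z) \<le> real K"
      proof (cases "n = 0")
        case True
        then show ?thesis by (simp add: S_def grid_value_def)
      next
        case False
        then have "n > 0" by simp
        obtain u where "u \<in> {0..t}" "snd z - t / n \<le> u" "u \<le> snd z"
          "\<forall>g. grid_value t n g (snd z) = g u"
          by (rule grid_value_eq[OF t \<open>n > 0\<close> inP(2)[OF z]])
        then show ?thesis using H0[of u] by (simp add: S_def)
      qed
      moreover have "0 \<le> min (H (snd z) (fst z)) (real K)" "min (H (snd z) (fst z)) (real K) \<le> real K"
        using H0[of "snd z"] inP(2)[OF z] by auto
      ultimately have "\<bar>S n (snd z) (fst z) - min (H (snd z) (fst z)) (real K)\<bar> \<le> \<bar>real K\<bar>" by linarith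
      then show "ennreal ((S n (snd z) (fst z) - min (H (snd z) (fst z)) (real K))\<^sup>2) \<le> ennreal ((real K)\<^sup>2)"
        by (intro ennreal_leI) (simp only: abs_le_square_iff)
    qed
    show "AE z in M \<Otimes>\<^sub>M L. (\<lambda>n. ennreal ((S n (snd z) (fst z) - min (H (snd z) (fst z)) (real K))\<^sup>2)) \<longlonglongrightarrow> 0"
    proof (rule AE_I2)
      fix z assume z: "z \<in> space (M \<Otimes>\<^sub>M L)"
      have "continuous_on {0..t} (\<lambda>u. min (H u (fst z)) (real K))"
        by (intro continuous_intros continuous_on_subset[OF cont[OF inP(1)[OF z]]]) auto
      from grid_value_tendsto[OF t inP(2)[OF z] this]
      have "(\<lambda>n. S n (snd z) (fst z)) \<longlonglongrightarrow> min (H (snd z) (fst z)) (real K)"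
        by (simp add: S_def)
      then have "(\<lambda>n. (S n (snd z) (fst z) - min (H (snd z) (fst z)) (real K))\<^sup>2) \<longlonglongrightarrow> 
          (min (H (snd z) (fst z)) (real K) - min (H (snd z) (fst z)) (real K))\<^sup>2"
        by (intro tendsto_intros)
      then have "(\<lambda>n. ennreal ((S n (snd z) (fst z) - min (H (snd z) (fst z)) (real K))\<^sup>2)) \<longlonglongrightarrow> ennreal 0"
        by (intro tendsto_ennrealI) simp
      then show "(\<lambda>n. ennreal ((S n (snd z) (fst z) - min (H (snd z) (fst z)) (real K))\<^sup>2)) \<longlonglongrightarrow> 0"
        by simp
    qed
  qed measurable
  then have "\<forall>\<^sub>F n in sequentially. N (\<lambda>s \<omega>. S n s \<omega> - min (H s \<omega>) (real K)) < ennreal (e / 8)"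
    using e by (intro order_tendstoD(2)[OF 2]) auto
  then have "\<forall>\<^sub>F n in sequentially. N (\<lambda>s \<omega>. S n s \<omega> - min (H s \<omega>) (real K)) < ennreal (e / 8) \<and> n \<ge> m"
    using eventually_ge_at_top[of m] by eventually_elim auto
  then obtain n where n: "N (\<lambda>s \<omega>. S n s \<omega> - min (H s \<omega>) (real K)) < ennreal (e / 8)" "n \<ge> m"
    using eventually_happens'[OF sequentially_bot] by blast
  have "(\<integral>\<^sup>+\<omega>. (\<integral>\<^sup>+s\<in>{0..t}. ennreal ((step_value (grid_step t n (real K) H) s \<omega> - H s \<omega>)\<^sup>2) \<partial>lborel) \<partial>M) =
      N (\<lambda>s \<omega>. S n s \<omega> - H s \<omega>)"
    unfolding grid_step_value S_def[symmetric] N_def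
    by (rule L2_norm_sq_iterated) (simp flip: L_def)
  also have "\<dots> \<le> 2 * N (\<lambda>s \<omega>. S n s \<omega> - min (H s \<omega>) (real K)) + 2 * N (\<lambda>s \<omega>. min (H s \<omega>) (real K) - H s \<omega>)"
    unfolding N_def by (rule L2_norm_sq_triangle) (simp_all flip: L_def)
  also have "\<dots> \<le> 2 * ennreal (e / 8) + 2 * ennreal (e / 8)"
    using n(1) K(1) by (intro add_mono mult_left_mono) auto
  also have "\<dots> = ennreal (e / 2)"
    using e by (simp add: ennreal_mult[symmetric] ennreal_plus[symmetric] del: ennreal_plus flip: ennreal_numeral)
  also have "\<dots> < ennreal e" using e by (simp add: ennreal_lessI)
  finally show ?thesis using n(2) K(2) by blast
qed

text \<open>The approximating step processes \<open>\<phi>\<close> from the definition of the integral are compared with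
  grid processes \<open>\<psi>\<close>: both approximate \<open>H\<close>, so by the isometry their integrals are close in \<open>L\<^sup>2\<close>.
  Letting \<open>\<phi>\<close> tend to its limit shows that the integrals of \<open>\<psi>\<close> converge to \<open>J\<close> in \<open>L\<^sup>2\<close>, and a
  subsequence converges almost surely.\<close>

lemma (in prob_space) ito_integral_grid_limit:
  assumes B: "brownian_wrt M F B" and J: "is_ito_integral M F B H t J" and t: "t > 0"
    and H: "\<And>s. s \<ge> 0 \<Longrightarrow> H s \<in> borel_measurable (F s)"
    and pos: "\<And>s \<omega>. s \<ge> 0 \<Longrightarrow> \<omega> \<in> space M \<Longrightarrow> H s \<omega> \<ge> 0"
    and cont: "\<And>\<omega>. \<omega> \<in> space M \<Longrightarrow> continuous_on {0..} (\<lambda>s. H s \<omega>)"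
  obtains n K :: "nat \<Rightarrow> nat" where "\<And>k. n k > k" "\<And>k. K k > k"
    "AE \<omega> in M. (\<lambda>k. step_integral B t (grid_step t (n k) (real (K k)) H) \<omega>) \<longlonglongrightarrow> J \<omega>"
proof -
  have HM: "H s \<in> borel_measurable M" if "s \<ge> 0" for s
    using brownian_wrt_measurable_ambient[OF B H[OF that] that] .
  have prog: "(\<lambda>(s, \<omega>). H s \<omega>) \<in> borel_measurable (restrict_space borel {0..t} \<Otimes>\<^sub>M F t)"
    and fin: "(\<integral>\<^sup>+\<omega>. (\<integral>\<^sup>+s\<in>{0..t}. ennreal ((H s \<omega>)\<^sup>2) \<partial>lborel) \<partial>M) < \<infinity>"
    and Jm[measurable]: "J \<in> borel_measurable M"
    using J t by (auto simp: is_ito_integral_def ito_integrand_def)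
  have joint: "(\<lambda>z. H (snd z) (fst z)) \<in> borel_measurable (M \<Otimes>\<^sub>M horizon t)"
  proof -
    have "(\<lambda>z. (snd z, fst z)) \<in> measurable (M \<Otimes>\<^sub>M horizon t) (restrict_space borel {0..t} \<Otimes>\<^sub>M F t)"
    proof (rule measurable_Pair)
      have "(\<lambda>s. s) \<in> measurable (horizon t) (restrict_space borel {0..t})"
        by (intro measurable_restrict_space2 measurable_restrict_space1) (auto simp: space_restrict_space)
      then show "(\<lambda>z. snd z) \<in> measurable (M \<Otimes>\<^sub>M horizon t) (restrict_space borel {0..t})"
        by (rule measurable_compose[OF measurable_snd])
      have "(\<lambda>\<omega>. \<omega>) \<in> measurable M (F t)"
        using B t by (intro measurable_ident_coarser) (auto simp: brownian_wrt_def)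
      then show "(\<lambda>z. fst z) \<in> measurable (M \<Otimes>\<^sub>M horizon t) (F t)"
        by (rule measurable_compose[OF measurable_fst])
    qed
    from measurable_compose[OF this prog] show ?thesis by simp
  qed
  obtain \<phi> where \<phi>: "\<And>n. adapted_step_process M F (\<phi> n)"
    "(\<lambda>n. \<integral>\<^sup>+\<omega>. (\<integral>\<^sup>+s\<in>{0..t}. ennreal ((step_value (\<phi> n) s \<omega> - H s \<omega>)\<^sup>2) \<partial>lborel) \<partial>M) \<longlonglongrightarrow> 0"
    "(\<lambda>n. \<integral>\<^sup>+\<omega>. ennreal ((step_integral B t (\<phi> n) \<omega> - J \<omega>)\<^sup>2) \<partial>M) \<longlonglongrightarrow> 0"
    using J unfolding is_ito_integral_def by blast
  define E where "E n K = (\<integral>\<^sup>+\<omega>. (\<integral>\<^sup>+s\<in>{0..t}.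
      ennreal ((step_value (grid_step t n (real K) H) s \<omega> - H s \<omega>)\<^sup>2) \<partial>lborel) \<partial>M)" for n K
  have "\<exists>n K. n \<ge> Suc k \<and> K \<ge> Suc k \<and> E n K < 1 / Suc k" for k
    unfolding E_def using grid_L2_approx[OF t HM joint pos cont fin, of "1 / Suc k" "Suc k"] by simp
  then obtain n K where nK: "\<And>k. n k \<ge> Suc k" "\<And>k. K k \<ge> Suc k" "\<And>k. E (n k) (K k) < 1 / Suc k"
    by metis
  define \<psi> where "\<psi> k = grid_step t (n k) (real (K k)) H" for k
  have \<psi>: "adapted_step_process M F (\<psi> k)" for k
    unfolding \<psi>_def by (rule grid_step_adapted[OF t _ H pos]) auto
  have BM: "B s \<in> borel_measurable M" if "s \<ge> 0" for s
    using B that by (intro sbm_measurable) (auto simp: brownian_wrt_def)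
  have heightM: "height \<xi> i \<in> borel_measurable M" if "adapted_step_process M F \<xi>" "i < steps \<xi>" for \<xi> i
    using brownian_wrt_measurable_ambient[OF B adapted_step_processD(3)[OF that]]
      adapted_step_processD(1)[OF that(1), of i] that(2) by simp
  have Im[measurable]: "step_integral B t \<xi> \<in> borel_measurable M" if "adapted_step_process M F \<xi>" for \<xi>
    unfolding step_integral_def
    using adapted_step_processD(1)[OF that] heightM[OF that] t
    by (intro borel_measurable_sum borel_measurable_times borel_measurable_diff BM) (auto simp: Suc_le_eq)
  let ?I = "step_integral B t"
  have bound: "(\<integral>\<^sup>+\<omega>. ennreal ((?I (\<psi> k) \<omega> - J \<omega>)\<^sup>2) \<partial>M) \<le> 4 * ennreal (1 / Suc k)" for k
  proof (rule tendsto_lowerbound)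
    let ?a = "\<lambda>j. \<integral>\<^sup>+\<omega>. (\<integral>\<^sup>+s\<in>{0..t}. ennreal ((step_value (\<phi> j) s \<omega> - H s \<omega>)\<^sup>2) \<partial>lborel) \<partial>M"
    let ?b = "\<lambda>j. \<integral>\<^sup>+\<omega>. ennreal ((?I (\<phi> j) \<omega> - J \<omega>)\<^sup>2) \<partial>M"
    have "(\<lambda>j. 2 * (2 * ennreal (1 / Suc k) + 2 * ?a j) + 2 * ?b j) \<longlonglongrightarrow>
        2 * (2 * ennreal (1 / Suc k) + 2 * 0) + 2 * 0"
      by (intro tendsto_add tendsto_const ennreal_tendsto_cmult \<phi>) auto
    then show "(\<lambda>j. 2 * (2 * ennreal (1 / Suc k) + 2 * ?a j) + 2 * ?b j) \<longlonglongrightarrow> 4 * ennreal (1 / Suc k)"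
      by (simp add: mult.assoc[symmetric])
    show "\<forall>\<^sub>F j in sequentially. (\<integral>\<^sup>+\<omega>. ennreal ((?I (\<psi> k) \<omega> - J \<omega>)\<^sup>2) \<partial>M) \<le>
        2 * (2 * ennreal (1 / Suc k) + 2 * ?a j) + 2 * ?b j"
    proof (rule always_eventually, rule allI)
      fix j
      note [measurable] = Im[OF \<psi>] Im[OF \<phi>(1)]
      have "(\<integral>\<^sup>+\<omega>. ennreal ((?I (\<psi> k) \<omega> - ?I (\<phi> j) \<omega>)\<^sup>2) \<partial>M) =
          (\<integral>\<^sup>+\<omega>. (\<integral>\<^sup>+s\<in>{0..t}. ennreal ((step_value (\<psi> k) s \<omega> - step_value (\<phi> j) s \<omega>)\<^sup>2) \<partial>lborel) \<partial>M)"
        using t by (intro step_integral_isometry[OF B \<psi> \<phi>(1)]) auto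
      also have "\<dots> = L2_norm_sq t (\<lambda>s \<omega>. step_value (\<psi> k) s \<omega> - step_value (\<phi> j) s \<omega>)"
        by (intro L2_norm_sq_iterated borel_measurable_diff step_value_joint_measurable heightM[OF \<psi>] heightM[OF \<phi>(1)])
      also have "\<dots> \<le> 2 * L2_norm_sq t (\<lambda>s \<omega>. step_value (\<psi> k) s \<omega> - H s \<omega>) +
          2 * L2_norm_sq t (\<lambda>s \<omega>. H s \<omega> - step_value (\<phi> j) s \<omega>)"
        by (intro L2_norm_sq_triangle joint step_value_joint_measurable heightM[OF \<psi>] heightM[OF \<phi>(1)])
      also have "L2_norm_sq t (\<lambda>s \<omega>. H s \<omega> - step_value (\<phi> j) s \<omega>) =
          L2_norm_sq t (\<lambda>s \<omega>. step_value (\<phi> j) s \<omega> - H s \<omega>)"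
        unfolding L2_norm_sq_def by (simp only: power2_commute)
      also have "L2_norm_sq t (\<lambda>s \<omega>. step_value (\<phi> j) s \<omega> - H s \<omega>) = ?a j"
        by (intro L2_norm_sq_iterated[symmetric] borel_measurable_diff joint step_value_joint_measurable heightM[OF \<phi>(1)])
      also have "L2_norm_sq t (\<lambda>s \<omega>. step_value (\<psi> k) s \<omega> - H s \<omega>) =
          E (n k) (K k)"
        unfolding E_def \<psi>_def[symmetric]
        by (intro L2_norm_sq_iterated[symmetric] borel_measurable_diff joint step_value_joint_measurable heightM[OF \<psi>])
      finally have "(\<integral>\<^sup>+\<omega>. ennreal ((?I (\<psi> k) \<omega> - ?I (\<phi> j) \<omega>)\<^sup>2) \<partial>M) \<le> 2 * E (n k) (K k) + 2 * ?a j" .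
      also have "\<dots> \<le> 2 * ennreal (1 / Suc k) + 2 * ?a j"
        using less_imp_le[OF nK(3)[of k]] by (intro add_mono mult_left_mono) auto
      finally have dist: "(\<integral>\<^sup>+\<omega>. ennreal ((?I (\<psi> k) \<omega> - ?I (\<phi> j) \<omega>)\<^sup>2) \<partial>M) \<le>
        2 * ennreal (1 / Suc k) + 2 * ?a j" .
      have "(\<integral>\<^sup>+\<omega>. ennreal ((?I (\<psi> k) \<omega> - J \<omega>)\<^sup>2) \<partial>M) \<le>
          (\<integral>\<^sup>+\<omega>. 2 * ennreal ((?I (\<psi> k) \<omega> - ?I (\<phi> j) \<omega>)\<^sup>2) + 2 * ennreal ((?I (\<phi> j) \<omega> - J \<omega>)\<^sup>2) \<partial>M)"
        by (intro nn_integral_mono ennreal_square_diff_le)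
      also have "\<dots> = 2 * (\<integral>\<^sup>+\<omega>. ennreal ((?I (\<psi> k) \<omega> - ?I (\<phi> j) \<omega>)\<^sup>2) \<partial>M) + 2 * ?b j"
        by (simp add: nn_integral_add nn_integral_cmult)
      also have "\<dots> \<le> 2 * (2 * ennreal (1 / Suc k) + 2 * ?a j) + 2 * ?b j"
        using dist by (intro add_mono mult_left_mono order_refl) auto
      finally show "(\<integral>\<^sup>+\<omega>. ennreal ((?I (\<psi> k) \<omega> - J \<omega>)\<^sup>2) \<partial>M) \<le>
        2 * (2 * ennreal (1 / Suc k) + 2 * ?a j) + 2 * ?b j" .
    qed
  qed simp
  define u where "u k \<omega> = (?I (\<psi> k) \<omega> - J \<omega>)\<^sup>2" for k \<omega>
  have um[measurable]: "u k \<in> borel_measurable M" for k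
    unfolding u_def using Im[OF \<psi>, of k] by measurable
  have int: "integrable M (u k)" for k
    using bound[of k] by (intro integrableI_nonneg um) (auto simp: u_def ennreal_mult_less_top le_less_trans)
  have "(\<lambda>k. expectation (\<lambda>\<omega>. norm (u k \<omega>))) \<longlonglongrightarrow> 0"
  proof (rule tendsto_sandwich[OF _ _ tendsto_const])
    show "\<forall>\<^sub>F k in sequentially. 0 \<le> expectation (\<lambda>\<omega>. norm (u k \<omega>))" by simp
    show "\<forall>\<^sub>F k in sequentially. expectation (\<lambda>\<omega>. norm (u k \<omega>)) \<le> 4 * (1 / Suc k)"
    proof (rule always_eventually, rule allI)
      fix k
      have "ennreal (expectation (\<lambda>\<omega>. norm (u k \<omega>))) = (\<integral>\<^sup>+\<omega>. ennreal (u k \<omega>) \<partial>M)"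
        using int[of k] by (subst nn_integral_eq_integral) (auto simp: u_def[abs_def])
      also have "\<dots> \<le> ennreal (4 * (1 / Suc k))"
      proof -
        have "ennreal (4 * (1 / Suc k)) = 4 * ennreal (1 / Suc k)"
          by (subst ennreal_mult) auto
        then show ?thesis using bound[of k] by (simp only: u_def)
      qed
      finally show "expectation (\<lambda>\<omega>. norm (u k \<omega>)) \<le> 4 * (1 / Suc k)" by simp
    qed
    have "(\<lambda>k. 4 * (1 / real (Suc k))) \<longlonglongrightarrow> 4 * 0"
      by (intro tendsto_mult tendsto_const LIMSEQ_Suc[OF lim_1_over_n])
    then show "(\<lambda>k. 4 * (1 / real (Suc k))) \<longlonglongrightarrow> 0" by simp
  qed
  from tendsto_L1_AE_subseq[OF int this]
  obtain r where r: "strict_mono r" "AE \<omega> in M. (\<lambda>k. u (r k) \<omega>) \<longlonglongrightarrow> 0" by auto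
  show thesis
  proof (rule that[of "n \<circ> r" "K \<circ> r"])
    show "(n \<circ> r) k > k" "(K \<circ> r) k > k" for k
      using nK(1,2)[of "r k"] seq_suble[OF r(1), of k] by auto
    show "AE \<omega> in M. (\<lambda>k. ?I (grid_step t ((n \<circ> r) k) (real ((K \<circ> r) k)) H) \<omega>) \<longlonglongrightarrow> J \<omega>"
      using r(2)
    proof (rule AE_mp, intro AE_I2 impI)
      fix \<omega> assume "(\<lambda>k. u (r k) \<omega>) \<longlonglongrightarrow> 0"
      then have "(\<lambda>k. ?I (\<psi> (r k)) \<omega> - J \<omega>) \<longlonglongrightarrow> 0"
        unfolding u_def using tendsto_real_sqrt[of _ 0] by (fastforce intro: tendsto_rabs_zero_cancel)
      then show "(\<lambda>k. ?I (grid_step t ((n \<circ> r) k) (real ((K \<circ> r) k)) H) \<omega>) \<longlonglongrightarrow> J \<omega>"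
        unfolding \<psi>_def by (simp add: LIM_zero_iff)
    qed
  qed
qed

section \<open>Gaussian bounds conditional on the integrand\<close>

text \<open>The normal density is bounded by \<open>1 / \<sigma>\<close>.\<close>

lemma (in prob_space) normal_small_ball:
  assumes D: "distributed M lborel X (normal_density 0 \<sigma>)" and \<sigma>: "\<sigma> > 0" and r: "r \<ge> 0"
  shows "emeasure M {\<omega> \<in> space M. \<bar>X \<omega>\<bar> < r} \<le> ennreal (2 * r / \<sigma>)"
proof -
  have "normal_density 0 \<sigma> x \<le> 1 / \<sigma>" for x
  proof -
    have "\<sigma> = sqrt (1 * \<sigma>\<^sup>2)" using \<sigma> by simp
    also have "\<dots> \<le> sqrt (2 * pi * \<sigma>\<^sup>2)"
      using pi_gt3 by (intro real_sqrt_le_mono mult_right_mono) auto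
    finally have "1 / sqrt (2 * pi * \<sigma>\<^sup>2) \<le> 1 / \<sigma>" using \<sigma> by (intro divide_left_mono) auto
    moreover have "exp (- (x - 0)\<^sup>2 / (2 * \<sigma>\<^sup>2)) \<le> 1" by simp
    ultimately have "1 / sqrt (2 * pi * \<sigma>\<^sup>2) * exp (- (x - 0)\<^sup>2 / (2 * \<sigma>\<^sup>2)) \<le> 1 / \<sigma> * 1"
      using \<sigma> by (intro mult_mono) auto
    then show ?thesis by (simp add: normal_density_def)
  qed
  note le = this
  have "{\<omega> \<in> space M. \<bar>X \<omega>\<bar> < r} = X -` {-r<..<r} \<inter> space M" by auto
  then have "emeasure M {\<omega> \<in> space M. \<bar>X \<omega>\<bar> < r} =
      (\<integral>\<^sup>+x. ennreal (normal_density 0 \<sigma> x) * indicator {-r<..<r} x \<partial>lborel)"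
    using distributed_emeasure[OF D, of "{-r<..<r}"] by simp
  also have "\<dots> \<le> (\<integral>\<^sup>+x. ennreal (1 / \<sigma>) * indicator {-r<..<r} x \<partial>lborel)"
    by (intro nn_integral_mono mult_right_mono ennreal_leI le) auto
  also have "\<dots> = ennreal (1 / \<sigma>) * ennreal (2 * r)"
    using r by (subst nn_integral_cmult_indicator) auto
  also have "\<dots> = ennreal (2 * r / \<sigma>)" using \<sigma> r by (simp flip: ennreal_mult)
  finally show ?thesis .
qed

lemma (in prob_space) normal_tail:
  assumes D: "distributed M lborel X (normal_density 0 \<sigma>)" and \<sigma>: "\<sigma> > 0" and r: "r > 0"
  shows "emeasure M {\<omega> \<in> space M. \<bar>X \<omega>\<bar> > r} \<le> ennreal (\<sigma>\<^sup>2 / r\<^sup>2)"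
proof -
  have X[measurable]: "X \<in> borel_measurable M" using distributed_measurable[OF D] by simp
  have E: "expectation X = 0" by (rule normal_distributed_expectation[OF \<sigma> D])
  have V: "variance X = \<sigma>\<^sup>2" by (rule normal_distributed_variance[OF \<sigma> D])
  have int: "integrable M (\<lambda>\<omega>. (X \<omega>)\<^sup>2)"
    using distributed_integrable[OF D, of "\<lambda>x. x\<^sup>2"] integrable_normal_moment[OF \<sigma>, of 0 2] by simp
  have "prob {\<omega> \<in> space M. r \<le> \<bar>X \<omega> - expectation X\<bar>} \<le> variance X / r\<^sup>2"
    by (rule Chebyshev_inequality[OF X int r])
  moreover have "prob {\<omega> \<in> space M. \<bar>X \<omega>\<bar> > r} \<le> prob {\<omega> \<in> space M. r \<le> \<bar>X \<omega> - expectation X\<bar>}"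
    by (intro finite_measure_mono) (auto simp: E)
  ultimately have "prob {\<omega> \<in> space M. \<bar>X \<omega>\<bar> > r} \<le> \<sigma>\<^sup>2 / r\<^sup>2"
    unfolding V by linarith
  then show ?thesis by (simp add: emeasure_eq_measure ennreal_leI)
qed

text \<open>Fubini's theorem: the first element may be frozen.\<close>

lemma (in prob_space) indep_rv_emeasure:
  assumes ind: "indep_rv M S X T Y" and E: "E \<in> sets (S \<Otimes>\<^sub>M T)"
  shows "emeasure M {\<omega> \<in> space M. (X \<omega>, Y \<omega>) \<in> E} =
    (\<integral>\<^sup>+\<omega>. emeasure M {\<omega>' \<in> space M. (X \<omega>, Y \<omega>') \<in> E} \<partial>M)"
proof -
  note [measurable] = indep_rvD(1,2)[OF ind]
  interpret Y: prob_space "distr M T Y" by (rule prob_space_distr) measurable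
  have "sets (S \<Otimes>\<^sub>M distr M T Y) = sets (S \<Otimes>\<^sub>M T)" "sets (distr M S X \<Otimes>\<^sub>M distr M T Y) = sets (S \<Otimes>\<^sub>M T)"
    by (intro sets_pair_measure_cong; simp)+
  with E have E': "E \<in> sets (S \<Otimes>\<^sub>M distr M T Y)" "E \<in> sets (distr M S X \<Otimes>\<^sub>M distr M T Y)" by simp_all
  have "emeasure M {\<omega> \<in> space M. (X \<omega>, Y \<omega>) \<in> E} = emeasure (distr M (S \<Otimes>\<^sub>M T) (\<lambda>\<omega>. (X \<omega>, Y \<omega>))) E"
    using E by (subst emeasure_distr) (auto intro!: arg_cong[where f = "emeasure M"])
  also have "\<dots> = (\<integral>\<^sup>+x. emeasure (distr M T Y) (Pair x -` E) \<partial>distr M S X)"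
    unfolding indep_rv_distr[OF ind] by (rule Y.emeasure_pair_measure_alt[OF E'(2)])
  also have "\<dots> = (\<integral>\<^sup>+\<omega>. emeasure (distr M T Y) (Pair (X \<omega>) -` E) \<partial>M)"
    using Y.measurable_emeasure_Pair[OF E'(1)] by (intro nn_integral_distr indep_rvD(1)[OF ind]) simp
  also have "\<dots> = (\<integral>\<^sup>+\<omega>. emeasure M {\<omega>' \<in> space M. (X \<omega>, Y \<omega>') \<in> E} \<partial>M)"
  proof (rule nn_integral_cong)
    fix \<omega>
    have "Pair (X \<omega>) -` E \<in> sets T" by (rule sets_Pair1[OF E])
    then show "emeasure (distr M T Y) (Pair (X \<omega>) -` E) = emeasure M {\<omega>' \<in> space M. (X \<omega>, Y \<omega>') \<in> E}"
      by (subst emeasure_distr) (auto intro!: arg_cong[where f = "emeasure M"])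
  qed
  finally show ?thesis .
qed

lemma (in prob_space) grid_sum_normal:
  assumes B: "standard_brownian_motion M B" and t: "t > 0" and n: "n > 0" and c: "\<And>i. i < n \<Longrightarrow> c i > 0"
  shows "distributed M lborel
    (\<lambda>\<omega>. \<Sum>i<n. c i * (B (t * real (Suc i) / real n) \<omega> - B (t * real i / real n) \<omega>))
    (normal_density 0 (sqrt (\<Sum>i<n. (c i)\<^sup>2 * (t / n))))"
proof -
  have le: "t * real i / real n \<le> t * real (Suc i) / real n" for i
    using t by (intro divide_right_mono mult_left_mono) auto
  have "indep_vars (\<lambda>_. borel) (\<lambda>i \<omega>. B (t * real (Suc i) / real n) \<omega> - B (t * real i / real n) \<omega>) {..<n}"
    by (rule sbm_indep[OF B, of "\<lambda>i. t * real i / real n"]) (use le in auto)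
  then have ind: "indep_vars (\<lambda>_. borel) (\<lambda>i \<omega>. c i * (B (t * real (Suc i) / real n) \<omega> - B (t * real i / real n) \<omega>)) {..<n}"
    by (rule indep_vars_compose2) auto
  have diff: "t * real (Suc i) / real n - t * real i / real n = t / n" for i
    by (simp add: distrib_left add_divide_distrib)
  have "distributed M lborel (\<lambda>\<omega>. \<Sum>i<n. c i * (B (t * real (Suc i) / real n) \<omega> - B (t * real i / real n) \<omega>))
    (normal_density (\<Sum>i<n. 0) (sqrt (\<Sum>i<n. (c i * sqrt (t / n))\<^sup>2)))"
  proof (rule sum_indep_normal[OF _ _ ind])
    show "{..<n} \<noteq> {}" using n by auto
    fix i assume "i \<in> {..<n}"
    then have ci: "c i > 0" using c by simp
    then show "0 < c i * sqrt (t / n)" using t n by simp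
    have "distributed M lborel (\<lambda>\<omega>. 0 + c i * (B (t * real (Suc i) / real n) \<omega> - B (t * real i / real n) \<omega>))
       (normal_density (0 + c i * 0) (\<bar>c i\<bar> * sqrt (t * real (Suc i) / real n - t * real i / real n)))"
      by (intro normal_density_affine sbm_normal[OF B]) (use ci t n in \<open>auto simp: diff divide_strict_right_mono\<close>)
    then show "distributed M lborel (\<lambda>\<omega>. c i * (B (t * real (Suc i) / real n) \<omega> - B (t * real i / real n) \<omega>))
       (normal_density 0 (c i * sqrt (t / n)))"
      unfolding diff using ci by simp
  qed simp
  moreover have "(c i * sqrt (t / n))\<^sup>2 = (c i)\<^sup>2 * (t / n)" for i
    using t by (simp add: power_mult_distrib)
  ultimately show ?thesis by simp
qed

text \<open>Freezing an elementary event \<open>\<omega>\<close> in the heights, and only there, leaves a linear combination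
  of independent normal increments with constant coefficients. Its variance is \<open>v \<omega>\<close>.\<close>

lemma (in prob_space) grid_sum_bounds:
  fixes h :: "nat \<Rightarrow> 'a \<Rightarrow> real"
  assumes B: "standard_brownian_motion M B" and ind: "indep_rv M N (\<lambda>\<omega>. \<omega>) path_space (sample_path B)"
    and sp: "space N = space M"
    and t: "t > 0" and n: "n > 0"
    and h: "\<And>i. i < n \<Longrightarrow> h i \<in> borel_measurable N"
    and pos: "\<And>i \<omega>. i < n \<Longrightarrow> \<omega> \<in> space M \<Longrightarrow> h i \<omega> > 0"
    and r: "r \<in> borel_measurable N" "\<And>\<omega>. \<omega> \<in> space M \<Longrightarrow> r \<omega> > 0"
  defines "S \<equiv> \<lambda>\<omega>. \<Sum>i<n. h i \<omega> * (B (t * real (Suc i) / real n) \<omega> - B (t * real i / real n) \<omega>)"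
    and "v \<equiv> \<lambda>\<omega>. \<Sum>i<n. (h i \<omega>)\<^sup>2 * (t / n)"
  shows "emeasure M {\<omega> \<in> space M. \<bar>S \<omega>\<bar> < r \<omega>} \<le> (\<integral>\<^sup>+\<omega>. ennreal (min 1 (2 * r \<omega> / sqrt (v \<omega>))) \<partial>M)"
    "emeasure M {\<omega> \<in> space M. \<bar>S \<omega>\<bar> > r \<omega>} \<le> (\<integral>\<^sup>+\<omega>. ennreal (min 1 (v \<omega> / (r \<omega>)\<^sup>2)) \<partial>M)"
proof -
  let ?D = "\<lambda>w i. w (t * real (Suc i) / real n) - w (t * real i / real n) :: real"
  define T where "T z = (\<Sum>i<n. h i (fst z) * ?D (snd z) i)" for z :: "'a \<times> (real \<Rightarrow> real)"
  have Tm[measurable]: "T \<in> borel_measurable (N \<Otimes>\<^sub>M path_space)"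
    unfolding T_def
  proof (intro borel_measurable_sum borel_measurable_times borel_measurable_diff)
    fix i assume "i \<in> {..<n}"
    then show "(\<lambda>z. h i (fst z)) \<in> borel_measurable (N \<Otimes>\<^sub>M path_space)"
      by (intro measurable_compose[OF measurable_fst h]) simp
    show "(\<lambda>z. snd z (t * real (Suc i) / real n)) \<in> borel_measurable (N \<Otimes>\<^sub>M path_space)"
      "(\<lambda>z. snd z (t * real i / real n)) \<in> borel_measurable (N \<Otimes>\<^sub>M path_space)"
      by (rule measurable_compose[OF measurable_snd path_coordinate_measurable]; use t in simp)+
  qed
  have rm[measurable]: "(\<lambda>z. r (fst z)) \<in> borel_measurable (N \<Otimes>\<^sub>M path_space)"
    by (rule measurable_compose[OF measurable_fst r(1)])
  have inE: "(\<omega>, sample_path B \<omega>') \<in> space (N \<Otimes>\<^sub>M path_space)" if "\<omega> \<in> space M" "\<omega>' \<in> space M" for \<omega> \<omega>'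
    using that measurable_space[OF indep_rvD(2)[OF ind]] sp by (auto simp: space_pair_measure)
  have TB: "T (\<omega>, sample_path B \<omega>') = (\<Sum>i<n. h i \<omega> * ?D (\<lambda>u. B u \<omega>') i)" for \<omega> \<omega>'
    using t by (simp add: T_def sample_path_def)
  have normal: "distributed M lborel (\<lambda>\<omega>'. T (\<omega>, sample_path B \<omega>')) (normal_density 0 (sqrt (v \<omega>)))"
    and v0: "v \<omega> > 0" if "\<omega> \<in> space M" for \<omega>
  proof -
    show "distributed M lborel (\<lambda>\<omega>'. T (\<omega>, sample_path B \<omega>')) (normal_density 0 (sqrt (v \<omega>)))"
      unfolding TB v_def by (rule grid_sum_normal[OF B t n]) (use pos that in auto)
    have "(h i \<omega>)\<^sup>2 * (t / n) > 0" if "i < n" for i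
      using pos[OF that \<open>\<omega> \<in> space M\<close>] t n by simp
    then show "v \<omega> > 0" unfolding v_def using n by (intro sum_pos) auto
  qed
  have slice: "emeasure M {\<omega> \<in> space M. P (S \<omega>) (r \<omega>)} =
      (\<integral>\<^sup>+\<omega>. emeasure M {\<omega>' \<in> space M. P (T (\<omega>, sample_path B \<omega>')) (r \<omega>)} \<partial>M)"
    if P: "{z \<in> space (N \<Otimes>\<^sub>M path_space). P (T z) (r (fst z))} \<in> sets (N \<Otimes>\<^sub>M path_space)" for P
  proof -
    let ?E = "{z \<in> space (N \<Otimes>\<^sub>M path_space). P (T z) (r (fst z))}"
    have "{\<omega> \<in> space M. P (S \<omega>) (r \<omega>)} = {\<omega> \<in> space M. (\<omega>, sample_path B \<omega>) \<in> ?E}"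
      using inE by (auto simp: TB S_def)
    moreover have "{\<omega>' \<in> space M. P (T (\<omega>, sample_path B \<omega>')) (r \<omega>)} = {\<omega>' \<in> space M. (\<omega>, sample_path B \<omega>') \<in> ?E}"
      if "\<omega> \<in> space M" for \<omega> using inE[OF that] by auto
    ultimately show ?thesis
      using indep_rv_emeasure[OF ind P] by (simp cong: nn_integral_cong)
  qed
  have le1: "emeasure M A \<le> ennreal 1" for A
    using emeasure_le_1 by simp
  have min: "emeasure M A \<le> ennreal (min 1 x)" if "emeasure M A \<le> ennreal x" for A x
    using that le1[of A] by (simp add: min_def)
  show "emeasure M {\<omega> \<in> space M. \<bar>S \<omega>\<bar> < r \<omega>} \<le> (\<integral>\<^sup>+\<omega>. ennreal (min 1 (2 * r \<omega> / sqrt (v \<omega>))) \<partial>M)"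
  proof -
    have "emeasure M {\<omega> \<in> space M. \<bar>S \<omega>\<bar> < r \<omega>} =
        (\<integral>\<^sup>+\<omega>. emeasure M {\<omega>' \<in> space M. \<bar>T (\<omega>, sample_path B \<omega>')\<bar> < r \<omega>} \<partial>M)"
      by (rule slice) measurable
    also have "\<dots> \<le> (\<integral>\<^sup>+\<omega>. ennreal (min 1 (2 * r \<omega> / sqrt (v \<omega>))) \<partial>M)"
      by (intro nn_integral_mono min normal_small_ball normal) (use r v0 in \<open>auto intro: less_imp_le\<close>)
    finally show ?thesis .
  qed
  show "emeasure M {\<omega> \<in> space M. \<bar>S \<omega>\<bar> > r \<omega>} \<le> (\<integral>\<^sup>+\<omega>. ennreal (min 1 (v \<omega> / (r \<omega>)\<^sup>2)) \<partial>M)"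
  proof -
    have "emeasure M {\<omega> \<in> space M. \<bar>S \<omega>\<bar> > r \<omega>} =
        (\<integral>\<^sup>+\<omega>. emeasure M {\<omega>' \<in> space M. \<bar>T (\<omega>, sample_path B \<omega>')\<bar> > r \<omega>} \<partial>M)"
      by (rule slice) measurable
    also have "\<dots> \<le> (\<integral>\<^sup>+\<omega>. ennreal (min 1 (v \<omega> / (r \<omega>)\<^sup>2)) \<partial>M)"
    proof (intro nn_integral_mono min)
      fix \<omega> assume \<omega>: "\<omega> \<in> space M"
      show "emeasure M {\<omega>' \<in> space M. \<bar>T (\<omega>, sample_path B \<omega>')\<bar> > r \<omega>} \<le> ennreal (v \<omega> / (r \<omega>)\<^sup>2)"
        using normal_tail[OF normal[OF \<omega>] _ r(2)[OF \<omega>]] v0[OF \<omega>] by simp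
    qed
    finally show ?thesis .
  qed
qed

text \<open>The sums are integrals of grid functions that converge pointwise: for a fixed continuous \<open>g\<close>
  the truncation has no effect from some index on.\<close>

lemma grid_quadratic_variation_tendsto:
  fixes g :: "real \<Rightarrow> real" and n K :: "nat \<Rightarrow> nat"
  assumes t: "t > 0" and g: "continuous_on {0..t} g" "\<And>u. u \<in> {0..t} \<Longrightarrow> g u \<ge> 0"
    and n: "\<And>k. n k > k" and K: "\<And>k. K k > k"
  shows "(\<lambda>k. \<Sum>i<n k. (min (g (t * real i / real (n k))) (real (K k)))\<^sup>2 * (t / n k)) \<longlonglongrightarrow>
    (\<integral>s. (g s)\<^sup>2 \<partial>horizon t)"
proof -
  interpret L: finite_measure "horizon t" by (rule finite_measure_horizon)
  obtain C where C: "\<And>u. u \<in> {0..t} \<Longrightarrow> g u \<le> C"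
    using compact_continuous_image[OF g(1)] compact_imp_bounded bounded_imp_bdd_above
    by (metis bdd_above.E compact_Icc imageI)
  have gt: "filterlim n sequentially sequentially"
    by (rule filterlim_at_top_mono[OF filterlim_ident]) (use n in \<open>auto intro: always_eventually less_imp_le\<close>)
  let ?f = "\<lambda>k u. (min (g u) (real (K k)))\<^sup>2"
  have t0: "0 \<le> t * real i / real m" "i \<le> m \<Longrightarrow> t * real i / real m \<le> t" for i m :: nat
    using t by (cases "m = 0"; auto simp: field_simps)+
  have eq: "(\<Sum>i<n k. ?f k (t * real i / real (n k)) * (t / n k)) = (\<integral>s. grid_value t (n k) (?f k) s \<partial>horizon t)" for k
  proof -
    have *: "has_bochner_integral (horizon t) (indicator {t * real i / real (n k)<..t * real (Suc i) / real (n k)}) (t / n k)"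
      if i: "i < n k" for i
    proof -
      let ?A = "{t * real i / real (n k)<..t * real (Suc i) / real (n k)}"
      have sub: "?A \<subseteq> {0<..t}" using t0(1)[of i "n k"] t0(2)[of "Suc i" "n k"] i by auto
      have "t * real i / real (n k) \<le> t * real (Suc i) / real (n k)"
        using t by (intro divide_right_mono mult_left_mono) auto
      then have "measure lborel ?A = t / n k" by (simp add: distrib_left add_divide_distrib)
      moreover have "measure (horizon t) ?A = measure lborel ?A"
        using sub by (intro measure_restrict_space) auto
      moreover have "?A \<in> sets (horizon t)" using sub by (auto simp: sets_restrict_space_iff)
      moreover have "emeasure (horizon t) ?A < \<infinity>"
        using L.emeasure_finite[of ?A] by (simp add: less_top[symmetric])
      ultimately show ?thesis
        using has_bochner_integral_real_indicator[of ?A "horizon t"] by metis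
    qed
    have "has_bochner_integral (horizon t) (grid_value t (n k) (?f k))
        (\<Sum>i<n k. ?f k (t * real i / real (n k)) * (t / n k))"
      unfolding grid_value_def using * by (intro has_bochner_integral_sum has_bochner_integral_mult_right) auto
    then show ?thesis by (simp add: has_bochner_integral_integral_eq)
  qed
  have "(\<lambda>k. \<integral>s. grid_value t (n k) (?f k) s \<partial>horizon t) \<longlonglongrightarrow> (\<integral>s. (g s)\<^sup>2 \<partial>horizon t)"
  proof (rule integral_dominated_convergence[where w = "\<lambda>_. C\<^sup>2"])
    show "(\<lambda>s. (g s)\<^sup>2) \<in> borel_measurable (horizon t)"
      using continuous_measurable_horizon[OF g(1)] by measurable
    have "(\<lambda>s. s) \<in> borel_measurable (horizon t)" by (intro measurable_restrict_space1) simp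
    then show "grid_value t (n k) (?f k) \<in> borel_measurable (horizon t)" for k
      unfolding grid_value_def by measurable
    show "integrable (horizon t) (\<lambda>_. C\<^sup>2)" by simp
    show "AE s in horizon t. norm (grid_value t (n k) (?f k) s) \<le> C\<^sup>2" for k
    proof (rule AE_I2)
      fix s assume "s \<in> space (horizon t)"
      then have s: "s \<in> {0<..t}" by (simp add: space_restrict_space)
      have nk: "n k > 0" using n[of k] by simp
      obtain u where u: "u \<in> {0..t}" "s - t / n k \<le> u" "u \<le> s" "\<forall>g. grid_value t (n k) g s = g u"
        by (rule grid_value_eq[OF t nk s])
      have "(min (g u) (real (K k)))\<^sup>2 \<le> C\<^sup>2"
        using C[OF u(1)] g(2)[OF u(1)] by (intro power_mono) auto
      then show "norm (grid_value t (n k) (?f k) s) \<le> C\<^sup>2" using u(4) by simp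
    qed
    show "AE s in horizon t. (\<lambda>k. grid_value t (n k) (?f k) s) \<longlonglongrightarrow> (g s)\<^sup>2"
    proof (rule AE_I2)
      fix s assume "s \<in> space (horizon t)"
      then have s: "s \<in> {0<..t}" by (simp add: space_restrict_space)
      have "(\<lambda>m. grid_value t m (\<lambda>u. (g u)\<^sup>2) s) \<longlonglongrightarrow> (g s)\<^sup>2"
        by (rule grid_value_tendsto[OF t s]) (intro continuous_intros g)
      from filterlim_compose[OF this gt]
      have lim: "(\<lambda>k. grid_value t (n k) (\<lambda>u. (g u)\<^sup>2) s) \<longlonglongrightarrow> (g s)\<^sup>2" .
      obtain k0 :: nat where k0: "C \<le> real k0" using real_arch_simple by blast
      have "\<forall>\<^sub>F k in sequentially. grid_value t (n k) (\<lambda>u. (g u)\<^sup>2) s = grid_value t (n k) (?f k) s"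
        unfolding eventually_sequentially
      proof (intro exI[of _ k0] allI impI)
        fix k assume "k0 \<le> k"
        have nk: "n k > 0" using n[of k] by simp
        obtain u where u: "u \<in> {0..t}" "s - t / n k \<le> u" "u \<le> s" "\<forall>g. grid_value t (n k) g s = g u"
          by (rule grid_value_eq[OF t nk s])
        have "g u \<le> real (K k)" using C[OF u(1)] k0 \<open>k0 \<le> k\<close> K[of k] by linarith
        then show "grid_value t (n k) (\<lambda>u. (g u)\<^sup>2) s = grid_value t (n k) (?f k) s"
          using u(4) by (simp add: min_def)
      qed
      with lim show "(\<lambda>k. grid_value t (n k) (?f k) s) \<longlonglongrightarrow> (g s)\<^sup>2"
        by (rule Lim_transform_eventually)
    qed
  qed
  then show ?thesis unfolding eq .
qed

text \<open>Fatou's lemma for the indicators of the events and bounded convergence for the upper bounds.\<close>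

lemma (in prob_space) emeasure_limit_bound:
  fixes f :: "nat \<Rightarrow> 'a \<Rightarrow> real"
  assumes A[measurable]: "A \<in> events" "\<And>k. A' k \<in> events"
    and ev: "AE \<omega> in M. \<omega> \<in> A \<longrightarrow> (\<forall>\<^sub>F k in sequentially. \<omega> \<in> A' k)"
    and f: "\<And>k. f k \<in> borel_measurable M" "\<And>k \<omega>. f k \<omega> \<le> 1"
    and lim: "\<And>\<omega>. \<omega> \<in> space M \<Longrightarrow> (\<lambda>k. f k \<omega>) \<longlonglongrightarrow> g \<omega>"
    and bound: "\<And>k. emeasure M (A' k) \<le> (\<integral>\<^sup>+\<omega>. ennreal (f k \<omega>) \<partial>M)"
  shows "emeasure M A \<le> (\<integral>\<^sup>+\<omega>. ennreal (g \<omega>) \<partial>M)"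
proof -
  have g: "g \<in> borel_measurable M" by (rule borel_measurable_LIMSEQ_real[OF lim f(1)])
  have "(\<lambda>k. \<integral>\<^sup>+\<omega>. ennreal (f k \<omega>) \<partial>M) \<longlonglongrightarrow> (\<integral>\<^sup>+\<omega>. ennreal (g \<omega>) \<partial>M)"
  proof (rule nn_integral_dominated_convergence[where w = "\<lambda>_. 1"])
    show "AE \<omega> in M. ennreal (f k \<omega>) \<le> 1" for k using f(2)[of k] by (auto simp: ennreal_le_1)
    show "AE \<omega> in M. (\<lambda>k. ennreal (f k \<omega>)) \<longlonglongrightarrow> ennreal (g \<omega>)"
      by (intro AE_I2 tendsto_ennrealI lim)
    show "(\<integral>\<^sup>+\<omega>. 1 \<partial>M) < \<infinity>" by (simp add: emeasure_space_1)
  qed (use f g in auto)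
  then have lim': "liminf (\<lambda>k. \<integral>\<^sup>+\<omega>. ennreal (f k \<omega>) \<partial>M) = (\<integral>\<^sup>+\<omega>. ennreal (g \<omega>) \<partial>M)"
    by (rule lim_imp_Liminf[OF sequentially_bot])
  have "emeasure M A = (\<integral>\<^sup>+\<omega>. indicator A \<omega> \<partial>M)" by simp
  also have "\<dots> \<le> (\<integral>\<^sup>+\<omega>. liminf (\<lambda>k. indicator (A' k) \<omega>) \<partial>M)"
  proof (rule nn_integral_mono_AE)
    show "AE \<omega> in M. indicator A \<omega> \<le> liminf (\<lambda>k. indicator (A' k) \<omega> :: ennreal)"
      using ev
    proof (rule AE_mp, intro AE_I2 impI)
      fix \<omega> assume "\<omega> \<in> A \<longrightarrow> (\<forall>\<^sub>F k in sequentially. \<omega> \<in> A' k)"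
      then show "indicator A \<omega> \<le> liminf (\<lambda>k. indicator (A' k) \<omega> :: ennreal)"
        by (intro Liminf_bounded) (auto simp: indicator_def elim: eventually_mono)
    qed
  qed
  also have "\<dots> \<le> liminf (\<lambda>k. \<integral>\<^sup>+\<omega>. indicator (A' k) \<omega> \<partial>M)"
    by (rule nn_integral_liminf) simp
  also have "\<dots> \<le> liminf (\<lambda>k. \<integral>\<^sup>+\<omega>. ennreal (f k \<omega>) \<partial>M)"
    using bound by (intro Liminf_mono always_eventually) simp
  also note lim'
  finally show ?thesis .
qed

lemma square_integral_pos:
  assumes t: "t > 0" and g: "continuous_on {0..t} g" "\<And>u. u \<in> {0..t} \<Longrightarrow> g u > (0::real)"
  shows "(\<integral>s. (g s)\<^sup>2 \<partial>horizon t) > 0"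
proof -
  interpret L: finite_measure "horizon t" by (rule finite_measure_horizon)
  obtain c where c: "c \<in> {0..t}" "\<And>u. u \<in> {0..t} \<Longrightarrow> g c \<le> g u"
    using continuous_attains_inf[OF _ _ g(1)] t by fastforce
  obtain C where C: "C \<in> {0..t}" "\<And>u. u \<in> {0..t} \<Longrightarrow> g u \<le> g C"
    using continuous_attains_sup[OF _ _ g(1)] t by fastforce
  have gc: "g c > 0" by (rule g(2)[OF c(1)])
  note [measurable] = continuous_measurable_horizon[OF g(1)]
  have "(\<integral>s. (g c)\<^sup>2 \<partial>horizon t) \<le> (\<integral>s. (g s)\<^sup>2 \<partial>horizon t)"
  proof (rule integral_mono)
    show "integrable (horizon t) (\<lambda>s. (g s)\<^sup>2)"
    proof (rule L.integrable_const_bound[of _ "(g C)\<^sup>2"])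
      show "AE s in horizon t. norm ((g s)\<^sup>2) \<le> (g C)\<^sup>2"
      proof (rule AE_I2)
        fix s assume "s \<in> space (horizon t)"
        then have "s \<in> {0..t}" by (auto simp: space_restrict_space)
        then show "norm ((g s)\<^sup>2) \<le> (g C)\<^sup>2" using C(2)[of s] g(2)[of s] by (auto intro!: power_mono)
      qed
    qed measurable
    fix s assume "s \<in> space (horizon t)"
    then have "s \<in> {0..t}" by (auto simp: space_restrict_space)
    then show "(g c)\<^sup>2 \<le> (g s)\<^sup>2" using c(2)[of s] gc by (auto intro!: power_mono)
  qed simp
  moreover have "(\<integral>s. (g c)\<^sup>2 \<partial>horizon t) = (g c)\<^sup>2 * t"
    using t by (simp add: measure_restrict_space space_restrict_space)
  ultimately show ?thesis using gc t by (smt (verit) mult_pos_pos zero_less_power)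
qed

text \<open>Given \<open>N\<close>, the integral \<open>J\<close> behaves like a centred Gaussian variable with variance \<open>V\<close>: these
  are the small-ball and the Chebyshev estimate of such a variable, averaged over \<open>N\<close>.\<close>

lemma (in prob_space) ito_integral_conditional_bounds:
  fixes H :: "real \<Rightarrow> 'a \<Rightarrow> real"
  assumes B: "brownian_wrt M F B" and J: "is_ito_integral M F B H t J" and t: "t > 0"
    and H: "\<And>s. s \<ge> 0 \<Longrightarrow> H s \<in> borel_measurable (F s)"
    and pos: "\<And>s \<omega>. s \<ge> 0 \<Longrightarrow> \<omega> \<in> space M \<Longrightarrow> H s \<omega> > 0"
    and cont: "\<And>\<omega>. \<omega> \<in> space M \<Longrightarrow> continuous_on {0..} (\<lambda>s. H s \<omega>)"
    and N: "space N = space M" "sets N \<subseteq> sets M"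
    and HN: "\<And>s. s \<ge> 0 \<Longrightarrow> H s \<in> borel_measurable N"
    and ind: "indep_rv M N (\<lambda>\<omega>. \<omega>) path_space (sample_path B)"
    and r: "r \<in> borel_measurable N" "\<And>\<omega>. \<omega> \<in> space M \<Longrightarrow> r \<omega> > 0"
  defines "V \<equiv> \<lambda>\<omega>. \<integral>s. (H s \<omega>)\<^sup>2 \<partial>horizon t"
  shows "emeasure M {\<omega> \<in> space M. \<bar>J \<omega>\<bar> < r \<omega>} \<le> (\<integral>\<^sup>+\<omega>. ennreal (min 1 (2 * r \<omega> / sqrt (V \<omega>))) \<partial>M)"
    "emeasure M {\<omega> \<in> space M. \<bar>J \<omega>\<bar> > r \<omega>} \<le> (\<integral>\<^sup>+\<omega>. ennreal (min 1 (V \<omega> / (r \<omega>)\<^sup>2)) \<partial>M)"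
proof -
  have sbm: "standard_brownian_motion M B" using B by (simp add: brownian_wrt_def)
  obtain n K :: "nat \<Rightarrow> nat" where nK: "\<And>k. n k > k" "\<And>k. K k > k"
    and lim: "AE \<omega> in M. (\<lambda>k. step_integral B t (grid_step t (n k) (real (K k)) H) \<omega>) \<longlonglongrightarrow> J \<omega>"
    using ito_integral_grid_limit[OF B J t H less_imp_le[OF pos] cont] by blast
  define h where "h k i \<omega> = min (H (t * real i / real (n k)) \<omega>) (real (K k))" for k i \<omega>
  define S where "S k \<omega> = (\<Sum>i<n k. h k i \<omega> * (B (t * real (Suc i) / real (n k)) \<omega> - B (t * real i / real (n k)) \<omega>))" for k \<omega>
  define v where "v k \<omega> = (\<Sum>i<n k. (h k i \<omega>)\<^sup>2 * (t / n k))" for k \<omega>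
  have n0: "n k > 0" and K0: "K k > 0" for k using nK[of k] by auto
  have u0: "t * real i / real (n k) \<ge> 0" for i k using t by simp
  have SJ: "AE \<omega> in M. (\<lambda>k. S k \<omega>) \<longlonglongrightarrow> J \<omega>"
    using lim by (simp add: grid_step_integral[OF t] S_def h_def)
  have h0: "h k i \<omega> > 0" if "\<omega> \<in> space M" for k i \<omega>
    using pos[OF u0 that] K0[of k] by (simp add: h_def)
  have hN: "h k i \<in> borel_measurable N" for k i
    unfolding h_def by (intro borel_measurable_min HN[OF u0]) simp
  note hM = measurable_larger_sets[OF hN N]
  have rM[measurable]: "r \<in> borel_measurable M" by (rule measurable_larger_sets[OF r(1) N])
  have Jm[measurable]: "J \<in> borel_measurable M" using J by (simp add: is_ito_integral_def)
  have Sm[measurable]: "S k \<in> borel_measurable M" for k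
    unfolding S_def using t
    by (intro borel_measurable_sum borel_measurable_times borel_measurable_diff sbm_measurable[OF sbm] hM) auto
  have vm[measurable]: "v k \<in> borel_measurable M" for k
    unfolding v_def using hM by measurable
  have cont': "continuous_on {0..t} (\<lambda>s. H s \<omega>)" if "\<omega> \<in> space M" for \<omega>
    by (rule continuous_on_subset[OF cont[OF that]]) auto
  have vV: "(\<lambda>k. v k \<omega>) \<longlonglongrightarrow> V \<omega>" and V0: "V \<omega> > 0" if \<omega>: "\<omega> \<in> space M" for \<omega>
  proof -
    show "(\<lambda>k. v k \<omega>) \<longlonglongrightarrow> V \<omega>"
      unfolding v_def h_def V_def
      by (rule grid_quadratic_variation_tendsto[OF t cont'[OF \<omega>] less_imp_le[OF pos[OF _ \<omega>]] nK]) auto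
    show "V \<omega> > 0"
      unfolding V_def by (rule square_integral_pos[OF t cont'[OF \<omega>] pos[OF _ \<omega>]]) auto
  qed
  note bounds = grid_sum_bounds[OF sbm ind N(1) t n0 hN h0 r]
  show "emeasure M {\<omega> \<in> space M. \<bar>J \<omega>\<bar> < r \<omega>} \<le> (\<integral>\<^sup>+\<omega>. ennreal (min 1 (2 * r \<omega> / sqrt (V \<omega>))) \<partial>M)"
  proof (rule emeasure_limit_bound[where A' = "\<lambda>k. {\<omega> \<in> space M. \<bar>S k \<omega>\<bar> < r \<omega>}"])
    show "AE \<omega> in M. \<omega> \<in> {\<omega> \<in> space M. \<bar>J \<omega>\<bar> < r \<omega>} \<longrightarrow>
        (\<forall>\<^sub>F k in sequentially. \<omega> \<in> {\<omega> \<in> space M. \<bar>S k \<omega>\<bar> < r \<omega>})"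
      using SJ
    proof (rule AE_mp, intro AE_I2 impI)
      fix \<omega> assume "(\<lambda>k. S k \<omega>) \<longlonglongrightarrow> J \<omega>" "\<omega> \<in> {\<omega> \<in> space M. \<bar>J \<omega>\<bar> < r \<omega>}"
      then show "\<forall>\<^sub>F k in sequentially. \<omega> \<in> {\<omega> \<in> space M. \<bar>S k \<omega>\<bar> < r \<omega>}"
        using order_tendstoD(2)[OF tendsto_rabs] by auto
    qed
    show "(\<lambda>k. min 1 (2 * r \<omega> / sqrt (v k \<omega>))) \<longlonglongrightarrow> min 1 (2 * r \<omega> / sqrt (V \<omega>))" if "\<omega> \<in> space M" for \<omega>
      using vV[OF that] V0[OF that] by (intro tendsto_intros) auto
    show "emeasure M {\<omega> \<in> space M. \<bar>S k \<omega>\<bar> < r \<omega>} \<le> (\<integral>\<^sup>+\<omega>. ennreal (min 1 (2 * r \<omega> / sqrt (v k \<omega>))) \<partial>M)" for k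
      unfolding S_def v_def by (rule bounds(1))
  qed (simp, measurable)
  show "emeasure M {\<omega> \<in> space M. \<bar>J \<omega>\<bar> > r \<omega>} \<le> (\<integral>\<^sup>+\<omega>. ennreal (min 1 (V \<omega> / (r \<omega>)\<^sup>2)) \<partial>M)"
  proof (rule emeasure_limit_bound[where A' = "\<lambda>k. {\<omega> \<in> space M. \<bar>S k \<omega>\<bar> > r \<omega>}"])
    show "AE \<omega> in M. \<omega> \<in> {\<omega> \<in> space M. \<bar>J \<omega>\<bar> > r \<omega>} \<longrightarrow>
        (\<forall>\<^sub>F k in sequentially. \<omega> \<in> {\<omega> \<in> space M. \<bar>S k \<omega>\<bar> > r \<omega>})"
      using SJ
    proof (rule AE_mp, intro AE_I2 impI)
      fix \<omega> assume "(\<lambda>k. S k \<omega>) \<longlonglongrightarrow> J \<omega>" "\<omega> \<in> {\<omega> \<in> space M. \<bar>J \<omega>\<bar> > r \<omega>}"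
      then show "\<forall>\<^sub>F k in sequentially. \<omega> \<in> {\<omega> \<in> space M. \<bar>S k \<omega>\<bar> > r \<omega>}"
        using order_tendstoD(1)[OF tendsto_rabs] by auto
    qed
    show "(\<lambda>k. min 1 (v k \<omega> / (r \<omega>)\<^sup>2)) \<longlonglongrightarrow> min 1 (V \<omega> / (r \<omega>)\<^sup>2)" if "\<omega> \<in> space M" for \<omega>
      using vV[OF that] r(2)[OF that] by (intro tendsto_intros) auto
    show "emeasure M {\<omega> \<in> space M. \<bar>S k \<omega>\<bar> > r \<omega>} \<le> (\<integral>\<^sup>+\<omega>. ennreal (min 1 (v k \<omega> / (r \<omega>)\<^sup>2)) \<partial>M)" for k
      unfolding S_def v_def by (rule bounds(2))
  qed (simp, measurable)
qed

section \<open>Filtrations generated by independent Brownian motions\<close>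

text \<open>The element \<open>X\<close> is frozen by Fubini's theorem; then only the two functions of \<open>Y\<close> are left.\<close>

lemma (in prob_space) indep_rv_extend:
  assumes XY: "indep_rv M S X T Y" and f[measurable]: "f \<in> measurable T T1" and g[measurable]: "g \<in> measurable T T2"
    and fg: "indep_rv M T1 (\<lambda>\<omega>. f (Y \<omega>)) T2 (\<lambda>\<omega>. g (Y \<omega>))"
  shows "indep_rv M (S \<Otimes>\<^sub>M T1) (\<lambda>\<omega>. (X \<omega>, f (Y \<omega>))) T2 (\<lambda>\<omega>. g (Y \<omega>))"
  unfolding indep_rv_def
proof (intro conjI ballI)
  note [measurable] = indep_rvD(1,2)[OF XY]
  fix A C assume A[measurable]: "A \<in> sets (S \<Otimes>\<^sub>M T1)" and C[measurable]: "C \<in> sets T2"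
  have XfY: "indep_rv M S X T1 (\<lambda>\<omega>. f (Y \<omega>))"
    using indep_rv_compose[OF XY measurable_ident f] by simp
  let ?E = "{z \<in> space (S \<Otimes>\<^sub>M T). (fst z, f (snd z)) \<in> A \<and> g (snd z) \<in> C}"
  have E: "?E \<in> sets (S \<Otimes>\<^sub>M T)" by measurable
  have mem: "(X \<omega>, Y \<omega>') \<in> space (S \<Otimes>\<^sub>M T)" if "\<omega> \<in> space M" "\<omega>' \<in> space M" for \<omega> \<omega>'
    using measurable_space[OF indep_rvD(1)[OF XY] that(1)] measurable_space[OF indep_rvD(2)[OF XY] that(2)]
    by (simp add: space_pair_measure)
  have "emeasure M {\<omega> \<in> space M. (X \<omega>, f (Y \<omega>)) \<in> A \<and> g (Y \<omega>) \<in> C} =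
      emeasure M {\<omega> \<in> space M. (X \<omega>, Y \<omega>) \<in> ?E}"
    using mem by (auto intro!: arg_cong[where f = "emeasure M"])
  also have "\<dots> = (\<integral>\<^sup>+\<omega>. emeasure M {\<omega>' \<in> space M. (X \<omega>, Y \<omega>') \<in> ?E} \<partial>M)"
    by (rule indep_rv_emeasure[OF XY E])
  also have "\<dots> = (\<integral>\<^sup>+\<omega>. emeasure M {\<omega>' \<in> space M. (X \<omega>, f (Y \<omega>')) \<in> A} *
      emeasure M {\<omega>' \<in> space M. g (Y \<omega>') \<in> C} \<partial>M)"
  proof (rule nn_integral_cong)
    fix \<omega> assume \<omega>: "\<omega> \<in> space M"
    have sl: "Pair (X \<omega>) -` A \<in> sets T1" by (rule sets_Pair1[OF A])
    have "{\<omega>' \<in> space M. (X \<omega>, Y \<omega>') \<in> ?E} =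
        {\<omega>' \<in> space M. f (Y \<omega>') \<in> Pair (X \<omega>) -` A \<and> g (Y \<omega>') \<in> C}"
      using mem[OF \<omega>] by auto
    then show "emeasure M {\<omega>' \<in> space M. (X \<omega>, Y \<omega>') \<in> ?E} =
        emeasure M {\<omega>' \<in> space M. (X \<omega>, f (Y \<omega>')) \<in> A} * emeasure M {\<omega>' \<in> space M. g (Y \<omega>') \<in> C}"
      using indep_rvD(3)[OF fg sl C] by (simp add: emeasure_eq_measure ennreal_mult)
  qed
  also have "\<dots> = (\<integral>\<^sup>+\<omega>. emeasure M {\<omega>' \<in> space M. (X \<omega>, f (Y \<omega>')) \<in> A} \<partial>M) *
      emeasure M {\<omega>' \<in> space M. g (Y \<omega>') \<in> C}"
  proof (rule nn_integral_multc)
    interpret P: prob_space "distr M T1 (\<lambda>\<omega>. f (Y \<omega>))" by (rule prob_space_distr) measurable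
    have "sets (S \<Otimes>\<^sub>M distr M T1 (\<lambda>\<omega>. f (Y \<omega>))) = sets (S \<Otimes>\<^sub>M T1)"
      by (intro sets_pair_measure_cong) simp_all
    with A have "A \<in> sets (S \<Otimes>\<^sub>M distr M T1 (\<lambda>\<omega>. f (Y \<omega>)))" by simp
    from P.measurable_emeasure_Pair[OF this]
    have "(\<lambda>\<omega>. emeasure (distr M T1 (\<lambda>\<omega>. f (Y \<omega>))) (Pair (X \<omega>) -` A)) \<in> borel_measurable M"
      by (rule measurable_compose[OF indep_rvD(1)[OF XY]])
    moreover have "emeasure (distr M T1 (\<lambda>\<omega>. f (Y \<omega>))) (Pair (X \<omega>) -` A) =
        emeasure M {\<omega>' \<in> space M. (X \<omega>, f (Y \<omega>')) \<in> A}" for \<omega>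
      using sets_Pair1[OF A, of "X \<omega>"]
      by (subst emeasure_distr) (auto intro!: arg_cong[where f = "emeasure M"])
    ultimately show "(\<lambda>\<omega>. emeasure M {\<omega>' \<in> space M. (X \<omega>, f (Y \<omega>')) \<in> A}) \<in> borel_measurable M" by simp
  qed
  also have "(\<integral>\<^sup>+\<omega>. emeasure M {\<omega>' \<in> space M. (X \<omega>, f (Y \<omega>')) \<in> A} \<partial>M) =
      emeasure M {\<omega> \<in> space M. (X \<omega>, f (Y \<omega>)) \<in> A}"
    by (rule indep_rv_emeasure[OF XfY A, symmetric])
  finally show "prob {\<omega> \<in> space M. (X \<omega>, f (Y \<omega>)) \<in> A \<and> g (Y \<omega>) \<in> C} =
      prob {\<omega> \<in> space M. (X \<omega>, f (Y \<omega>)) \<in> A} * prob {\<omega> \<in> space M. g (Y \<omega>) \<in> C}"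
    by (simp add: emeasure_eq_measure flip: ennreal_mult)
qed (use indep_rvD[OF XY] in measurable)

text \<open>Independence of \<open>X\<close> is independence of the \<open>\<sigma>\<close>-algebra generated by \<open>X\<close>, hence of every
  smaller one.\<close>

lemma indep_rv_coarser:
  assumes ind: "indep_rv M S X T Y" and sp: "space G = space M"
    and sub: "sets G \<subseteq> sets (vimage_algebra (space M) X S)"
  shows "indep_rv M G (\<lambda>\<omega>. \<omega>) T Y"
proof -
  have X: "X \<in> measurable M S" by (rule indep_rvD(1)[OF ind])
  then have XS: "X \<in> space M \<rightarrow> space S" by (auto dest: measurable_space)
  have preimage: "\<exists>E\<in>sets S. A = X -` E \<inter> space M" if "A \<in> sets G" for A
    using that sub by (auto simp: sets_vimage_algebra2[OF XS])
  show ?thesis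
    unfolding indep_rv_def
  proof (intro conjI ballI)
    show "(\<lambda>\<omega>. \<omega>) \<in> measurable M G"
      by (rule measurable_ident_coarser[OF sp]) (use preimage X in \<open>auto intro: measurable_sets\<close>)
    show "Y \<in> measurable M T" by (rule indep_rvD(2)[OF ind])
    fix A C assume "A \<in> sets G" "C \<in> sets T"
    from preimage[OF this(1)] obtain E where E: "E \<in> sets S" "A = X -` E \<inter> space M" by blast
    have "{\<omega> \<in> space M. \<omega> \<in> A \<and> Y \<omega> \<in> C} = {\<omega> \<in> space M. X \<omega> \<in> E \<and> Y \<omega> \<in> C}"
      "{\<omega> \<in> space M. \<omega> \<in> A} = {\<omega> \<in> space M. X \<omega> \<in> E}" by (auto simp: E)
    then show "measure M {\<omega> \<in> space M. \<omega> \<in> A \<and> Y \<omega> \<in> C} =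
        measure M {\<omega> \<in> space M. \<omega> \<in> A} * measure M {\<omega> \<in> space M. Y \<omega> \<in> C}"
      using indep_rvD(3)[OF ind E(1) \<open>C \<in> sets T\<close>] by simp
  qed
qed

lemma space_natural_filtration: "space (natural_filtration M \<xi> s) = space M"
  by (simp add: natural_filtration_def space_measure_of_conv)

lemma sets_natural_filtration:
  "sets (natural_filtration M \<xi> s) =
    sigma_sets (space M) {\<xi> u -` A \<inter> space M | u A. 0 \<le> u \<and> u \<le> s \<and> A \<in> sets borel}"
  unfolding natural_filtration_def by (rule sets_measure_of) auto

lemma natural_filtration_le:
  assumes sp: "space G = space M" and \<xi>: "\<And>u. 0 \<le> u \<Longrightarrow> u \<le> s \<Longrightarrow> \<xi> u \<in> borel_measurable G"
  shows "sets (natural_filtration M \<xi> s) \<subseteq> sets G"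
  unfolding sets_natural_filtration sp[symmetric]
  by (rule sets.sigma_sets_subset) (use \<xi> in \<open>auto intro: measurable_sets\<close>)

lemma natural_filtration_measurable:
  assumes "0 \<le> u" "u \<le> s"
  shows "\<xi> u \<in> borel_measurable (natural_filtration M \<xi> s)"
proof (rule measurableI)
  fix A :: "'b set" assume "A \<in> sets borel"
  then show "\<xi> u -` A \<inter> space (natural_filtration M \<xi> s) \<in> sets (natural_filtration M \<xi> s)"
    unfolding sets_natural_filtration space_natural_filtration
    using assms by (intro sigma_sets.Basic) blast
qed simp

text \<open>The common filtration up to time \<open>s\<close> is contained in the \<open>\<sigma>\<close>-algebra generated by the whole
  paths of the other two motions together with the path of \<open>P j\<close> up to \<open>s\<close>. The later increments of
  \<open>P j\<close> are independent of the former by assumption and of the latter by the independence of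
  increments.\<close>

lemma (in prob_space) independent_family_brownian_wrt:
  fixes P :: "nat \<Rightarrow> real \<Rightarrow> 'a \<Rightarrow> real"
  assumes sbm: "\<And>i. i < 3 \<Longrightarrow> standard_brownian_motion M (P i)"
    and ind: "indep_vars (\<lambda>_. path_space) (\<lambda>i. sample_path (P i)) {..<3}" and j: "j < 3"
  shows "brownian_wrt M (natural_filtration M (\<lambda>s \<omega>. (P 0 s \<omega>, P 1 s \<omega>, P 2 s \<omega>))) (P j)"
proof -
  define \<xi> where "\<xi> = (\<lambda>s \<omega>. (P 0 s \<omega>, P 1 s \<omega>, P 2 s \<omega>))"
  let ?F = "natural_filtration M \<xi>"
  have lt: "0 < (3::nat)" "1 < (3::nat)" "2 < (3::nat)" by auto
  have \<xi>_meas: "\<xi> u \<in> borel_measurable G" if "\<And>i. i < 3 \<Longrightarrow> P i u \<in> borel_measurable G" for u G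
  proof -
    have "P 0 u \<in> borel_measurable G" "P 1 u \<in> borel_measurable G" "P 2 u \<in> borel_measurable G"
      using that[OF lt(1)] that[OF lt(2)] that[OF lt(3)] .
    then show ?thesis unfolding \<xi>_def by measurable
  qed
  have coord: "P j s \<in> borel_measurable (?F s)" if "s \<ge> 0" for s
  proof -
    note \<xi> = natural_filtration_measurable[OF that order_refl, of \<xi> M]
    have "(\<lambda>\<omega>. fst (\<xi> s \<omega>)) \<in> borel_measurable (?F s)" "(\<lambda>\<omega>. fst (snd (\<xi> s \<omega>))) \<in> borel_measurable (?F s)"
      "(\<lambda>\<omega>. snd (snd (\<xi> s \<omega>))) \<in> borel_measurable (?F s)"
      by (rule measurable_compose[OF \<xi> borel_measurable_continuous_onI]; intro continuous_intros)+
    moreover have "j = 0 \<or> j = 1 \<or> j = 2" using j by auto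
    ultimately show ?thesis by (auto simp: \<xi>_def)
  qed
  define A where "A = {..<3} - {j}"
  define \<Theta> where "\<Theta> \<omega> = (\<lambda>i\<in>A. sample_path (P i) \<omega>)" for \<omega>
  have "indep_var (Pi\<^sub>M A (\<lambda>_. path_space)) (\<lambda>\<omega>. restrict (\<lambda>i. sample_path (P i) \<omega>) A)
      (Pi\<^sub>M {j} (\<lambda>_. path_space)) (\<lambda>\<omega>. restrict (\<lambda>i. sample_path (P i) \<omega>) {j})"
    by (rule indep_var_restrict[OF ind]) (use j in \<open>auto simp: A_def\<close>)
  then have "indep_rv M (Pi\<^sub>M A (\<lambda>_. path_space)) \<Theta>
      (Pi\<^sub>M {j} (\<lambda>_. path_space)) (\<lambda>\<omega>. restrict (\<lambda>i. sample_path (P i) \<omega>) {j})"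
    unfolding indep_rv_indep_var \<Theta>_def[abs_def] .
  from indep_rv_compose[OF this measurable_ident measurable_component_singleton[of j]]
  have \<Theta>: "indep_rv M (Pi\<^sub>M A (\<lambda>_. path_space)) \<Theta> path_space (sample_path (P j))" by simp
  have incr: "indep_rv M (?F s) (\<lambda>\<omega>. \<omega>) borel (\<lambda>\<omega>. P j t \<omega> - P j s \<omega>)" if st: "0 \<le> s" "s \<le> t" for s t
  proof -
    let ?past = "Pi\<^sub>M {0..s} (\<lambda>_. borel :: real measure)"
    let ?X = "\<lambda>\<omega>. (\<Theta> \<omega>, \<lambda>u\<in>{0..s}. sample_path (P j) \<omega> u)"
    let ?S = "Pi\<^sub>M A (\<lambda>_. path_space) \<Otimes>\<^sub>M ?past"
    have "indep_rv M ?S ?X borel (\<lambda>\<omega>. sample_path (P j) \<omega> t - sample_path (P j) \<omega> s)"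
    proof (rule indep_rv_extend[OF \<Theta>])
      show "(\<lambda>w. \<lambda>u\<in>{0..s}. w u) \<in> measurable path_space ?past"
        by (rule measurable_restrict) auto
      show "(\<lambda>w. w t - w s) \<in> borel_measurable path_space"
        using st by (intro borel_measurable_diff path_coordinate_measurable) auto
      have "(\<lambda>u\<in>{0..s}. sample_path (P j) \<omega> u) = (\<lambda>u\<in>{0..s}. P j u \<omega>)" for \<omega>
        by (auto simp: sample_path_def fun_eq_iff)
      then show "indep_rv M ?past (\<lambda>\<omega>. \<lambda>u\<in>{0..s}. sample_path (P j) \<omega> u) borel (\<lambda>\<omega>. sample_path (P j) \<omega> t - sample_path (P j) \<omega> s)"
        using sbm_past_indep_increment[OF sbm[OF j] st(1) order_refl st(2)] st by (simp add: sample_path_def)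
    qed
    then have main: "indep_rv M ?S ?X borel (\<lambda>\<omega>. P j t \<omega> - P j s \<omega>)"
      using st by (simp add: sample_path_def)
    let ?V = "vimage_algebra (space M) ?X ?S"
    have spV: "space ?V = space M" by simp
    have "?X \<in> space M \<rightarrow> space ?S"
      using indep_rvD(1)[OF main] by (auto dest: measurable_space)
    then have XV: "?X \<in> measurable ?V ?S" by (rule measurable_vimage_algebra1)
    show ?thesis
    proof (rule indep_rv_coarser[OF main space_natural_filtration natural_filtration_le[OF spV]])
      fix u assume u: "0 \<le> u" "u \<le> s"
      show "\<xi> u \<in> borel_measurable ?V"
      proof (rule \<xi>_meas)
        fix i :: nat assume i: "i < 3"
        show "P i u \<in> borel_measurable ?V"
        proof (cases "i = j")
          case True
          have "(\<lambda>z. snd z u) \<in> borel_measurable ?S"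
            by (rule measurable_compose[OF measurable_snd measurable_component_singleton]) (use u in auto)
          from measurable_compose[OF XV this] show ?thesis using u True by (simp add: sample_path_def)
        next
          case False
          then have "i \<in> A" using i by (simp add: A_def)
          have "(\<lambda>z. fst z i u) \<in> borel_measurable ?S"
            by (rule measurable_compose[OF measurable_compose[OF measurable_fst
                  measurable_component_singleton[OF \<open>i \<in> A\<close>]] path_coordinate_measurable[OF u(1)]])
          from measurable_compose[OF XV this] show ?thesis
            using u \<open>i \<in> A\<close> by (simp add: sample_path_def \<Theta>_def)
        qed
      qed
    qed
  qed
  show ?thesis
    unfolding brownian_wrt_def \<xi>_def[symmetric]
  proof (intro conjI allI impI)
    show "standard_brownian_motion M (P j)" by (rule sbm[OF j])
    fix s :: real assume s: "0 \<le> s"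
    show "space (?F s) = space M" by (rule space_natural_filtration)
    show "sets (?F s) \<subseteq> sets M"
      by (rule natural_filtration_le[OF refl \<xi>_meas]) (rule sbm_measurable[OF sbm])
    show "P j s \<in> borel_measurable (?F s)" by (rule coord[OF s])
    fix t assume st: "s \<le> t"
    show "sets (?F s) \<subseteq> sets (?F t)"
      by (rule natural_filtration_le) (use st in \<open>auto simp: space_natural_filtration intro: natural_filtration_measurable\<close>)
    show "indep_rv M (?F s) (\<lambda>\<omega>. \<omega>) borel (\<lambda>\<omega>. P j t \<omega> - P j s \<omega>)" by (rule incr[OF s st])
  qed
qed

lemma (in prob_space) independent_family_path_algebra:
  fixes P :: "nat \<Rightarrow> real \<Rightarrow> 'a \<Rightarrow> real"
  assumes ind: "indep_vars (\<lambda>_. path_space) (\<lambda>i. sample_path (P i)) I" and ij: "i \<in> I" "j \<in> I" "i \<noteq> j"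
  shows "indep_rv M (vimage_algebra (space M) (sample_path (P i)) path_space) (\<lambda>\<omega>. \<omega>) path_space (sample_path (P j))"
proof (rule indep_rv_coarser)
  have "indep_var (Pi\<^sub>M {i} (\<lambda>_. path_space)) (\<lambda>\<omega>. restrict (\<lambda>i. sample_path (P i) \<omega>) {i})
      (Pi\<^sub>M {j} (\<lambda>_. path_space)) (\<lambda>\<omega>. restrict (\<lambda>i. sample_path (P i) \<omega>) {j})"
    by (rule indep_var_restrict[OF ind]) (use ij in auto)
  then have "indep_rv M (Pi\<^sub>M {i} (\<lambda>_. path_space)) (\<lambda>\<omega>. restrict (\<lambda>i. sample_path (P i) \<omega>) {i})
      (Pi\<^sub>M {j} (\<lambda>_. path_space)) (\<lambda>\<omega>. restrict (\<lambda>i. sample_path (P i) \<omega>) {j})"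
    unfolding indep_rv_indep_var .
  from indep_rv_compose[OF this measurable_component_singleton[of i] measurable_component_singleton[of j]]
  show "indep_rv M path_space (sample_path (P i)) path_space (sample_path (P j))" by simp
qed simp_all

section \<open>The size of integrals of exponentials of Brownian motion\<close>

lemma cSUP_rationals:
  fixes f :: "real \<Rightarrow> real"
  assumes f: "continuous_on {0..1} f"
  shows "(SUP u\<in>{0..1}. f u) = (SUP u\<in>\<rat> \<inter> {0..1}. f u)" "bdd_above (f ` {0..1})"
proof -
  obtain s where s: "s \<in> {0..1}" "\<And>t. t \<in> {0..1} \<Longrightarrow> f t \<le> f s"
    using continuous_attains_sup[OF _ _ f] by fastforce
  then show bdd: "bdd_above (f ` {0..1})" by (intro bdd_aboveI2)
  have bddQ: "bdd_above (f ` (\<rat> \<inter> {0..1}))" by (rule bdd_above_mono[OF bdd]) auto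
  have "(0::real) \<in> \<rat> \<inter> {0..1}" by auto
  then have ne: "\<rat> \<inter> {0..1} \<noteq> ({} :: real set)" by blast
  have cont: "continuous_on (closure (\<rat> \<inter> {0..1})) f" unfolding rational_grid_dense by (rule f)
  have "f u \<le> (SUP u\<in>\<rat> \<inter> {0..1}. f u)" if "u \<in> {0..1}" for u
    by (rule continuous_le_on_closure[OF cont]) (use that rational_grid_dense bddQ in \<open>auto intro: cSUP_upper\<close>)
  then have "(SUP u\<in>{0..1}. f u) \<le> (SUP u\<in>\<rat> \<inter> {0..1}. f u)"
    by (intro cSUP_least) auto
  moreover have "(SUP u\<in>\<rat> \<inter> {0..1}. f u) \<le> (SUP u\<in>{0..1}. f u)"
    using ne bdd by (intro cSUP_subset_mono) auto
  ultimately show "(SUP u\<in>{0..1}. f u) = (SUP u\<in>\<rat> \<inter> {0..1}. f u)" by simp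
qed

lemma borel_measurable_SUP_path:
  fixes X :: "real \<Rightarrow> 'a \<Rightarrow> real"
  assumes X: "\<And>u. u \<in> {0..1} \<Longrightarrow> X u \<in> borel_measurable N"
    and cont: "\<And>\<omega>. \<omega> \<in> space N \<Longrightarrow> continuous_on {0..1} (\<lambda>u. X u \<omega>)"
  shows "(\<lambda>\<omega>. SUP u\<in>{0..1}. X u \<omega>) \<in> borel_measurable N"
proof -
  have "(\<lambda>\<omega>. SUP u\<in>\<rat> \<inter> {0..1}. X u \<omega>) \<in> borel_measurable N"
  proof (rule borel_measurable_cSUP)
    show "countable (\<rat> \<inter> {0..1::real})" using countable_rat by (rule countable_subset[rotated]) auto
    show "bdd_above ((\<lambda>u. X u \<omega>) ` (\<rat> \<inter> {0..1}))" if "\<omega> \<in> space N" for \<omega>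
      by (rule bdd_above_mono[OF cSUP_rationals(2)[OF cont[OF that]]]) auto
  qed (use X in auto)
  then show ?thesis
    by (rule measurable_cong[THEN iffD1, rotated]) (simp add: cSUP_rationals(1)[OF cont])
qed

text \<open>Only the maximum of the integrand enters the upper half of Laplace's principle.\<close>

lemma exp_square_integral_upper:
  fixes g :: "real \<Rightarrow> real"
  assumes t: "t > 0" and g: "continuous_on {0..t} g" and le: "\<And>s. s \<in> {0..t} \<Longrightarrow> g s \<le> m"
  shows "(\<integral>s. (exp (g s))\<^sup>2 \<partial>horizon t) \<le> (exp m)\<^sup>2 * t"
    "integrable (horizon t) (\<lambda>s. (exp (g s))\<^sup>2)"
proof -
  interpret L: finite_measure "horizon t" by (rule finite_measure_horizon)
  note [measurable] = continuous_measurable_horizon[OF g]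
  have bound: "(exp (g s))\<^sup>2 \<le> (exp m)\<^sup>2" if "s \<in> space (horizon t)" for s
    using that le[of s] by (intro power_mono) (auto simp: space_restrict_space)
  show int: "integrable (horizon t) (\<lambda>s. (exp (g s))\<^sup>2)"
    by (rule L.integrable_const_bound[of _ "(exp m)\<^sup>2"]) (use bound in \<open>auto intro!: AE_I2\<close>)
  have "(\<integral>s. (exp (g s))\<^sup>2 \<partial>horizon t) \<le> (\<integral>s. (exp m)\<^sup>2 \<partial>horizon t)"
    by (rule integral_mono[OF int _ bound]) simp
  also have "\<dots> = (exp m)\<^sup>2 * t"
    using t by (simp add: measure_restrict_space space_restrict_space)
  finally show "(\<integral>s. (exp (g s))\<^sup>2 \<partial>horizon t) \<le> (exp m)\<^sup>2 * t" .
qed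

text \<open>For the lower half it is enough that the integrand is large on some interval of length \<open>1\<close>.\<close>

lemma exp_square_integral_lower:
  fixes g :: "real \<Rightarrow> real"
  assumes t: "t > 0" and g: "continuous_on {0..t} g"
    and lu: "0 \<le> l" "l + 1 \<le> t" and ge: "\<And>s. s \<in> {l..l + 1} \<Longrightarrow> k \<le> g s"
  shows "(exp k)\<^sup>2 \<le> (\<integral>s. (exp (g s))\<^sup>2 \<partial>horizon t)"
proof -
  interpret L: finite_measure "horizon t" by (rule finite_measure_horizon)
  obtain C where C: "\<And>u. u \<in> {0..t} \<Longrightarrow> g u \<le> g C"
    using continuous_attains_sup[OF _ _ g(1)] t by fastforce
  have sub: "{l<..l + 1} \<subseteq> {0<..t}" using lu by auto
  have "(\<integral>s. indicator {l<..l + 1} s \<partial>horizon t) = (1::real)"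
  proof -
    have "{l<..l + 1} \<inter> space (horizon t) = {l<..l + 1}" using sub by (auto simp: space_restrict_space)
    moreover have "measure (horizon t) {l<..l + 1} = measure lborel {l<..l + 1}"
      using sub by (intro measure_restrict_space) auto
    ultimately show ?thesis by (simp only: Bochner_Integration.integral_indicator) simp
  qed
  then have "(exp k)\<^sup>2 = (\<integral>s. (exp k)\<^sup>2 * indicator {l<..l + 1} s \<partial>horizon t)"
    by (simp only: integral_mult_right_zero)
  also have "\<dots> \<le> (\<integral>s. (exp (g s))\<^sup>2 \<partial>horizon t)"
  proof (rule integral_mono[OF _ exp_square_integral_upper(2)[OF t g C]])
    show "integrable (horizon t) (\<lambda>s. (exp k)\<^sup>2 * indicator {l<..l + 1} s)"
      using sub by (intro integrable_mult_right integrable_real_indicator)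
        (auto simp: sets_restrict_space_iff L.emeasure_finite less_top[symmetric])
    fix s show "(exp k)\<^sup>2 * indicator {l<..l + 1} s \<le> (exp (g s))\<^sup>2"
      using ge[of s] by (auto simp: indicator_def intro!: power_mono)
  qed auto
  finally show ?thesis .
qed

lemma (in prob_space) scaled_sbm:
  assumes "standard_brownian_motion M B" "t > 0"
  shows "standard_brownian_motion M (\<lambda>s \<omega>. (1 / sqrt t) * B (t * s) \<omega>)"
  by (rule sbm_scale[OF prob_space_axioms assms]) (use assms(2) in \<open>simp add: power_divide\<close>)

text \<open>The conditional variance \<open>V\<close> lies between \<open>exp (2 m - e sqrt t)\<close> and \<open>t exp (2 m)\<close>: the upper
  bound is trivial, and near the time at which the maximum \<open>m\<close> is attained, \<open>c Z\<close> varies over a unit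
  of time by no more than \<open>e sqrt t / 2\<close> with high probability, because a unit of time is a
  vanishing fraction of \<open>t\<close> for the rescaled Brownian motion. A Gaussian variable is of the order of
  its standard deviation.\<close>

lemma (in prob_space) exponential_ito_integral_size:
  fixes W B Z X :: "real \<Rightarrow> 'a \<Rightarrow> real" and c a :: real
  assumes W: "standard_brownian_motion M W" and B: "brownian_wrt M F B"
    and WF: "\<And>s. s \<ge> 0 \<Longrightarrow> W s \<in> borel_measurable (F s)"
    and Z: "\<And>t \<omega>. t \<ge> 0 \<Longrightarrow> \<omega> \<in> space M \<Longrightarrow> Z t \<omega> = a * t + W t \<omega>"
    and N: "space N = space M" "sets N \<subseteq> sets M" and WN: "\<And>s. s \<ge> 0 \<Longrightarrow> W s \<in> borel_measurable N"
    and ind: "indep_rv M N (\<lambda>\<omega>. \<omega>) path_space (sample_path B)"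
    and X: "\<And>t. t \<ge> 0 \<Longrightarrow> is_ito_integral M F B (\<lambda>s \<omega>. exp (c * Z s \<omega>)) t (X t)"
    and c: "c \<noteq> 0" and e: "e > 0" and \<eta>: "\<eta> > 0"
  defines "m \<equiv> \<lambda>t \<omega>. SUP u\<in>{0..1}. c * Z (t * u) \<omega>"
  shows "\<forall>\<^sub>F t in at_top. {\<omega> \<in> space M. \<bar>X t \<omega>\<bar> < exp (m t \<omega> - e * sqrt t)} \<in> events \<and>
      {\<omega> \<in> space M. \<bar>X t \<omega>\<bar> > exp (m t \<omega> + e * sqrt t)} \<in> events \<and>
      prob {\<omega> \<in> space M. \<bar>X t \<omega>\<bar> < exp (m t \<omega> - e * sqrt t)} < \<eta> \<and>
      prob {\<omega> \<in> space M. \<bar>X t \<omega>\<bar> > exp (m t \<omega> + e * sqrt t)} < \<eta>"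
proof -
  \<comment> \<open>One quarter of \<open>e sqrt t\<close> is spent on the oscillation of \<open>c W\<close>, another quarter on the drift.\<close>
  define e' where "e' = e / (4 * \<bar>c\<bar>)"
  have e': "e' > 0" using e c by (simp add: e'_def)
  obtain \<delta> where \<delta>: "\<delta> > 0"
    "\<And>C. standard_brownian_motion M C \<Longrightarrow> prob {\<omega> \<in> space M. sample_path C \<omega> \<notin> osc_event \<delta> e'} < \<eta> / 2"
    using sbm_osc_tight[OF W e', of "\<eta> / 2"] \<eta> by auto
  have Zcont: "continuous_on {0..} (\<lambda>s. Z s \<omega>)" if "\<omega> \<in> space M" for \<omega>
  proof -
    have "continuous_on {0..} (\<lambda>s. a * s + W s \<omega>)"
      by (intro continuous_intros sbm_continuous[OF W that])
    then show ?thesis by (rule continuous_on_eq) (simp add: Z[OF _ that])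
  qed
  have Zmeas: "Z s \<in> borel_measurable G" if "space G = space M" "W s \<in> borel_measurable G" "s \<ge> 0" for G s
  proof -
    have "(\<lambda>\<omega>. a * s + W s \<omega>) \<in> borel_measurable G" using that(2) by measurable
    then show ?thesis
      by (rule measurable_cong[THEN iffD1, rotated]) (simp add: Z that)
  qed
  have spF: "space (F s) = space M" if "s \<ge> 0" for s using B that by (simp add: brownian_wrt_def)
  define H where "H s \<omega> = exp (c * Z s \<omega>)" for s \<omega>
  have HF: "H s \<in> borel_measurable (F s)" and HN: "H s \<in> borel_measurable N" if "s \<ge> 0" for s
    unfolding H_def using Zmeas[OF spF[OF that] WF[OF that] that] Zmeas[OF N(1) WN[OF that] that] by measurable
  have Hcont: "continuous_on {0..} (\<lambda>s. H s \<omega>)" if "\<omega> \<in> space M" for \<omega>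
    unfolding H_def by (intro continuous_intros Zcont[OF that])
  have cZu: "continuous_on {0..1} (\<lambda>u. c * Z (t * u) \<omega>)" if "t > 0" "\<omega> \<in> space M" for t \<omega>
    by (intro continuous_intros continuous_on_compose2[OF Zcont[OF that(2)]]) (use that in auto)
  have mN: "m t \<in> borel_measurable N" if "t > 0" for t
    unfolding m_def
  proof (rule borel_measurable_SUP_path)
    fix u :: real assume "u \<in> {0..1}"
    then have "t * u \<ge> 0" using that by simp
    from Zmeas[OF N(1) WN[OF this] this] show "(\<lambda>\<omega>. c * Z (t * u) \<omega>) \<in> borel_measurable N" by measurable
  qed (use cZu[OF that] N(1) in simp)
  have m_attained: "\<exists>u\<in>{0..1}. m t \<omega> = c * Z (t * u) \<omega>" and m_upper: "\<And>s. s \<in> {0..t} \<Longrightarrow> c * Z s \<omega> \<le> m t \<omega>"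
    if t\<omega>: "t > 0" "\<omega> \<in> space M" for t \<omega>
  proof -
    obtain v where v: "v \<in> {0..1}" "\<And>u. u \<in> {0..1} \<Longrightarrow> c * Z (t * u) \<omega> \<le> c * Z (t * v) \<omega>"
      using continuous_attains_sup[OF _ _ cZu[OF t\<omega>]] by fastforce
    have eq: "m t \<omega> = c * Z (t * v) \<omega>"
      unfolding m_def by (rule cSup_eq_maximum) (use v in auto)
    then show "\<exists>u\<in>{0..1}. m t \<omega> = c * Z (t * u) \<omega>" using v(1) by blast
    fix s assume "s \<in> {0..t}"
    then show "c * Z s \<omega> \<le> m t \<omega>"
      using v(2)[of "s / t"] t\<omega> by (simp add: eq)
  qed
  have cont': "continuous_on {0..t} (\<lambda>s. c * Z s \<omega>)" if "\<omega> \<in> space M" for t \<omega>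
    by (intro continuous_intros continuous_on_subset[OF Zcont[OF that]]) auto
  define V where "V t \<omega> = (\<integral>s. (H s \<omega>)\<^sup>2 \<partial>horizon t)" for t \<omega>
  have V_upper: "V t \<omega> \<le> (exp (m t \<omega>))\<^sup>2 * t" if "t > 0" "\<omega> \<in> space M" for t \<omega>
    unfolding V_def H_def by (rule exp_square_integral_upper[OF that(1) cont'[OF that(2)] m_upper[OF that]])
  have bounds: "emeasure M {\<omega> \<in> space M. \<bar>X t \<omega>\<bar> < r \<omega>} \<le> (\<integral>\<^sup>+\<omega>. ennreal (min 1 (2 * r \<omega> / sqrt (V t \<omega>))) \<partial>M)"
    "emeasure M {\<omega> \<in> space M. \<bar>X t \<omega>\<bar> > r \<omega>} \<le> (\<integral>\<^sup>+\<omega>. ennreal (min 1 (V t \<omega> / (r \<omega>)\<^sup>2)) \<partial>M)"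
    if "t > 0" "r \<in> borel_measurable N" "\<And>\<omega>. \<omega> \<in> space M \<Longrightarrow> r \<omega> > 0" for t r
  proof -
    have J: "is_ito_integral M F B H t (X t)" using X[of t] that(1) by (simp add: H_def[abs_def])
    have H0: "H s \<omega> > 0" for s \<omega> by (simp add: H_def)
    show "emeasure M {\<omega> \<in> space M. \<bar>X t \<omega>\<bar> < r \<omega>} \<le> (\<integral>\<^sup>+\<omega>. ennreal (min 1 (2 * r \<omega> / sqrt (V t \<omega>))) \<partial>M)"
      "emeasure M {\<omega> \<in> space M. \<bar>X t \<omega>\<bar> > r \<omega>} \<le> (\<integral>\<^sup>+\<omega>. ennreal (min 1 (V t \<omega> / (r \<omega>)\<^sup>2)) \<partial>M)"
      unfolding V_def
      by (rule ito_integral_conditional_bounds[OF B J that(1) HF H0 Hcont N HN ind that(2,3)]; assumption)+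
  qed
  have V_lower: "(exp (m t \<omega> - e * sqrt t / 2))\<^sup>2 \<le> V t \<omega>"
    if t: "t \<ge> 2" "1 / t < \<delta>" "\<bar>c\<bar> * \<bar>a\<bar> \<le> e * sqrt t / 4" and \<omega>: "\<omega> \<in> space M"
      and osc: "sample_path (\<lambda>s \<omega>. (1 / sqrt t) * W (t * s) \<omega>) \<omega> \<in> osc_event \<delta> e'" for t \<omega>
  proof -
    have t0: "t > 0" using t by simp
    obtain u where u: "u \<in> {0..1}" "m t \<omega> = c * Z (t * u) \<omega>" using m_attained[OF t0 \<omega>] by blast
    have W_osc: "\<bar>W (t * u) \<omega> - W s \<omega>\<bar> \<le> e' * sqrt t" if s: "s \<in> {0..t}" "\<bar>t * u - s\<bar> \<le> 1" for s
    proof -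
      have "\<bar>u - s / t\<bar> = \<bar>t * u - s\<bar> / t" 
      proof -
        have "u - s / t = (t * u - s) / t" using t0 by (simp add: diff_divide_distrib)
        then show ?thesis using t0 by (simp add: abs_divide)
      qed
      also have "\<dots> \<le> 1 / t" using s t0 by (simp add: divide_right_mono)
      finally have "\<bar>u - s / t\<bar> < \<delta>" using t(2) by simp
      moreover have "s / t \<in> {0..1}" using s t0 by auto
      moreover have "\<forall>r\<in>{0..1}. \<forall>s\<in>{0..1}. \<bar>r - s\<bar> < \<delta> \<longrightarrow>
          \<bar>(1 / sqrt t) * W (t * r) \<omega> - (1 / sqrt t) * W (t * s) \<omega>\<bar> \<le> e'"
        using osc unfolding sample_path_def osc_event_iff[OF sbm_continuous[OF scaled_sbm[OF W t0] \<omega>]] .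
      ultimately have "\<bar>(1 / sqrt t) * W (t * u) \<omega> - (1 / sqrt t) * W (t * (s / t)) \<omega>\<bar> \<le> e'"
        using u(1) by blast
      moreover have "t * (s / t) = s" using t0 by simp
      ultimately have "\<bar>(1 / sqrt t) * (W (t * u) \<omega> - W s \<omega>)\<bar> \<le> e'"
        by (simp only: right_diff_distrib)
      then have "(1 / sqrt t) * \<bar>W (t * u) \<omega> - W s \<omega>\<bar> \<le> e'"
        using t0 by (simp only: abs_mult) simp
      then show ?thesis using t0 by (simp add: pos_divide_le_eq)
    qed
    have low: "m t \<omega> - e * sqrt t / 2 \<le> c * Z s \<omega>" if s: "s \<in> {0..t}" "\<bar>t * u - s\<bar> \<le> 1" for s
    proof -
      have "m t \<omega> - c * Z s \<omega> = c * a * (t * u - s) + c * (W (t * u) \<omega> - W s \<omega>)"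
        using s u t0 \<omega> by (simp add: Z algebra_simps)
      also have "\<dots> \<le> \<bar>c\<bar> * \<bar>a\<bar> * 1 + \<bar>c\<bar> * (e' * sqrt t)"
      proof (rule add_mono)
        have "c * a * (t * u - s) \<le> \<bar>c * a * (t * u - s)\<bar>" by simp
        also have "\<dots> \<le> \<bar>c\<bar> * \<bar>a\<bar> * 1" unfolding abs_mult using s(2) by (intro mult_left_mono) auto
        finally show "c * a * (t * u - s) \<le> \<bar>c\<bar> * \<bar>a\<bar> * 1" .
        have "c * (W (t * u) \<omega> - W s \<omega>) \<le> \<bar>c * (W (t * u) \<omega> - W s \<omega>)\<bar>" by simp
        also have "\<dots> \<le> \<bar>c\<bar> * (e' * sqrt t)"
          unfolding abs_mult using W_osc[OF s] by (intro mult_left_mono) auto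
        finally show "c * (W (t * u) \<omega> - W s \<omega>) \<le> \<bar>c\<bar> * (e' * sqrt t)" .
      qed
      also have "\<dots> \<le> e * sqrt t / 4 + e * sqrt t / 4"
        using t(3) c by (simp add: e'_def)
      finally show ?thesis by simp
    qed
    have "t * u \<in> {0..t}" using u(1) t0 by (auto simp: mult_left_le)
    \<comment> \<open>A unit interval inside \<open>[0, t]\<close> that has the time of the maximum as an endpoint.\<close>
    then obtain l where l: "0 \<le> l" "l + 1 \<le> t" "\<And>s. s \<in> {l..l+1} \<Longrightarrow> \<bar>t * u - s\<bar> \<le> 1"
    proof (cases "t * u + 1 \<le> t")
      case True
      then show ?thesis using that[of "t * u"] \<open>t * u \<in> {0..t}\<close> by auto
    next
      case False
      then show ?thesis using that[of "t * u - 1"] \<open>t * u \<in> {0..t}\<close> t(1) by auto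
    qed
    show ?thesis
      unfolding V_def H_def
      by (rule exp_square_integral_lower[OF t0 cont'[OF \<omega>] l(1,2)]) (use l low in auto)
  qed
  have "\<forall>\<^sub>F t in at_top. t * exp (- (2 * e * sqrt t)) < \<eta>"
    by (rule order_tendstoD(2)[OF _ \<eta>]) (use e in real_asymp)
  moreover have "\<forall>\<^sub>F t in at_top. 2 * exp (- (e * sqrt t / 2)) < \<eta> / 2"
    by (rule order_tendstoD(2)[of _ 0]) (use e \<eta> in \<open>real_asymp | simp\<close>)+
  moreover have "\<forall>\<^sub>F t in at_top. 1 / t < \<delta>"
    by (rule order_tendstoD(2)[OF _ \<delta>(1)]) real_asymp
  moreover have "\<forall>\<^sub>F t in at_top. \<bar>c\<bar> * \<bar>a\<bar> \<le> e * sqrt t / 4"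
  proof -
    have "filterlim (\<lambda>t. e * sqrt t / 4) at_top at_top" using e by real_asymp
    then show ?thesis by (simp add: filterlim_at_top)
  qed
  moreover have "\<forall>\<^sub>F t in at_top. t \<ge> (2::real)" by (rule eventually_ge_at_top)
  ultimately show ?thesis
  proof eventually_elim
    case (elim t)
    then have t0: "t > 0" by simp
    have Xm[measurable]: "X t \<in> borel_measurable M" using X[of t] t0 by (simp add: is_ito_integral_def)
    have rN: "(\<lambda>\<omega>. exp (m t \<omega> - e * sqrt t)) \<in> borel_measurable N" "(\<lambda>\<omega>. exp (m t \<omega> + e * sqrt t)) \<in> borel_measurable N"
      using mN[OF t0] by measurable
    note [measurable] = measurable_larger_sets[OF mN[OF t0] N]
    let ?bad = "{\<omega> \<in> space M. sample_path (\<lambda>s \<omega>. (1 / sqrt t) * W (t * s) \<omega>) \<omega> \<notin> osc_event \<delta> e'}"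
    have sc: "standard_brownian_motion M (\<lambda>s \<omega>. (1 / sqrt t) * W (t * s) \<omega>)" by (rule scaled_sbm[OF W t0])
    have bad: "?bad \<in> events"
      using measurable_sets[OF sbm_path_measurable[OF sc], of "space path_space - osc_event \<delta> e'"] osc_event_measurable[of \<delta> e']
        measurable_space[OF sbm_path_measurable[OF sc]]
      by (auto simp: vimage_def Int_def conj_commute cong: conj_cong elim!: back_subst[of "\<lambda>A. A \<in> events"])
    have "emeasure M {\<omega> \<in> space M. \<bar>X t \<omega>\<bar> < exp (m t \<omega> - e * sqrt t)} \<le>
        (\<integral>\<^sup>+\<omega>. ennreal (min 1 (2 * exp (m t \<omega> - e * sqrt t) / sqrt (V t \<omega>))) \<partial>M)"
      by (rule bounds(1)[OF t0 rN(1)]) simp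
    also have "\<dots> \<le> (\<integral>\<^sup>+\<omega>. indicator ?bad \<omega> + ennreal (2 * exp (- (e * sqrt t / 2))) \<partial>M)"
    proof (rule nn_integral_mono)
      fix \<omega> assume \<omega>: "\<omega> \<in> space M"
      show "ennreal (min 1 (2 * exp (m t \<omega> - e * sqrt t) / sqrt (V t \<omega>))) \<le>
          indicator ?bad \<omega> + ennreal (2 * exp (- (e * sqrt t / 2)))"
      proof (cases "\<omega> \<in> ?bad")
        case True
        have "ennreal (min 1 (2 * exp (m t \<omega> - e * sqrt t) / sqrt (V t \<omega>))) \<le> 1" by (simp add: ennreal_le_1)
        then show ?thesis using True by (simp add: add_increasing2)
      next
        case False
        have "(exp (m t \<omega> - e * sqrt t / 2))\<^sup>2 \<le> V t \<omega>"
          by (rule V_lower[OF _ _ _ \<omega>]) (use elim False \<omega> in auto)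
        then have "exp (m t \<omega> - e * sqrt t / 2) \<le> sqrt (V t \<omega>)" by (rule real_le_rsqrt)
        moreover from this have "sqrt (V t \<omega>) > 0" by (rule less_le_trans[OF exp_gt_zero])
        ultimately have "2 * exp (m t \<omega> - e * sqrt t) / sqrt (V t \<omega>) \<le>
            2 * exp (m t \<omega> - e * sqrt t) / exp (m t \<omega> - e * sqrt t / 2)"
          by (intro divide_left_mono mult_pos_pos) auto
        also have "\<dots> = 2 * exp (- (e * sqrt t / 2))"
        proof -
          have "m t \<omega> - e * sqrt t = (m t \<omega> - e * sqrt t / 2) + - (e * sqrt t / 2)" by simp
          then show ?thesis by (simp only: exp_add) simp
        qed
        finally show ?thesis using False \<omega> by (simp add: ennreal_leI min.coboundedI2)
      qed
    qed
    also have "\<dots> = emeasure M ?bad + ennreal (2 * exp (- (e * sqrt t / 2)))"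
      using bad by (subst nn_integral_add) (auto simp: emeasure_space_1)
    also have "\<dots> < ennreal (\<eta> / 2) + ennreal (\<eta> / 2)"
      using \<delta>(2)[OF sc] elim(2) \<eta>
      by (intro add_strict_mono) (auto simp: emeasure_eq_measure ennreal_lessI)
    also have "\<dots> = ennreal \<eta>" using \<eta> by (simp flip: ennreal_plus)
    finally have small: "prob {\<omega> \<in> space M. \<bar>X t \<omega>\<bar> < exp (m t \<omega> - e * sqrt t)} < \<eta>"
      by (simp add: emeasure_eq_measure ennreal_less_iff)
    have "emeasure M {\<omega> \<in> space M. \<bar>X t \<omega>\<bar> > exp (m t \<omega> + e * sqrt t)} \<le>
        (\<integral>\<^sup>+\<omega>. ennreal (min 1 (V t \<omega> / (exp (m t \<omega> + e * sqrt t))\<^sup>2)) \<partial>M)"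
      by (rule bounds(2)[OF t0 rN(2)]) simp
    also have "\<dots> \<le> (\<integral>\<^sup>+\<omega>. ennreal (t * exp (- (2 * e * sqrt t))) \<partial>M)"
    proof (intro nn_integral_mono ennreal_leI)
      fix \<omega> assume \<omega>: "\<omega> \<in> space M"
      have "V t \<omega> / (exp (m t \<omega> + e * sqrt t))\<^sup>2 \<le> (exp (m t \<omega>))\<^sup>2 * t / (exp (m t \<omega> + e * sqrt t))\<^sup>2"
        using V_upper[OF t0 \<omega>] by (intro divide_right_mono) auto
      also have "\<dots> = t * exp (- (2 * e * sqrt t))"
        by (simp add: exp_add exp_minus power2_eq_square field_simps flip: exp_add)
      finally show "min 1 (V t \<omega> / (exp (m t \<omega> + e * sqrt t))\<^sup>2) \<le> t * exp (- (2 * e * sqrt t))" by simp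
    qed
    also have "\<dots> < ennreal \<eta>" using elim(1) t0 \<eta> by (simp add: emeasure_space_1 ennreal_lessI)
    finally have "prob {\<omega> \<in> space M. \<bar>X t \<omega>\<bar> > exp (m t \<omega> + e * sqrt t)} < \<eta>"
      by (simp add: emeasure_eq_measure ennreal_less_iff)
    with small show ?case by (intro conjI) measurable
  qed
qed

section \<open>Convergence in law up to negligible errors\<close>

text \<open>Slutsky's theorem in a form in which the comparison variables \<open>\<zeta> t\<close> have the law of the limit
  already. The distribution function at \<open>x\<close> is compared with its values at nearby points.\<close>

lemma (in prob_space) converges_in_law_if_close:
  assumes \<xi>: "\<forall>\<^sub>F t in at_top. \<xi> t \<in> borel_measurable M"
    and \<zeta>: "\<And>t. t > 0 \<Longrightarrow> \<zeta> t \<in> borel_measurable M" and \<eta>: "\<eta> \<in> borel_measurable M"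
    and law: "\<And>t x. t > 0 \<Longrightarrow> prob {\<omega> \<in> space M. \<zeta> t \<omega> \<le> x} = prob {\<omega> \<in> space M. \<eta> \<omega> \<le> x}"
    and close: "\<And>e n. e > 0 \<Longrightarrow> n > 0 \<Longrightarrow>
      \<forall>\<^sub>F t in at_top. prob {\<omega> \<in> space M. \<bar>\<xi> t \<omega> - \<zeta> t \<omega>\<bar> > e} < n"
  shows "converges_in_law_at_top M \<xi> \<eta>"
  unfolding converges_in_law_at_top_def
proof (intro conjI \<xi> \<eta> allI impI)
  have cdf: "cdf (distr M borel f) x = prob {\<omega> \<in> space M. f \<omega> \<le> x}" if "f \<in> borel_measurable M" for f x
    unfolding cdf_def using that
    by (subst measure_distr) (auto intro!: arg_cong[where f = prob])
  fix x assume cont: "isCont (cdf (distr M borel \<eta>)) x"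
  show "((\<lambda>t. cdf (distr M borel (\<xi> t)) x) \<longlongrightarrow> cdf (distr M borel \<eta>) x) at_top"
  proof (rule tendstoI)
    fix n :: real assume n: "n > 0"
    obtain d where d: "d > 0" "\<And>y. dist y x < d \<Longrightarrow> dist (cdf (distr M borel \<eta>) y) (cdf (distr M borel \<eta>) x) < n / 2"
      using cont n unfolding continuous_at_eps_delta by (meson half_gt_zero)
    have near: "\<bar>prob {\<omega> \<in> space M. \<eta> \<omega> \<le> y} - prob {\<omega> \<in> space M. \<eta> \<omega> \<le> x}\<bar> < n / 2" if "\<bar>y - x\<bar> < d" for y
      using d(2)[of y] that by (simp add: dist_real_def cdf[OF \<eta>])
    have "\<forall>\<^sub>F t in at_top. prob {\<omega> \<in> space M. \<bar>\<xi> t \<omega> - \<zeta> t \<omega>\<bar> > d / 2} < n / 2"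
      using close[of "d / 2" "n / 2"] d(1) n by simp
    then show "\<forall>\<^sub>F t in at_top. dist (cdf (distr M borel (\<xi> t)) x) (cdf (distr M borel \<eta>) x) < n"
      using \<xi> eventually_gt_at_top[of 0]
    proof eventually_elim
      case (elim t)
      note [measurable] = elim(2) \<zeta>[OF elim(3)]
      let ?bad = "{\<omega> \<in> space M. \<bar>\<xi> t \<omega> - \<zeta> t \<omega>\<bar> > d / 2}"
      have sub: "{\<omega> \<in> space M. \<xi> t \<omega> \<le> x} \<subseteq> {\<omega> \<in> space M. \<zeta> t \<omega> \<le> x + d / 2} \<union> ?bad"
        "{\<omega> \<in> space M. \<zeta> t \<omega> \<le> x - d / 2} \<subseteq> {\<omega> \<in> space M. \<xi> t \<omega> \<le> x} \<union> ?bad"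
      proof -
        have "\<zeta> t \<omega> \<le> x + d / 2" if "\<xi> t \<omega> \<le> x" "\<not> \<bar>\<xi> t \<omega> - \<zeta> t \<omega>\<bar> > d / 2" for \<omega>
          using that by linarith
        then show "{\<omega> \<in> space M. \<xi> t \<omega> \<le> x} \<subseteq> {\<omega> \<in> space M. \<zeta> t \<omega> \<le> x + d / 2} \<union> ?bad" by blast
        have "\<xi> t \<omega> \<le> x" if "\<zeta> t \<omega> \<le> x - d / 2" "\<not> \<bar>\<xi> t \<omega> - \<zeta> t \<omega>\<bar> > d / 2" for \<omega>
          using that by linarith
        then show "{\<omega> \<in> space M. \<zeta> t \<omega> \<le> x - d / 2} \<subseteq> {\<omega> \<in> space M. \<xi> t \<omega> \<le> x} \<union> ?bad" by blast
      qed
      have "prob {\<omega> \<in> space M. \<xi> t \<omega> \<le> x} \<le> prob ({\<omega> \<in> space M. \<zeta> t \<omega> \<le> x + d / 2} \<union> ?bad)"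
        by (intro finite_measure_mono sub) measurable
      also have "\<dots> \<le> prob {\<omega> \<in> space M. \<zeta> t \<omega> \<le> x + d / 2} + prob ?bad"
        by (intro measure_Un_le) measurable
      finally have 1: "prob {\<omega> \<in> space M. \<xi> t \<omega> \<le> x} \<le> prob {\<omega> \<in> space M. \<eta> \<omega> \<le> x + d / 2} + prob ?bad"
        unfolding law[OF elim(3)] .
      have "prob {\<omega> \<in> space M. \<zeta> t \<omega> \<le> x - d / 2} \<le> prob ({\<omega> \<in> space M. \<xi> t \<omega> \<le> x} \<union> ?bad)"
        by (intro finite_measure_mono sub) measurable
      also have "\<dots> \<le> prob {\<omega> \<in> space M. \<xi> t \<omega> \<le> x} + prob ?bad"
        by (intro measure_Un_le) measurable
      finally have 2: "prob {\<omega> \<in> space M. \<eta> \<omega> \<le> x - d / 2} \<le> prob {\<omega> \<in> space M. \<xi> t \<omega> \<le> x} + prob ?bad"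
        unfolding law[OF elim(3)] .
      have "\<bar>prob {\<omega> \<in> space M. \<eta> \<omega> \<le> x + d / 2} - prob {\<omega> \<in> space M. \<eta> \<omega> \<le> x}\<bar> < n / 2"
        "\<bar>prob {\<omega> \<in> space M. \<eta> \<omega> \<le> x - d / 2} - prob {\<omega> \<in> space M. \<eta> \<omega> \<le> x}\<bar> < n / 2"
        by (rule near; use d(1) in simp)+
      with 1 2 elim(1) have "\<bar>prob {\<omega> \<in> space M. \<xi> t \<omega> \<le> x} - prob {\<omega> \<in> space M. \<eta> \<omega> \<le> x}\<bar> < n"
        by linarith
      then show ?case by (simp add: dist_real_def cdf[OF \<eta>] cdf[OF elim(2)])
    qed
  qed
qed

text \<open>The geometric estimate in terms of the extreme heights \<open>T\<close> and \<open>b\<close> of the path: if \<open>ln \<bar>x\<bar>\<close> is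
  \<open>p T\<close> up to \<open>\<epsilon>\<close>, then the level \<open>sol_top p x z\<close> is \<open>T\<close> up to \<open>\<epsilon> / p\<close>, and similarly at the
  bottom.\<close>

lemma sol_dist_estimate:
  fixes p q x y z T b \<epsilon> :: real
  assumes pq: "p > 0" "q > 0" and \<epsilon>: "\<epsilon> \<ge> 0"
    and T: "0 \<le> T" "z \<le> T" and b: "b \<le> 0" "b \<le> z"
    and x: "exp (p * T - \<epsilon>) \<le> \<bar>x\<bar>" "\<bar>x\<bar> \<le> exp (p * T + \<epsilon>)"
    and y: "exp (- q * b - \<epsilon>) \<le> \<bar>y\<bar>" "\<bar>y\<bar> \<le> exp (- q * b + \<epsilon>)"
  defines "R \<equiv> 2 * (T - b) - \<bar>z\<bar>" and "\<kappa> \<equiv> 1 / p + 1 / q"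
  shows "\<bar>sol_dist p q (x, y, z) (0, 0, 0) - R\<bar> \<le> 2 * \<kappa> * \<epsilon> + 2 + 2 * \<kappa> * ln (R + 2 * \<kappa> * \<epsilon> + 3)"
proof -
  define d where "d = sol_dist p q (x, y, z) (0, 0, 0)"
  define G where "G = 2 * (sol_top p x z - sol_bottom q y z) - \<bar>z\<bar>"
  have \<kappa>: "\<kappa> > 0" using pq by (simp add: \<kappa>_def add_pos_pos)
  have "0 < \<bar>x\<bar>" "0 < \<bar>y\<bar>" using x(1) y(1) by (auto intro: less_le_trans[OF exp_gt_zero])
  then have xy: "x \<noteq> 0" "y \<noteq> 0" by auto
  have lnx: "p * T - \<epsilon> \<le> ln \<bar>x\<bar>" "ln \<bar>x\<bar> \<le> p * T + \<epsilon>"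
    using x ln_ge_iff[OF \<open>0 < \<bar>x\<bar>\<close>] ln_mono[OF x(2)] \<open>0 < \<bar>x\<bar>\<close> by simp_all
  have lny: "- q * b - \<epsilon> \<le> ln \<bar>y\<bar>" "ln \<bar>y\<bar> \<le> - q * b + \<epsilon>"
    using y ln_ge_iff[OF \<open>0 < \<bar>y\<bar>\<close>] ln_mono[OF y(2)] \<open>0 < \<bar>y\<bar>\<close> by simp_all
  have lx: "T - \<epsilon> / p \<le> ln \<bar>x\<bar> / p" "ln \<bar>x\<bar> / p \<le> T + \<epsilon> / p"
    using divide_right_mono[OF lnx(1), of p] divide_right_mono[OF lnx(2), of p] pq
    by (simp_all add: diff_divide_distrib add_divide_distrib)
  have ly: "b - \<epsilon> / q \<le> - ln \<bar>y\<bar> / q" "- ln \<bar>y\<bar> / q \<le> b + \<epsilon> / q"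
    using divide_right_mono[OF lny(1), of q] divide_right_mono[OF lny(2), of q] pq
    by (simp_all add: diff_divide_distrib add_divide_distrib)
  have eps: "\<epsilon> / p \<ge> 0" "\<epsilon> / q \<ge> 0" using pq \<epsilon> by auto
  have top: "T - \<epsilon> / p \<le> sol_top p x z" "sol_top p x z \<le> T + \<epsilon> / p"
    using lx T eps by (auto simp: sol_top_def)
  have bot: "b - \<epsilon> / q \<le> sol_bottom q y z" "sol_bottom q y z \<le> b + \<epsilon> / q"
    using ly b eps by (auto simp: sol_bottom_def)
  have GR: "\<bar>G - R\<bar> \<le> 2 * \<kappa> * \<epsilon>"
  proof -
    have "2 * \<kappa> * \<epsilon> = 2 * (\<epsilon> / p) + 2 * (\<epsilon> / q)" by (simp add: \<kappa>_def algebra_simps)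
    then show ?thesis using top bot unfolding G_def R_def by (simp add: abs_le_iff)
  qed
  have upper: "d \<le> G + 2" unfolding d_def G_def by (rule sol_dist_upper[OF pq xy])
  have lower: "G \<le> d + 2 * \<kappa> * ln (max 1 d)" unfolding d_def G_def \<kappa>_def by (rule sol_dist_lower[OF pq xy])
  have "R \<ge> 0" using T b unfolding R_def by (simp add: abs_le_iff)
  moreover have "2 * \<kappa> * \<epsilon> \<ge> 0" using \<kappa> \<epsilon> by simp
  ultimately have "max 1 d \<le> R + 2 * \<kappa> * \<epsilon> + 3" using upper GR by (auto simp: abs_le_iff)
  then have ln: "ln (max 1 d) \<le> ln (R + 2 * \<kappa> * \<epsilon> + 3)" by (subst ln_le_cancel_iff) auto
  then have "2 * \<kappa> * ln (max 1 d) \<le> 2 * \<kappa> * ln (R + 2 * \<kappa> * \<epsilon> + 3)"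
    using \<kappa> by (intro mult_left_mono) auto
  moreover have "0 \<le> 2 * \<kappa> * ln (max 1 d)" using \<kappa> by simp
  ultimately show ?thesis
    using upper lower GR unfolding d_def[symmetric] by (simp add: abs_le_iff)
qed

lemma path_extrema:
  fixes f :: "real \<Rightarrow> real"
  assumes f: "continuous_on {0..1} f"
  obtains s r where "s \<in> {0..1}" "r \<in> {0..1}" "\<forall>u\<in>{0..1}. f r \<le> f u \<and> f u \<le> f s"
    "(SUP u\<in>{0..1}. f u) = f s" "(INF u\<in>{0..1}. f u) = f r"
proof -
  obtain s where s: "s \<in> {0..1}" "\<And>t. t \<in> {0..1} \<Longrightarrow> f t \<le> f s"
    using continuous_attains_sup[OF _ _ f] by fastforce
  obtain r where r: "r \<in> {0..1}" "\<And>t. t \<in> {0..1} \<Longrightarrow> f r \<le> f t"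
    using continuous_attains_inf[OF _ _ f] by fastforce
  have "(SUP s\<in>{0..1}. f s) = f s" using s by (intro cSup_eq_maximum) auto
  moreover have "(INF s\<in>{0..1}. f s) = f r" using r by (intro cInf_eq_minimum) auto
  ultimately show thesis using that[OF s(1) r(1)] s(2) r(2) by blast
qed

lemma SUP_scale:
  fixes f :: "real \<Rightarrow> real"
  assumes f: "continuous_on {0..1} f"
  shows "c \<ge> 0 \<Longrightarrow> (SUP u\<in>{0..1}. c * f u) = c * (SUP u\<in>{0..1}. f u)"
    "c \<ge> 0 \<Longrightarrow> (INF u\<in>{0..1}. c * f u) = c * (INF u\<in>{0..1}. f u)"
    "c \<le> 0 \<Longrightarrow> (SUP u\<in>{0..1}. c * f u) = c * (INF u\<in>{0..1}. f u)"
    "c \<le> 0 \<Longrightarrow> (INF u\<in>{0..1}. c * f u) = c * (SUP u\<in>{0..1}. f u)"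
proof -
  obtain s r where sr: "s \<in> {0..1}" "r \<in> {0..1}" "\<forall>u\<in>{0..1}. f r \<le> f u \<and> f u \<le> f s"
    "(SUP u\<in>{0..1}. f u) = f s" "(INF u\<in>{0..1}. f u) = f r"
    by (rule path_extrema[OF f])
  show "(SUP u\<in>{0..1}. c * f u) = c * (SUP u\<in>{0..1}. f u)" if "c \<ge> 0"
    unfolding sr(4) by (rule cSup_eq_maximum) (use sr that in \<open>auto intro: mult_left_mono\<close>)
  show "(INF u\<in>{0..1}. c * f u) = c * (INF u\<in>{0..1}. f u)" if "c \<ge> 0"
    unfolding sr(5) by (rule cInf_eq_minimum) (use sr that in \<open>auto intro: mult_left_mono\<close>)
  show "(SUP u\<in>{0..1}. c * f u) = c * (INF u\<in>{0..1}. f u)" if "c \<le> 0"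
    unfolding sr(5) by (rule cSup_eq_maximum) (use sr that in \<open>auto intro: mult_left_mono_neg\<close>)
  show "(INF u\<in>{0..1}. c * f u) = c * (SUP u\<in>{0..1}. f u)" if "c \<le> 0"
    unfolding sr(4) by (rule cInf_eq_minimum) (use sr that in \<open>auto intro: mult_left_mono_neg\<close>)
qed

text \<open>With an upward drift the maximum is nearly attained at time \<open>1\<close> and the minimum nearly at time
  \<open>0\<close>: within \<open>\<delta>\<close> of these times \<open>w\<close> changes by at most \<open>e\<close>, and farther away the drift \<open>b \<delta>\<close>
  outweighs the size \<open>\<Lambda>\<close> of \<open>w\<close>. Each of the two extrema enters with the factor \<open>2\<close>, and a negative
  value of \<open>f 1\<close> lies within \<open>e\<close> of \<open>0\<close>.\<close>

lemma range_of_drifted_path: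
  fixes w :: "real \<Rightarrow> real"
  assumes w: "continuous_on {0..1} w" "w 0 = 0"
    and osc: "\<And>r s. r \<in> {0..1} \<Longrightarrow> s \<in> {0..1} \<Longrightarrow> \<bar>r - s\<bar> < \<delta> \<Longrightarrow> \<bar>w r - w s\<bar> \<le> e"
    and bounded: "\<And>s. s \<in> {0..1} \<Longrightarrow> \<bar>w s\<bar> \<le> \<Lambda>"
    and b: "b \<ge> 0" "b * \<delta> \<ge> 2 * \<Lambda>" and e: "e \<ge> 0"
  defines "f \<equiv> \<lambda>u. b * u + w u"
  shows "\<bar>2 * ((SUP u\<in>{0..1}. f u) - (INF u\<in>{0..1}. f u)) - \<bar>f 1\<bar> - f 1\<bar> \<le> 4 * e"
proof -
  have cont: "continuous_on {0..1} f" unfolding f_def by (intro continuous_intros w)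
  obtain s r where sr: "s \<in> {0..1}" "r \<in> {0..1}" "\<forall>u\<in>{0..1}. f r \<le> f u \<and> f u \<le> f s"
    "(SUP u\<in>{0..1}. f u) = f s" "(INF u\<in>{0..1}. f u) = f r"
    by (rule path_extrema[OF cont])
  have f0: "f 0 = 0" by (simp add: f_def w)
  have top: "f s \<le> f 1 + e"
  proof (cases "1 - s < \<delta>")
    case True
    have "b * s \<le> b" using sr(1) b(1) by (simp add: mult_left_le)
    moreover have "\<bar>w s - w 1\<bar> \<le> e" using True sr(1) by (intro osc) auto
    ultimately show ?thesis by (simp add: f_def abs_le_iff)
  next
    case False
    then have "b * \<delta> \<le> b * (1 - s)" using b(1) by (intro mult_left_mono) auto
    with b(2) bounded[OF sr(1)] bounded[of 1] e show ?thesis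
      by (simp add: f_def abs_le_iff algebra_simps)
  qed
  have bottom: "f r \<ge> - e"
  proof (cases "r < \<delta>")
    case True
    have "b * r \<ge> 0" using sr(2) b(1) by simp
    moreover have "\<bar>w r - w 0\<bar> \<le> e" using True sr(2) by (intro osc) auto
    ultimately show ?thesis by (simp add: f_def w abs_le_iff)
  next
    case False
    then have "b * \<delta> \<le> b * r" using b(1) by (intro mult_left_mono) auto
    with b(2) bounded[OF sr(2)] e show ?thesis by (simp add: f_def abs_le_iff)
  qed
  have "f 1 \<le> f s" "f 0 \<le> f s" "f r \<le> f 0" "f r \<le> f 1" using sr by auto
  then show ?thesis
    unfolding sr(4,5) using top bottom f0 by (cases "f 1 \<ge> 0") (auto simp: abs_le_iff)
qed

section \<open>The distance and the range of the height\<close>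

lemma vimage_algebra_path:
  assumes "sample_path W \<in> measurable M path_space"
  shows "space (vimage_algebra (space M) (sample_path W) path_space) = space M"
    "sets (vimage_algebra (space M) (sample_path W) path_space) \<subseteq> sets M"
    "s \<ge> 0 \<Longrightarrow> W s \<in> borel_measurable (vimage_algebra (space M) (sample_path W) path_space)"
proof -
  have fn: "sample_path W \<in> space M \<rightarrow> space path_space"
    using assms by (auto dest: measurable_space)
  show "space (vimage_algebra (space M) (sample_path W) path_space) = space M" by simp
  show "sets (vimage_algebra (space M) (sample_path W) path_space) \<subseteq> sets M"
    unfolding sets_vimage_algebra2[OF fn] using assms by (auto intro: measurable_sets)
  assume "s \<ge> 0"
  from measurable_compose[OF measurable_vimage_algebra1[OF fn] path_coordinate_measurable[OF this]]
  show "W s \<in> borel_measurable (vimage_algebra (space M) (sample_path W) path_space)"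
    using \<open>s \<ge> 0\<close> by (simp add: sample_path_def)
qed

text \<open>The vertical travel of a shortest curve that visits the maximum and the minimum of \<open>f\<close> and
  joins \<open>f 1\<close> to \<open>f 0 = 0\<close>.\<close>

definition path_range :: "(real \<Rightarrow> real) \<Rightarrow> real" where
  "path_range f = 2 * ((SUP u\<in>{0..1}. f u) - (INF u\<in>{0..1}. f u)) - \<bar>f 1\<bar>"

lemma path_range_scale:
  assumes f: "continuous_on {0..1} f"
  shows "path_range (\<lambda>u. c * f u) = \<bar>c\<bar> * path_range f"
  by (cases "c \<ge> 0") (simp_all add: path_range_def SUP_scale[OF f] abs_mult algebra_simps)

lemma path_range_measurable:
  fixes X :: "real \<Rightarrow> 'a \<Rightarrow> real"
  assumes X: "\<And>u. u \<in> {0..1} \<Longrightarrow> X u \<in> borel_measurable N"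
    and cont: "\<And>\<omega>. \<omega> \<in> space N \<Longrightarrow> continuous_on {0..1} (\<lambda>u. X u \<omega>)"
  shows "(\<lambda>\<omega>. path_range (\<lambda>u. X u \<omega>)) \<in> borel_measurable N"
proof -
  have "(\<lambda>\<omega>. SUP u\<in>{0..1}. X u \<omega>) \<in> borel_measurable N"
    by (rule borel_measurable_SUP_path[OF X cont])
  moreover have "(\<lambda>\<omega>. SUP u\<in>{0..1}. - 1 * X u \<omega>) \<in> borel_measurable N"
    by (rule borel_measurable_SUP_path) (use X cont in \<open>auto intro!: continuous_intros\<close>)
  moreover have "X 1 \<in> borel_measurable N" by (rule X) simp
  ultimately have "(\<lambda>\<omega>. 2 * ((SUP u\<in>{0..1}. X u \<omega>) + (SUP u\<in>{0..1}. - 1 * X u \<omega>)) - \<bar>X 1 \<omega>\<bar>) \<in> borel_measurable N"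
    by measurable
  then show ?thesis
  proof (rule measurable_cong[THEN iffD1, rotated])
    fix \<omega> assume "\<omega> \<in> space N"
    from SUP_scale(3)[OF cont[OF this], of "- 1"]
    show "2 * ((SUP u\<in>{0..1}. X u \<omega>) + (SUP u\<in>{0..1}. - 1 * X u \<omega>)) - \<bar>X 1 \<omega>\<bar> = path_range (\<lambda>u. X u \<omega>)"
      by (simp add: path_range_def)
  qed
qed

lemma path_range_bounds:
  assumes f: "continuous_on {0..1} f" "f 0 = 0" and b: "\<And>u. u \<in> {0..1} \<Longrightarrow> \<bar>f u\<bar> \<le> b"
  shows "path_range f \<le> 4 * b" "(SUP u\<in>{0..1}. f u) \<ge> max 0 (f 1)" "(INF u\<in>{0..1}. f u) \<le> min 0 (f 1)"
proof -
  obtain s r where sr: "s \<in> {0..1}" "r \<in> {0..1}" "\<forall>u\<in>{0..1}. f r \<le> f u \<and> f u \<le> f s"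
    "(SUP u\<in>{0..1}. f u) = f s" "(INF u\<in>{0..1}. f u) = f r"
    by (rule path_extrema[OF f(1)])
  show "path_range f \<le> 4 * b"
  proof -
    have "f s \<le> b" "- f r \<le> b" using b[OF sr(1)] b[OF sr(2)] by linarith+
    moreover have "0 \<le> \<bar>f 1\<bar>" by simp
    ultimately show ?thesis unfolding path_range_def sr(4,5) by argo
  qed
  have "f 0 \<le> f s" "f 1 \<le> f s" "f r \<le> f 0" "f r \<le> f 1" using sr(3) by auto
  then show "(SUP u\<in>{0..1}. f u) \<ge> max 0 (f 1)" "(INF u\<in>{0..1}. f u) \<le> min 0 (f 1)"
    unfolding sr(4,5) using f(2) by auto
qed

text \<open>The logarithmic error of the distance is invisible at the scale \<open>sqrt t\<close>.\<close>

lemma log_error_negligible: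
  fixes C \<kappa> e :: real
  assumes "C > 0" "\<kappa> > 0" "e > 0"
  shows "\<forall>\<^sub>F t in at_top. 2 + 2 * \<kappa> * ln (C * t) \<le> e * sqrt t"
proof -
  have "((\<lambda>t. (2 + 2 * \<kappa> * ln (C * t)) / sqrt t) \<longlongrightarrow> 0) at_top" using assms by real_asymp
  then have "\<forall>\<^sub>F t in at_top. (2 + 2 * \<kappa> * ln (C * t)) / sqrt t < e"
    by (rule order_tendstoD(2)) (rule assms)
  then show ?thesis using eventually_gt_at_top[of 0]
    by eventually_elim (simp add: pos_divide_less_eq less_imp_le)
qed

lemma (in prob_space) prob_union5_less:
  assumes "A \<in> events" "B \<in> events" "C \<in> events" "D \<in> events" "E \<in> events"
    "prob A < n / 5" "prob B < n / 5" "prob C < n / 5" "prob D < n / 5" "prob E < n / 5"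
    and sub: "S \<subseteq> A \<union> B \<union> C \<union> D \<union> E"
  shows "prob S < n"
proof -
  have "prob S \<le> prob (A \<union> B \<union> C \<union> D \<union> E)"
    using assms by (intro finite_measure_mono) auto
  also have "\<dots> \<le> prob (A \<union> B \<union> C \<union> D) + prob E" using assms by (intro measure_Un_le) auto
  also have "prob (A \<union> B \<union> C \<union> D) \<le> prob (A \<union> B \<union> C) + prob D" using assms by (intro measure_Un_le) auto
  also have "prob (A \<union> B \<union> C) \<le> prob (A \<union> B) + prob C" using assms by (intro measure_Un_le) auto
  also have "prob (A \<union> B) \<le> prob A + prob B" using assms by (intro measure_Un_le) auto
  finally show ?thesis using assms by simp
qed

lemma (in prob_space) osc_bad_event:
  assumes "standard_brownian_motion M C"
  shows "{\<omega> \<in> space M. sample_path C \<omega> \<notin> osc_event \<delta> e} \<in> events"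
proof -
  note C = sbm_path_measurable[OF assms]
  have "sample_path C -` (space path_space - osc_event \<delta> e) \<inter> space M \<in> events"
    by (intro measurable_sets[OF C] sets.compl_sets osc_event_measurable)
  also have "sample_path C -` (space path_space - osc_event \<delta> e) \<inter> space M = {\<omega> \<in> space M. sample_path C \<omega> \<notin> osc_event \<delta> e}"
    using measurable_space[OF C] by auto
  finally show ?thesis .
qed

text \<open>Outside five events of small probability, the sizes of \<open>X t\<close> and of \<open>Y t\<close> are governed by the
  extrema of the height, and the height is at most of order \<open>t\<close>. The last fact keeps the logarithmic
  error of the distance small.\<close>

lemma (in prob_space) sol_distance_close_to_range:
  fixes p q a :: real and W W1 W2 X Y Z :: "real \<Rightarrow> 'a \<Rightarrow> real"
  assumes pq: "p > 0" "q > 0"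
    and W: "standard_brownian_motion M W" and W1: "standard_brownian_motion M W1"
    and W2: "standard_brownian_motion M W2"
    and ind: "indep_vars (\<lambda>_. path_space) (\<lambda>i. sample_path ([W, W1, W2] ! i)) {..<3}"
    and Z: "\<And>t \<omega>. t \<ge> 0 \<Longrightarrow> \<omega> \<in> space M \<Longrightarrow> Z t \<omega> = a * t + W t \<omega>"
    and X: "is_ito_integral_process M (natural_filtration M (\<lambda>s \<omega>. (W s \<omega>, W1 s \<omega>, W2 s \<omega>)))
           W1 (\<lambda>s \<omega>. exp (p * Z s \<omega>)) X"
    and Y: "is_ito_integral_process M (natural_filtration M (\<lambda>s \<omega>. (W s \<omega>, W1 s \<omega>, W2 s \<omega>)))
           W2 (\<lambda>s \<omega>. exp (- q * Z s \<omega>)) Y"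
    and e: "e > 0" and n: "n > 0"
  shows "\<forall>\<^sub>F t in at_top. prob {\<omega> \<in> space M.
    \<bar>sol_dist p q (X t \<omega>, Y t \<omega>, Z t \<omega>) (0, 0, 0) - path_range (\<lambda>u. Z (t * u) \<omega>)\<bar> > e * sqrt t} < n"
proof -
  define P where "P = (\<lambda>i::nat. [W, W1, W2] ! i)"
  have P: "P 0 = W" "P 1 = W1" "P 2 = W2" "P (Suc 0) = W1" by (simp_all add: P_def)
  let ?\<xi> = "\<lambda>s \<omega>. (W s \<omega>, W1 s \<omega>, W2 s \<omega>)"
  let ?F = "natural_filtration M ?\<xi>"
  let ?N = "vimage_algebra (space M) (sample_path W) path_space"
  have sbmP: "standard_brownian_motion M (P i)" if "i < 3" for i
  proof -
    have "i = 0 \<or> i = 1 \<or> i = 2" using that by auto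
    then show ?thesis using W W1 W2 P by auto
  qed
  have indP: "indep_vars (\<lambda>_. path_space) (\<lambda>i. sample_path (P i)) {..<3}" using ind by (simp add: P_def)
  note bm = independent_family_brownian_wrt[OF sbmP indP, unfolded P(1,2,3)]
  have B1: "brownian_wrt M ?F W1" using bm[of 1] by (simp add: P)
  have B2: "brownian_wrt M ?F W2" using bm[of 2] by (simp add: P)
  have ind1: "indep_rv M ?N (\<lambda>\<omega>. \<omega>) path_space (sample_path W1)"
    using independent_family_path_algebra[OF indP, of 0 1] by (simp add: P)
  have ind2: "indep_rv M ?N (\<lambda>\<omega>. \<omega>) path_space (sample_path W2)"
    using independent_family_path_algebra[OF indP, of 0 2] by (simp add: P)
  note N = vimage_algebra_path[OF sbm_path_measurable[OF W]]
  have WF: "W s \<in> borel_measurable (?F s)" if "s \<ge> 0" for s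
  proof -
    have "(\<lambda>\<omega>. fst (?\<xi> s \<omega>)) \<in> borel_measurable (?F s)"
      by (rule measurable_compose[OF natural_filtration_measurable[OF that order_refl, of ?\<xi>] borel_measurable_continuous_onI])
         (intro continuous_intros)
    then show ?thesis by simp
  qed
  define \<kappa> where "\<kappa> = 1 / p + 1 / q"
  have \<kappa>: "\<kappa> > 0" using pq by (simp add: \<kappa>_def add_pos_pos)
  \<comment> \<open>The errors in the sizes of \<open>X t\<close> and \<open>Y t\<close> contribute \<open>2 \<kappa> e1 sqrt t\<close>, one half of the total error.\<close>
  define e1 where "e1 = e / (4 * \<kappa>)"
  have e1: "e1 > 0" "2 * \<kappa> * e1 = e / 2" using e \<kappa> by (simp_all add: e1_def)
  have JX: "is_ito_integral M ?F W1 (\<lambda>s \<omega>. exp (p * Z s \<omega>)) t (X t)"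
    and JY: "is_ito_integral M ?F W2 (\<lambda>s \<omega>. exp (- q * Z s \<omega>)) t (Y t)" if "t \<ge> 0" for t
    using X Y that by (auto simp: is_ito_integral_process_def)
  have n5: "n / 5 > 0" using n by simp
  define size_ok where "size_ok U m t \<longleftrightarrow>
      {\<omega> \<in> space M. \<bar>U t \<omega>\<bar> < exp (m t \<omega> - e1 * sqrt t)} \<in> events \<and>
      {\<omega> \<in> space M. \<bar>U t \<omega>\<bar> > exp (m t \<omega> + e1 * sqrt t)} \<in> events \<and>
      prob {\<omega> \<in> space M. \<bar>U t \<omega>\<bar> < exp (m t \<omega> - e1 * sqrt t)} < n / 5 \<and>
      prob {\<omega> \<in> space M. \<bar>U t \<omega>\<bar> > exp (m t \<omega> + e1 * sqrt t)} < n / 5"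
    for U m :: "real \<Rightarrow> 'a \<Rightarrow> real" and t
  have pq0: "p \<noteq> 0" "- q \<noteq> 0" using pq by auto
  have sizeX: "\<forall>\<^sub>F t in at_top. size_ok X (\<lambda>t \<omega>. SUP u\<in>{0..1}. p * Z (t * u) \<omega>) t"
    unfolding size_ok_def
    by (rule exponential_ito_integral_size[OF W B1 WF Z N ind1 JX pq0(1) e1(1) n5])
  have sizeY: "\<forall>\<^sub>F t in at_top. size_ok Y (\<lambda>t \<omega>. SUP u\<in>{0..1}. - q * Z (t * u) \<omega>) t"
    unfolding size_ok_def
    by (rule exponential_ito_integral_size[OF W B2 WF Z N ind2 JY pq0(2) e1(1) n5])
  obtain \<delta> where \<delta>: "\<delta> > 0"
    "\<And>C. standard_brownian_motion M C \<Longrightarrow> prob {\<omega> \<in> space M. sample_path C \<omega> \<notin> osc_event \<delta> 1} < n / 5"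
    using sbm_osc_tight[OF W zero_less_one n5] by blast
  obtain k :: nat where k: "1 / \<delta> < real k" using reals_Archimedean2 by blast
  \<comment> \<open>A bound for the argument of the logarithm divided by \<open>t\<close>, valid for \<open>t \<ge> 1\<close>.\<close>
  define C where "C = 4 * \<bar>a\<bar> + 4 * real k + e / 2 + 3"
  have C: "C > 0" using e by (simp add: C_def add_nonneg_pos)
  have err: "\<forall>\<^sub>F t in at_top. 2 + 2 * \<kappa> * ln (C * t) \<le> e / 2 * sqrt t"
    using log_error_negligible[OF C \<kappa>, of "e / 2"] e by simp
  show ?thesis
    using err sizeX sizeY eventually_ge_at_top[of 1]
  proof eventually_elim
    case (elim t)
    then have t: "t \<ge> 1" and t0: "t > 0" by auto
    define mX where "mX \<omega> = (SUP u\<in>{0..1}. p * Z (t * u) \<omega>)" for \<omega>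
    define mY where "mY \<omega> = (SUP u\<in>{0..1}. - q * Z (t * u) \<omega>)" for \<omega>
    let ?C = "\<lambda>s \<omega>. (1 / sqrt t) * W (t * s) \<omega>"
    have sc: "standard_brownian_motion M ?C" by (rule scaled_sbm[OF W t0])
    show ?case
    proof (rule prob_union5_less)
      show "{\<omega> \<in> space M. \<bar>X t \<omega>\<bar> < exp (mX \<omega> - e1 * sqrt t)} \<in> events"
        "prob {\<omega> \<in> space M. \<bar>X t \<omega>\<bar> < exp (mX \<omega> - e1 * sqrt t)} < n / 5"
        "{\<omega> \<in> space M. \<bar>X t \<omega>\<bar> > exp (mX \<omega> + e1 * sqrt t)} \<in> events"
        "prob {\<omega> \<in> space M. \<bar>X t \<omega>\<bar> > exp (mX \<omega> + e1 * sqrt t)} < n / 5"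
        using elim(2) unfolding mX_def size_ok_def by blast+
      show "{\<omega> \<in> space M. \<bar>Y t \<omega>\<bar> < exp (mY \<omega> - e1 * sqrt t)} \<in> events"
        "prob {\<omega> \<in> space M. \<bar>Y t \<omega>\<bar> < exp (mY \<omega> - e1 * sqrt t)} < n / 5"
        "{\<omega> \<in> space M. \<bar>Y t \<omega>\<bar> > exp (mY \<omega> + e1 * sqrt t)} \<in> events"
        "prob {\<omega> \<in> space M. \<bar>Y t \<omega>\<bar> > exp (mY \<omega> + e1 * sqrt t)} < n / 5"
        using elim(3) unfolding mY_def size_ok_def by blast+
      show "{\<omega> \<in> space M. sample_path ?C \<omega> \<notin> osc_event \<delta> 1} \<in> events" by (rule osc_bad_event[OF sc])
      show "prob {\<omega> \<in> space M. sample_path ?C \<omega> \<notin> osc_event \<delta> 1} < n / 5" by (rule \<delta>(2)[OF sc])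
      show "{\<omega> \<in> space M. e * sqrt t < \<bar>sol_dist p q (X t \<omega>, Y t \<omega>, Z t \<omega>) (0, 0, 0) - path_range (\<lambda>u. Z (t * u) \<omega>)\<bar>} \<subseteq>
        {\<omega> \<in> space M. \<bar>X t \<omega>\<bar> < exp (mX \<omega> - e1 * sqrt t)} \<union> {\<omega> \<in> space M. \<bar>X t \<omega>\<bar> > exp (mX \<omega> + e1 * sqrt t)} \<union>
        {\<omega> \<in> space M. \<bar>Y t \<omega>\<bar> < exp (mY \<omega> - e1 * sqrt t)} \<union> {\<omega> \<in> space M. \<bar>Y t \<omega>\<bar> > exp (mY \<omega> + e1 * sqrt t)} \<union>
        {\<omega> \<in> space M. sample_path ?C \<omega> \<notin> osc_event \<delta> 1}"
      proof (rule subsetI, rule ccontr)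
        fix \<omega> assume mem: "\<omega> \<in> {\<omega> \<in> space M. e * sqrt t <
            \<bar>sol_dist p q (X t \<omega>, Y t \<omega>, Z t \<omega>) (0, 0, 0) - path_range (\<lambda>u. Z (t * u) \<omega>)\<bar>}"
          and nmem: "\<omega> \<notin> {\<omega> \<in> space M. \<bar>X t \<omega>\<bar> < exp (mX \<omega> - e1 * sqrt t)} \<union>
            {\<omega> \<in> space M. \<bar>X t \<omega>\<bar> > exp (mX \<omega> + e1 * sqrt t)} \<union>
            {\<omega> \<in> space M. \<bar>Y t \<omega>\<bar> < exp (mY \<omega> - e1 * sqrt t)} \<union>
            {\<omega> \<in> space M. \<bar>Y t \<omega>\<bar> > exp (mY \<omega> + e1 * sqrt t)} \<union>
            {\<omega> \<in> space M. sample_path ?C \<omega> \<notin> osc_event \<delta> 1}"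
        have \<omega>: "\<omega> \<in> space M"
          and far: "e * sqrt t < \<bar>sol_dist p q (X t \<omega>, Y t \<omega>, Z t \<omega>) (0, 0, 0) - path_range (\<lambda>u. Z (t * u) \<omega>)\<bar>"
          using mem by blast+
        have osc: "sample_path ?C \<omega> \<in> osc_event \<delta> 1" using nmem \<omega> by blast
        have x: "exp (mX \<omega> - e1 * sqrt t) \<le> \<bar>X t \<omega>\<bar>" "\<bar>X t \<omega>\<bar> \<le> exp (mX \<omega> + e1 * sqrt t)"
          and y: "exp (mY \<omega> - e1 * sqrt t) \<le> \<bar>Y t \<omega>\<bar>" "\<bar>Y t \<omega>\<bar> \<le> exp (mY \<omega> + e1 * sqrt t)"
          unfolding not_less[symmetric] using nmem \<omega> by blast+
        define f where "f u = Z (t * u) \<omega>" for u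
        have f_eq: "f u = a * (t * u) + W (t * u) \<omega>" if "u \<ge> 0" for u
          using that t0 Z[OF _ \<omega>, of "t * u"] by (simp add: f_def)
        have f: "continuous_on {0..1} f"
        proof -
          have "continuous_on {0..1} (\<lambda>u. a * (t * u) + W (t * u) \<omega>)"
            by (intro continuous_intros continuous_on_compose2[OF sbm_continuous[OF W \<omega>]]) (use t0 in auto)
          then show ?thesis by (rule continuous_on_eq) (simp add: f_eq)
        qed
        have f0: "f 0 = 0" using f_eq[of 0] by (simp add: sbm_zero[OF W \<omega>])
        have f1: "f 1 = Z t \<omega>" by (simp add: f_def)
        have f_bound: "\<bar>f u\<bar> \<le> \<bar>a\<bar> * t + sqrt t * real k" if u: "u \<in> {0..1}" for u
        proof -
          have osc': "\<forall>r\<in>{0..1}. \<forall>s\<in>{0..1}. \<bar>r - s\<bar> < \<delta> \<longrightarrow> \<bar>?C r \<omega> - ?C s \<omega>\<bar> \<le> 1"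
            using osc unfolding sample_path_def osc_event_iff[OF sbm_continuous[OF sc \<omega>]] .
          have "\<bar>?C u \<omega>\<bar> \<le> real k * 1"
            by (rule osc_event_bounded[of \<delta> "\<lambda>s. ?C s \<omega>" 1 k u])
               (use osc' k \<delta>(1) u sbm_zero[OF W \<omega>] in auto)
          then have "(1 / sqrt t) * \<bar>W (t * u) \<omega>\<bar> \<le> real k" using t0 by (simp only: abs_mult) simp
          then have "\<bar>W (t * u) \<omega>\<bar> \<le> sqrt t * real k" using t0 by (simp add: pos_divide_le_eq mult.commute)
          moreover have "\<bar>a * (t * u)\<bar> \<le> \<bar>a\<bar> * t"
            unfolding abs_mult using u t0 by (intro mult_left_mono) (auto simp: mult_left_le)
          ultimately show ?thesis using f_eq[of u] u by (auto intro: order_trans[OF abs_triangle_ineq])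
        qed
        define T where "T = (SUP u\<in>{0..1}. f u)"
        define b where "b = (INF u\<in>{0..1}. f u)"
        have Tb: "0 \<le> T" "f 1 \<le> T" "b \<le> 0" "b \<le> f 1"
          using path_range_bounds(2,3)[OF f f0 f_bound] by (auto simp: T_def b_def)
        have mX: "mX \<omega> = p * T"
          unfolding mX_def T_def f_def[symmetric] using pq by (intro SUP_scale(1)[OF f]) simp
        have mY: "mY \<omega> = - q * b"
          unfolding mY_def b_def f_def[symmetric] using pq by (intro SUP_scale(3)[OF f]) simp
        have R: "path_range f = 2 * (T - b) - \<bar>Z t \<omega>\<bar>" by (simp add: path_range_def T_def b_def f1)
        have est: "\<bar>sol_dist p q (X t \<omega>, Y t \<omega>, Z t \<omega>) (0, 0, 0) - path_range f\<bar> \<le>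
            2 * \<kappa> * (e1 * sqrt t) + 2 + 2 * \<kappa> * ln (path_range f + 2 * \<kappa> * (e1 * sqrt t) + 3)"
          unfolding R \<kappa>_def
          by (rule sol_dist_estimate[OF pq]) (use e1 t0 Tb f1 x y mX mY in auto)
        have half: "2 * \<kappa> * (e1 * sqrt t) = e / 2 * sqrt t" using e1(2) by (simp add: mult.assoc[symmetric])
        have R0: "0 \<le> path_range f" using Tb unfolding R f1[symmetric] by (simp add: abs_le_iff)
        have sq: "sqrt t \<le> t" "1 \<le> t" using t by (auto intro: real_le_lsqrt simp: power2_eq_square)
        have "path_range f + e / 2 * sqrt t + 3 \<le> C * t"
        proof -
          have "path_range f \<le> 4 * (\<bar>a\<bar> * t + sqrt t * real k)" by (rule path_range_bounds(1)[OF f f0 f_bound])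
          moreover have "sqrt t * real k \<le> t * real k" "e / 2 * sqrt t \<le> e / 2 * t"
            using sq e by (auto intro!: mult_right_mono)
          ultimately show ?thesis using sq unfolding C_def by (simp add: algebra_simps)
        qed
        then have "ln (path_range f + e / 2 * sqrt t + 3) \<le> ln (C * t)"
          using R0 e t0 by (intro ln_mono) (auto intro: add_nonneg_pos)
        then have "2 * \<kappa> * ln (path_range f + e / 2 * sqrt t + 3) \<le> 2 * \<kappa> * ln (C * t)"
          using \<kappa> by (intro mult_left_mono) auto
        with est elim(1) have "\<bar>sol_dist p q (X t \<omega>, Y t \<omega>, Z t \<omega>) (0, 0, 0) - path_range f\<bar> \<le> e * sqrt t"
          unfolding half by linarith
        with far show False unfolding f_def[symmetric] by simp
      qed
    qed
  qed
qed

section \<open>The limit theorem\<close>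

theorem theorem3p7:
  fixes M :: "'a measure"
    and p q a :: real
    and W W1 W2 X Y Z :: "real \<Rightarrow> 'a \<Rightarrow> real"
  assumes "prob_space M"
    and "p > 0" and "q > 0"
    and "standard_brownian_motion M W"
    and "standard_brownian_motion M W1"
    and "standard_brownian_motion M W2"
    and "prob_space.indep_vars M (\<lambda>_. Pi\<^sub>M {0..} (\<lambda>_. borel))
           (\<lambda>i \<omega>. \<lambda>t\<in>{0..}. ([W, W1, W2] ! i) t \<omega>) {..<3}"
    and "\<And>t \<omega>. t \<ge> 0 \<Longrightarrow> \<omega> \<in> space M \<Longrightarrow> Z t \<omega> = a * t + W t \<omega>"
    and "is_ito_integral_process M (natural_filtration M (\<lambda>s \<omega>. (W s \<omega>, W1 s \<omega>, W2 s \<omega>)))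
           W1 (\<lambda>s \<omega>. exp (p * Z s \<omega>)) X"
    and "is_ito_integral_process M (natural_filtration M (\<lambda>s \<omega>. (W s \<omega>, W1 s \<omega>, W2 s \<omega>)))
           W2 (\<lambda>s \<omega>. exp (- q * Z s \<omega>)) Y"
  shows "(a \<noteq> 0 \<longrightarrow>
           converges_in_law_at_top M
             (\<lambda>t \<omega>. (sol_dist p q (X t \<omega>, Y t \<omega>, Z t \<omega>) (0, 0, 0) - \<bar>a\<bar> * t) / sqrt t)
             (\<lambda>\<omega>. W 1 \<omega>)) \<and>
         (a = 0 \<longrightarrow>
           converges_in_law_at_top M
             (\<lambda>t \<omega>. sol_dist p q (X t \<omega>, Y t \<omega>, Z t \<omega>) (0, 0, 0) / sqrt t)
             (\<lambda>\<omega>. 2 * ((SUP s\<in>{0..1}. W s \<omega>) - (INF s\<in>{0..1}. W s \<omega>)) - \<bar>W 1 \<omega>\<bar>))"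
proof -
  interpret prob_space M by fact
  note pq = assms(2,3) and W = assms(4) and Z = assms(8)
  define d where "d t \<omega> = sol_dist p q (X t \<omega>, Y t \<omega>, Z t \<omega>) (0, 0, 0)" for t \<omega>
  define R where "R t \<omega> = path_range (\<lambda>u. Z (t * u) \<omega>)" for t \<omega>
  have "(\<lambda>i. sample_path ([W, W1, W2] ! i)) = (\<lambda>i \<omega>. \<lambda>t\<in>{0..}. ([W, W1, W2] ! i) t \<omega>)"
    by (simp add: fun_eq_iff sample_path_def)
  then have ind: "indep_vars (\<lambda>_. path_space) (\<lambda>i. sample_path ([W, W1, W2] ! i)) {..<3}"
    using assms(7) by simp
  have close: "\<forall>\<^sub>F t in at_top. prob {\<omega> \<in> space M. \<bar>d t \<omega> - R t \<omega>\<bar> > e * sqrt t} < n"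
    if "e > 0" "n > 0" for e n
    unfolding d_def R_def
    by (rule sol_distance_close_to_range[OF pq W assms(5,6) ind Z assms(9,10) that])
  have Zm: "Z t \<in> borel_measurable M" if "t \<ge> 0" for t
  proof -
    have "(\<lambda>\<omega>. a * t + W t \<omega>) \<in> borel_measurable M" using sbm_measurable[OF W that] by measurable
    then show ?thesis by (rule measurable_cong[THEN iffD1, rotated]) (simp add: Z that)
  qed
  have dm: "d t \<in> borel_measurable M" if "t \<ge> 0" for t
  proof -
    have "X t \<in> borel_measurable M" "Y t \<in> borel_measurable M"
      using assms(9,10) that by (auto simp: is_ito_integral_process_def is_ito_integral_def)
    with Zm[OF that] have "(\<lambda>\<omega>. (X t \<omega>, Y t \<omega>, Z t \<omega>)) \<in> borel_measurable M" by measurable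
    from measurable_compose[OF this sol_dist_measurable] show ?thesis by (simp add: d_def[abs_def])
  qed
  define w where "w t u \<omega> = (1 / sqrt t) * W (t * u) \<omega>" for t u \<omega>
  have w: "standard_brownian_motion M (w t)" if "t > 0" for t
    unfolding w_def by (rule scaled_sbm[OF W that])
  have w_cont: "continuous_on {0..1} (\<lambda>u. w t u \<omega>)" if "t > 0" "\<omega> \<in> space M" for t \<omega>
    by (rule continuous_on_subset[OF sbm_continuous[OF w[OF that(1)] that(2)]]) auto
  have Zw: "Z (t * u) \<omega> = sqrt t * (a * sqrt t * u + w t u \<omega>)" if "t > 0" "\<omega> \<in> space M" "u \<in> {0..1}" for t u \<omega>
  proof -
    have "t * u \<ge> 0" using that by simp
    then have "Z (t * u) \<omega> = a * (t * u) + W (t * u) \<omega>" using Z that by simp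
    moreover have "sqrt t * (a * sqrt t * u) = a * (t * u)"
      using that(1) by (simp add: mult.assoc mult.left_commute)
    moreover have "sqrt t * w t u \<omega> = W (t * u) \<omega>" using that(1) by (simp add: w_def)
    ultimately show ?thesis by (simp only: distrib_left)
  qed
  have R_eq: "R t \<omega> = sqrt t * path_range (\<lambda>u. a * sqrt t * u + w t u \<omega>)" if "t > 0" "\<omega> \<in> space M" for t \<omega>
  proof -
    have "R t \<omega> = path_range (\<lambda>u. sqrt t * (a * sqrt t * u + w t u \<omega>))"
      unfolding R_def path_range_def using Zw[OF that] Zw[OF that, of 1] by simp
    also have "\<dots> = sqrt t * path_range (\<lambda>u. a * sqrt t * u + w t u \<omega>)"
      using that by (subst path_range_scale) (auto intro!: continuous_intros w_cont)
    finally show ?thesis .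
  qed
  have Rm: "R t \<in> borel_measurable M" if t: "t > 0" for t
  proof -
    have "continuous_on {0..1} (\<lambda>u. Z (t * u) \<omega>)" if \<omega>: "\<omega> \<in> space M" for \<omega>
    proof -
      have "continuous_on {0..1} (\<lambda>u. sqrt t * (a * sqrt t * u + w t u \<omega>))"
        by (intro continuous_intros w_cont[OF t \<omega>])
      then show ?thesis by (rule continuous_on_eq) (simp add: Zw[OF t \<omega>])
    qed
    then show ?thesis
      unfolding R_def using t by (intro path_range_measurable Zm) auto
  qed
  show ?thesis
  proof (intro conjI impI)
    assume a: "a \<noteq> 0"
    \<comment> \<open>For \<open>a < 0\<close> the reflected motion takes over the role of \<open>W\<close>; it has the same law.\<close>
    define k where "k t = sgn a / sqrt t" for t
    have k: "(k t)\<^sup>2 * t = 1" if "t > 0" for t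
      using a that by (simp add: k_def power_divide sgn_if)
    have kw: "k t * W t \<omega> = sgn a * w t 1 \<omega>" for t \<omega> by (simp add: k_def w_def)
    have "converges_in_law_at_top M (\<lambda>t \<omega>. (d t \<omega> - \<bar>a\<bar> * t) / sqrt t) (W 1)"
    proof (rule converges_in_law_if_close[where \<zeta> = "\<lambda>t \<omega>. k t * W t \<omega>"])
      show "\<forall>\<^sub>F t in at_top. (\<lambda>\<omega>. (d t \<omega> - \<bar>a\<bar> * t) / sqrt t) \<in> borel_measurable M"
        using eventually_ge_at_top[of 0]
      proof eventually_elim
        case (elim t)
        note [measurable] = dm[OF elim]
        show ?case by measurable
      qed
      show "(\<lambda>\<omega>. k t * W t \<omega>) \<in> borel_measurable M" if "t > 0" for t
        using sbm_measurable[OF W less_imp_le[OF that]] by measurable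
      show "W 1 \<in> borel_measurable M" by (rule sbm_measurable[OF W]) simp
      fix t x :: real assume t: "t > 0"
      let ?E = "{w \<in> space path_space. w 1 \<le> x}"
      have "(\<lambda>w. w 1) \<in> borel_measurable path_space" by (rule path_coordinate_measurable) simp
      then have E: "?E \<in> sets path_space" by measurable
      have mem: "sample_path U \<omega> \<in> ?E \<longleftrightarrow> U 1 \<omega> \<le> x" for U :: "real \<Rightarrow> 'a \<Rightarrow> real" and \<omega>
        by (auto simp: sample_path_def space_PiM)
      have "standard_brownian_motion M (\<lambda>s \<omega>. k t * W (t * s) \<omega>)"
        by (rule sbm_scale[OF prob_space_axioms W t k[OF t]])
      from sbm_event_prob_eq[OF this W E]
      show "prob {\<omega> \<in> space M. k t * W t \<omega> \<le> x} = prob {\<omega> \<in> space M. W 1 \<omega> \<le> x}"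
        unfolding mem by simp
    next
      fix e n :: real assume e: "e > 0" and n: "n > 0"
      obtain \<delta> where \<delta>: "\<delta> > 0"
        "\<And>C. standard_brownian_motion M C \<Longrightarrow> prob {\<omega> \<in> space M. sample_path C \<omega> \<notin> osc_event \<delta> (e / 8)} < n / 2"
        using sbm_osc_tight[OF W, of "e / 8" "n / 2"] e n by auto
      obtain j :: nat where j: "1 / \<delta> < real j" using reals_Archimedean2 by blast
      have "filterlim (\<lambda>t. \<bar>a\<bar> * sqrt t * \<delta>) at_top at_top" using a \<delta>(1) by real_asymp
      then have drift: "\<forall>\<^sub>F t in at_top. 2 * (real j * (e / 8)) \<le> \<bar>a\<bar> * sqrt t * \<delta>"
        unfolding filterlim_at_top by (rule spec)
      have "\<forall>\<^sub>F t in at_top. prob {\<omega> \<in> space M. \<bar>d t \<omega> - R t \<omega>\<bar> > e / 2 * sqrt t} < n / 2"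
        using close[of "e / 2" "n / 2"] e n by simp
      then show "\<forall>\<^sub>F t in at_top. prob {\<omega> \<in> space M. \<bar>(d t \<omega> - \<bar>a\<bar> * t) / sqrt t - k t * W t \<omega>\<bar> > e} < n"
        using drift eventually_gt_at_top[of 0]
      proof eventually_elim
        case (elim t)
        note t = elim(3)
        define bad where "bad = {\<omega> \<in> space M. \<bar>d t \<omega> - R t \<omega>\<bar> > e / 2 * sqrt t}"
        define bad' where "bad' = {\<omega> \<in> space M. sample_path (w t) \<omega> \<notin> osc_event \<delta> (e / 8)}"
        have bad': "bad' \<in> events" unfolding bad'_def by (rule osc_bad_event[OF w[OF t]])
        have drifted: "\<bar>R t \<omega> / sqrt t - \<bar>a\<bar> * sqrt t - k t * W t \<omega>\<bar> \<le> e / 2"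
          if \<omega>: "\<omega> \<in> space M" "\<omega> \<notin> bad'" for \<omega>
        proof -
          \<comment> \<open>Reflection makes the drift point upwards without changing the range.\<close>
          define v where "v u = sgn a * w t u \<omega>" for u
          have w_osc: "\<bar>w t r \<omega> - w t s \<omega>\<bar> \<le> e / 8" if "r \<in> {0..1}" "s \<in> {0..1}" "\<bar>r - s\<bar> < \<delta>" for r s
          proof -
            have "sample_path (w t) \<omega> \<in> osc_event \<delta> (e / 8)" using \<omega> by (simp add: bad'_def)
            then show ?thesis
              unfolding sample_path_def osc_event_iff[OF sbm_continuous[OF w[OF t] \<omega>(1)]] using that by blast
          qed
          have abs_sgn: "\<bar>sgn a * x\<bar> = \<bar>x\<bar>" for x using a by (simp add: abs_mult sgn_if)
          have v_cont: "continuous_on {0..1} v" unfolding v_def by (intro continuous_intros w_cont[OF t \<omega>(1)])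
          have v_zero: "v 0 = 0" using sbm_zero[OF w[OF t] \<omega>(1)] by (simp add: v_def)
          have v_osc: "\<bar>v r - v s\<bar> \<le> e / 8" if "r \<in> {0..1}" "s \<in> {0..1}" "\<bar>r - s\<bar> < \<delta>" for r s
            using w_osc[OF that] by (simp only: v_def right_diff_distrib[symmetric] abs_sgn)
          have v_bound: "\<bar>v s\<bar> \<le> real j * (e / 8)" if "s \<in> {0..1}" for s
            by (rule osc_event_bounded[of \<delta> v "e / 8" j s, OF v_osc j \<delta>(1) v_zero that])
          have main: "\<bar>path_range (\<lambda>u. \<bar>a\<bar> * sqrt t * u + v u) - (\<bar>a\<bar> * sqrt t + v 1)\<bar> \<le> 4 * (e / 8)"
            using range_of_drifted_path[of v \<delta> "e / 8" "real j * (e / 8)" "\<bar>a\<bar> * sqrt t",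
                OF v_cont v_zero v_osc v_bound _ elim(2)] t e
            by (simp add: path_range_def diff_diff_eq)
          have "(\<lambda>u. \<bar>a\<bar> * sqrt t * u + v u) = (\<lambda>u. sgn a * (a * sqrt t * u + w t u \<omega>))"
            by (simp add: v_def fun_eq_iff algebra_simps abs_sgn[of a, simplified] mult_sgn_abs sgn_if abs_if)
          then have "path_range (\<lambda>u. \<bar>a\<bar> * sqrt t * u + v u) = \<bar>sgn a\<bar> * path_range (\<lambda>u. a * sqrt t * u + w t u \<omega>)"
            by (simp only:) (rule path_range_scale, intro continuous_intros w_cont[OF t \<omega>(1)])
          also have "\<bar>sgn a\<bar> = 1" using a by (simp add: sgn_if)
          finally have "path_range (\<lambda>u. \<bar>a\<bar> * sqrt t * u + v u) = R t \<omega> / sqrt t"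
            using R_eq[OF t \<omega>(1)] t by simp
          with main show ?thesis unfolding kw v_def by (simp add: diff_diff_eq)
        qed
        have "{\<omega> \<in> space M. \<bar>(d t \<omega> - \<bar>a\<bar> * t) / sqrt t - k t * W t \<omega>\<bar> > e} \<subseteq> bad \<union> bad'"
        proof (rule subsetI, rule ccontr)
          fix \<omega> assume mem: "\<omega> \<in> {\<omega> \<in> space M. \<bar>(d t \<omega> - \<bar>a\<bar> * t) / sqrt t - k t * W t \<omega>\<bar> > e}"
            and nmem: "\<omega> \<notin> bad \<union> bad'"
          then have \<omega>: "\<omega> \<in> space M" by blast
          have "\<bar>d t \<omega> - R t \<omega>\<bar> \<le> e / 2 * sqrt t" using nmem \<omega> by (simp add: bad_def not_less)
          then have "\<bar>d t \<omega> - R t \<omega>\<bar> / sqrt t \<le> e / 2" using t by (simp add: pos_divide_le_eq)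
          then have "\<bar>d t \<omega> / sqrt t - R t \<omega> / sqrt t\<bar> \<le> e / 2"
            using t by (simp only: diff_divide_distrib[symmetric] abs_divide) simp
          moreover have "(d t \<omega> - \<bar>a\<bar> * t) / sqrt t = d t \<omega> / sqrt t - \<bar>a\<bar> * sqrt t"
            using t by (simp add: diff_divide_distrib real_div_sqrt flip: times_divide_eq_right)
          moreover have "\<bar>R t \<omega> / sqrt t - \<bar>a\<bar> * sqrt t - k t * W t \<omega>\<bar> \<le> e / 2"
            using drifted[OF \<omega>] nmem by blast
          ultimately have "\<bar>(d t \<omega> - \<bar>a\<bar> * t) / sqrt t - k t * W t \<omega>\<bar> \<le> e" by linarith
          with mem show False by simp
        qed
        moreover have "bad \<in> events"
        proof -
          note [measurable] = dm[OF less_imp_le[OF t]] Rm[OF t]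
          show ?thesis unfolding bad_def by measurable
        qed
        ultimately have "prob {\<omega> \<in> space M. \<bar>(d t \<omega> - \<bar>a\<bar> * t) / sqrt t - k t * W t \<omega>\<bar> > e} \<le> prob (bad \<union> bad')"
          using bad' by (intro finite_measure_mono) auto
        also have "\<dots> \<le> prob bad + prob bad'" using bad' \<open>bad \<in> events\<close> by (intro measure_Un_le)
        also have "\<dots> < n" using elim(1) \<delta>(2)[OF w[OF t]] unfolding bad_def bad'_def by simp
        finally show ?case .
      qed
    qed
    then show "converges_in_law_at_top M
             (\<lambda>t \<omega>. (sol_dist p q (X t \<omega>, Y t \<omega>, Z t \<omega>) (0, 0, 0) - \<bar>a\<bar> * t) / sqrt t) (\<lambda>\<omega>. W 1 \<omega>)"
      by (simp add: d_def)
  next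
    assume a: "a = 0"
    have rm: "(\<lambda>\<omega>. path_range (\<lambda>u. B u \<omega>)) \<in> borel_measurable M" if B: "standard_brownian_motion M B" for B
      by (rule path_range_measurable[OF sbm_measurable[OF B] continuous_on_subset[OF sbm_continuous[OF B]]]) auto
    have "converges_in_law_at_top M (\<lambda>t \<omega>. d t \<omega> / sqrt t) (\<lambda>\<omega>. path_range (\<lambda>u. W u \<omega>))"
    proof (rule converges_in_law_if_close[where \<zeta> = "\<lambda>t \<omega>. path_range (\<lambda>u. w t u \<omega>)"])
      show "\<forall>\<^sub>F t in at_top. (\<lambda>\<omega>. d t \<omega> / sqrt t) \<in> borel_measurable M"
        using eventually_ge_at_top[of 0]
      proof eventually_elim
        case (elim t)
        note [measurable] = dm[OF elim]
        show ?case by measurable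
      qed
      show "(\<lambda>\<omega>. path_range (\<lambda>u. w t u \<omega>)) \<in> borel_measurable M" if "t > 0" for t by (rule rm[OF w[OF that]])
      show "(\<lambda>\<omega>. path_range (\<lambda>u. W u \<omega>)) \<in> borel_measurable M" by (rule rm[OF W])
      fix t x :: real assume t: "t > 0"
      have mem: "{\<omega> \<in> space M. path_range (\<lambda>u. B u \<omega>) \<le> x} = {\<omega> \<in> space M. sample_path B \<omega> \<in> range_event x}"
        if B: "standard_brownian_motion M B" for B
        using range_event_iff[OF sbm_continuous[OF B]] by (auto simp: path_range_def sample_path_def)
      show "prob {\<omega> \<in> space M. path_range (\<lambda>u. w t u \<omega>) \<le> x} = prob {\<omega> \<in> space M. path_range (\<lambda>u. W u \<omega>) \<le> x}"
        unfolding mem[OF w[OF t]] mem[OF W] by (rule sbm_event_prob_eq[OF w[OF t] W range_event_measurable])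
    next
      fix e n :: real assume e: "e > 0" and n: "n > 0"
      show "\<forall>\<^sub>F t in at_top. prob {\<omega> \<in> space M. \<bar>d t \<omega> / sqrt t - path_range (\<lambda>u. w t u \<omega>)\<bar> > e} < n"
        using close[OF e n] eventually_gt_at_top[of 0]
      proof eventually_elim
        case (elim t)
        have "\<bar>d t \<omega> / sqrt t - path_range (\<lambda>u. w t u \<omega>)\<bar> > e \<longleftrightarrow> \<bar>d t \<omega> - R t \<omega>\<bar> > e * sqrt t"
          if "\<omega> \<in> space M" for \<omega>
        proof -
          have "d t \<omega> / sqrt t - path_range (\<lambda>u. w t u \<omega>) = (d t \<omega> - R t \<omega>) / sqrt t"
            using R_eq[OF elim(2) that] elim(2) by (simp add: a diff_divide_distrib)
          then show ?thesis using elim(2) by (simp add: abs_divide pos_less_divide_eq)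
        qed
        then show ?case using elim(1) by (simp cong: conj_cong)
      qed
    qed
    then show "converges_in_law_at_top M (\<lambda>t \<omega>. sol_dist p q (X t \<omega>, Y t \<omega>, Z t \<omega>) (0, 0, 0) / sqrt t)
        (\<lambda>\<omega>. 2 * ((SUP s\<in>{0..1}. W s \<omega>) - (INF s\<in>{0..1}. W s \<omega>)) - \<bar>W 1 \<omega>\<bar>)"
      by (simp add: d_def path_range_def)
  qed
qed

end
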